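(* Let $X$ be an affine rational complexity-one $T$-variety with coordinate ring $R_X$, and let $\mathfrak{v}$ be a full rank valuation on $R_X$ which is homogeneous with respect to the grading of $R_X$ by the character lattice $M$ of $T$ induced by the $T$-action. Then $X$ has a semi-canonical embedding for which the corresponding generators of $R_X$ form a Khovanskii basis for $\mathfrak{v}$.
   Context: $\mathbb{K}$ is an algebraically closed field. $T$ is an algebraic torus with character lattice $M$ and cocharacter lattice $N$; $N_\mathbb{Q}=N\otimes\mathbb{Q}$. A $T$-variety is a normal irreducible variety with an effective $T$-action; it has complexity one if $\dim T=\dim X-1$. Valuations. Let $R$ be a finitely generated $\mathbb{K}$-domain of Krull dimension $d$ and $\Gamma$ a totally ordered finitely generated free abelian group. A $\mathbb{K}$-valuation is a map $\mathfrak{v}:R\setminus\{0\}\to\Gamma$ with $\mathfrak{v}(\mathbb{K}^* )=0$, $\mathfrak{v}(fg)=\mathfrak{v}(f)+\mathfrak{v}(g)$ and $\mathfrak{v}(f+g)\ge\min\{\mathfrak{v}(f),\mathfrak{v}(g)\}$. Its image is the value semigroup $S(R,\mathfrak{v})$; its rank is the rank of the group generated by $S(R,\mathfrak{v})$, and it has full rank if this rank equals $d$. For a full rank $\mathfrak{v}$, a Khovanskii basis is a subset of $R$ whose image under $\mathfrak{v}$ generates $S(R,\mathfrak{v})$. If $R$ is $M$-graded, $\mathfrak{v}$ is ($M$-)homogeneous if $\mathfrak{v}(f)=\min_{u}\mathfrak{v}(f_u)$ over the nonzero graded pieces $f_u$ of $f$, for all $f\neq 0$. Semi-canonical embeddings.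 Every affine rational complexity-one $T$-variety is equivariantly isomorphic to some $$X(\mathcal{D})=\mathrm{Spec}\bigoplus_{u\in\sigma^\vee\cap M}H^0\Big(\mathbb{P}^1,\mathcal{O}\big(\textstyle\sum_i\lfloor\Delta_i(u)\rfloor P_i\big)\Big)\cdot\chi^u,$$ where $\mathcal{D}=\sum_{i=0}^m\Delta_i\cdot P_i$ is a polyhedral divisor on $\mathbb{P}^1$: $P_0,\dots,P_m\in\mathbb{P}^1$ are distinct points, $\sigma\subset N_\mathbb{Q}$ is a pointed polyhedral cone, each $\Delta_i$ is either empty or a polyhedron in $N_\mathbb{Q}$ with tailcone $\{v:\Delta_i+v\subseteq\Delta_i\}=\sigma$ (trivial coefficients $\Delta_i=\sigma$ are allowed, and $m\ge1$), $\sum_i\Delta_i\subsetneq\sigma$, and $\Delta_i(u)=\min_{v\in\Delta_i}\langle v,u\rangle$, with $\Delta_i(u)=\infty$ if $\Delta_i=\emptyset$ (a coefficient $\infty$ means poles of arbitrary order are allowed). Let $e_1,\dots,e_m$ be the standard basis of $\mathbb{Q}^m$, $e_0=-\sum_{i\ge1}e_i$, and let $C\subset N_\mathbb{Q}\times\mathbb{Q}^m$ be the cone generated by $\sigma\times0$ and all $\Delta_i\times e_i$, $0\le i\le m$. Put $A(C)=\mathbb{K}[C^\vee\cap(M\times\mathbb{Z}^m)]$ and $X(C)=\mathrm{Spec}\,A(C)$. Choose a linear embedding $\mathbb{P}^1\hookrightarrow\mathbb{P}^m=\mathrm{Proj}\,\mathbb{K}[y_0,\dots,y_m]$ such that $V(y_i)$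 pulls back to $P_i$ for all $i$, and let $L_\mathcal{D}$ be its image. With $z_i=y_i/y_0$, the map $\chi^{(u,v)}\mapsto (z_1^{v_1}\cdots z_m^{v_m})|_{L_\mathcal{D}}\cdot\chi^u$ is a surjection of $A(C)$ onto the coordinate ring of $X(\mathcal{D})$ (identifying $\mathbb{P}^1$ with $L_\mathcal{D}$), giving a closed embedding $X(\mathcal{D})\subset X(C)$. A semi-canonical embedding of $X$ is the composition of such an embedding $X\cong X(\mathcal{D})\subset X(C)$ with an equivariant embedding $X(C)\hookrightarrow\mathbb{A}^n$ given by a finite generating set $H$ (of size $n$) of the semigroup $C^\vee\cap(M\times\mathbb{Z}^m)$; the corresponding generators of $R_X$ are the images of the $\chi^h$, $h\in H$. *)

theory Defs
  imports
    "HOL-Computational_Algebra.Computational_Algebra"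
    "HOL-Library.Poly_Mapping"
    "HOL-Library.Product_Plus"
    "HOL-Library.Extended_Nat"
    "HOL-Library.Extended"
begin

text \<open>
  An affine variety is represented by its coordinate ring: a type \<open>'a::idom\<close> together with the
  structure homomorphism \<open>\<iota>\<close> from the ground field. A \<open>T\<close>-action on it is
  represented by the corresponding grading by the character lattice \<open>M\<close>. The lattice
  \<open>M\<close> itself is a type \<open>'m::ab_group_add\<close> that is assumed to be free abelian of finite rank
  (the rank may be 0).
\<close>

section \<open>Free abelian groups\<close>

definition zscale :: "int \<Rightarrow> 'g::ab_group_add \<Rightarrow> 'g" where
  "zscale n x = (if 0 \<le> n then ((+) x ^^ nat n) 0 else - ((+) x ^^ nat (- n)) 0)"

lemma zscale_of_nat: "zscale (int n) x = ((+) x ^^ n) 0"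
  by (simp add: zscale_def)

lemma zscale_plus_one: "zscale (n + 1) x = x + zscale n x"
proof (cases "0 \<le> n")
  case True
  then have "nat (n + 1) = Suc (nat n)" by simp
  with True show ?thesis by (simp add: zscale_def)
next
  case False
  then have "nat (- n) = Suc (nat (- (n + 1)))" by simp
  with False show ?thesis by (cases "n = - 1") (simp_all add: zscale_def)
qed

lemma zscale_minus_one: "zscale (n - 1) x = zscale n x - x"
  using zscale_plus_one[of "n - 1" x] by simp

lemma zscale_0 [simp]: "zscale 0 x = 0"
  by (simp add: zscale_def)

lemma zscale_add_left: "zscale (a + b) x = zscale a x + zscale b x"
proof (induction a rule: int_induct[where k = 0])
  case base
  then show ?case by simp
next
  case (step1 i)
  have "zscale (i + 1 + b) x = zscale ((i + b) + 1) x" by (simp add: ac_simps)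
  also have "\<dots> = zscale (i + 1) x + zscale b x"
    by (simp only: zscale_plus_one step1 add.assoc[of x])
  finally show ?case .
next
  case (step2 i)
  have "zscale (i - 1 + b) x = zscale ((i + b) - 1) x" by (simp add: algebra_simps)
  also have "\<dots> = zscale (i - 1) x + zscale b x"
    by (simp only: zscale_minus_one step2) (simp add: algebra_simps)
  finally show ?case .
qed

lemma zscale_add_right: "zscale a (x + y) = zscale a x + zscale a y"
  by (induction a rule: int_induct[where k = 0])
    (simp_all add: zscale_plus_one zscale_minus_one algebra_simps)

lemma zscale_zscale: "zscale a (zscale b x) = zscale (a * b) x"
proof (induction a rule: int_induct[where k = 0])
  case base
  then show ?case by simp
next
  case (step1 i)
  have "(i + 1) * b = b + i * b" by (simp add: algebra_simps)
  then have "zscale ((i + 1) * b) x = zscale b x + zscale (i * b) x"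
    by (simp only: zscale_add_left)
  then show ?case using step1 by (simp add: zscale_plus_one)
next
  case (step2 i)
  have "i * b = (i - 1) * b + b" by (simp add: algebra_simps)
  then have "zscale (i * b) x = zscale ((i - 1) * b) x + zscale b x"
    by (simp only: zscale_add_left)
  then show ?case using step2 by (simp add: zscale_minus_one)
qed

interpretation zmod: module "zscale :: int \<Rightarrow> 'g::ab_group_add \<Rightarrow> 'g"
proof
  show "zscale 1 x = x" for x :: 'g
    using zscale_plus_one[of 0 x] by simp
qed (simp_all add: zscale_add_left zscale_add_right zscale_zscale)

definition free_of_rank :: "'g::ab_group_add set \<Rightarrow> nat \<Rightarrow> bool" where
  "free_of_rank G n \<longleftrightarrow>
     (\<exists>B. finite B \<and> card B = n \<and> zmod.independent B \<and> zmod.span B = G)"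


section \<open>Affine varieties with torus action\<close>

definition k_algebra :: "('k::field \<Rightarrow> 'a::comm_ring_1) \<Rightarrow> bool" where
  "k_algebra \<iota> \<longleftrightarrow>
     \<iota> 1 = 1 \<and> (\<forall>x y. \<iota> (x + y) = \<iota> x + \<iota> y) \<and> (\<forall>x y. \<iota> (x * y) = \<iota> x * \<iota> y)"

definition subring_set :: "'a::comm_ring_1 set \<Rightarrow> bool" where
  "subring_set S \<longleftrightarrow>
     0 \<in> S \<and> 1 \<in> S \<and> (\<forall>x\<in>S. \<forall>y\<in>S. x - y \<in> S) \<and> (\<forall>x\<in>S. \<forall>y\<in>S. x * y \<in> S)"

definition subfield_set :: "'a::field set \<Rightarrow> bool" where
  "subfield_set S \<longleftrightarrow> subring_set S \<and> (\<forall>x\<in>S. inverse x \<in> S)"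

definition finitely_generated_algebra :: "('k::field \<Rightarrow> 'a::comm_ring_1) \<Rightarrow> bool" where
  "finitely_generated_algebra \<iota> \<longleftrightarrow> (\<exists>G. finite G \<and> subring_set hull (range \<iota> \<union> G) = UNIV)"

definition prime_ideal :: "'a::comm_ring_1 set \<Rightarrow> bool" where
  "prime_ideal I \<longleftrightarrow>
     0 \<in> I \<and> (\<forall>x\<in>I. \<forall>y\<in>I. x + y \<in> I) \<and> (\<forall>r. \<forall>x\<in>I. r * x \<in> I) \<and>
     1 \<notin> I \<and> (\<forall>x y. x * y \<in> I \<longrightarrow> x \<in> I \<or> y \<in> I)"

definition krull_dim :: "'a::comm_ring_1 itself \<Rightarrow> enat" where
  "krull_dim _ =
     Sup {enat n | n. \<exists>I :: nat \<Rightarrow> 'a set.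
            (\<forall>i\<le>n. prime_ideal (I i)) \<and> (\<forall>i<n. I i \<subset> I (Suc i))}"

definition integrally_closed :: "'a::idom itself \<Rightarrow> bool" where
  "integrally_closed _ \<longleftrightarrow>
     (\<forall>x :: 'a fract. (\<exists>p :: 'a poly. lead_coeff p = 1 \<and> poly (map_poly to_fract p) x = 0)
        \<longrightarrow> x \<in> range to_fract)"

text \<open>
  Polynomials over \<open>'k\<close> in countably many variables are finitely supported maps from exponent
  vectors to \<open>'k\<close>.
\<close>

definition eval_mpoly ::
  "('k \<Rightarrow> 'f) \<Rightarrow> (nat \<Rightarrow> 'f) \<Rightarrow> ((nat \<Rightarrow>\<^sub>0 nat) \<Rightarrow>\<^sub>0 'k::field) \<Rightarrow> 'f::field" where
  "eval_mpoly \<iota> x p =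
     (\<Sum>\<alpha>\<in>Poly_Mapping.keys p. \<iota> (Poly_Mapping.lookup p \<alpha>) * (\<Prod>j\<in>Poly_Mapping.keys \<alpha>. x j ^ Poly_Mapping.lookup \<alpha> j))"

definition algebraically_independent ::
  "('k::field \<Rightarrow> 'f::field) \<Rightarrow> nat \<Rightarrow> (nat \<Rightarrow> 'f) \<Rightarrow> bool" where
  "algebraically_independent \<iota> n x \<longleftrightarrow>
     (\<forall>p. (\<forall>\<alpha>\<in>Poly_Mapping.keys p. Poly_Mapping.keys \<alpha> \<subseteq> {..<n}) \<longrightarrow> eval_mpoly \<iota> x p = 0 \<longrightarrow> p = 0)"

definition rational_variety :: "('k::field \<Rightarrow> 'a::idom) \<Rightarrow> bool" where
  "rational_variety \<iota> \<longleftrightarrow>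
     (\<exists>n (x :: nat \<Rightarrow> 'a fract).
        algebraically_independent (to_fract \<circ> \<iota>) n x \<and>
        subfield_set hull (range (to_fract \<circ> \<iota>) \<union> x ` {..<n}) = UNIV)"

definition homogeneous_decomposition ::
  "('m \<Rightarrow> 'a::comm_ring_1 set) \<Rightarrow> 'a \<Rightarrow> ('m \<Rightarrow>\<^sub>0 'a) \<Rightarrow> bool" where
  "homogeneous_decomposition A f c \<longleftrightarrow>
     (\<forall>u. Poly_Mapping.lookup c u \<in> A u) \<and> f = (\<Sum>u\<in>Poly_Mapping.keys c. Poly_Mapping.lookup c u)"

definition algebra_grading ::
  "('k::field \<Rightarrow> 'a::comm_ring_1) \<Rightarrow> ('m::ab_group_add \<Rightarrow> 'a set) \<Rightarrow> bool" where
  "algebra_grading \<iota> A \<longleftrightarrow>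
     (\<forall>u. 0 \<in> A u \<and> (\<forall>x\<in>A u. \<forall>y\<in>A u. x + y \<in> A u) \<and> (\<forall>c. \<forall>x\<in>A u. \<iota> c * x \<in> A u)) \<and>
     (\<forall>u w. \<forall>x\<in>A u. \<forall>y\<in>A w. x * y \<in> A (u + w)) \<and>
     (\<forall>f. \<exists>!c. homogeneous_decomposition A f c)"

definition homogeneous_parts ::
  "('m \<Rightarrow> 'a::comm_ring_1 set) \<Rightarrow> 'a \<Rightarrow> ('m \<Rightarrow>\<^sub>0 'a)" where
  "homogeneous_parts A f = (THE c. homogeneous_decomposition A f c)"

text \<open>
  The kernel of the action of \<open>T\<close> is the diagonalizable group with character group
  \<open>M\<close> modulo the subgroup generated by the weights, so the action is effective if and only if
  the weights generate \<open>M\<close>.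
\<close>

definition effective_grading :: "('m::ab_group_add \<Rightarrow> 'a::zero set) \<Rightarrow> bool" where
  "effective_grading A \<longleftrightarrow> zmod.span {u. A u \<noteq> {0}} = UNIV"

definition affine_T_variety ::
  "('k::field \<Rightarrow> 'a::idom) \<Rightarrow> ('m::ab_group_add \<Rightarrow> 'a set) \<Rightarrow> bool" where
  "affine_T_variety \<iota> A \<longleftrightarrow>
     (\<exists>r. free_of_rank (UNIV :: 'm set) r) \<and>
     k_algebra \<iota> \<and> finitely_generated_algebra \<iota> \<and> integrally_closed TYPE('a) \<and>
     algebra_grading \<iota> A \<and> effective_grading A"

definition complexity_one :: "('m::ab_group_add \<Rightarrow> 'a::idom set) \<Rightarrow> bool" where
  "complexity_one (A :: 'm \<Rightarrow> 'a set) \<longleftrightarrow>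
     (\<exists>r. free_of_rank (UNIV :: 'm set) r \<and> krull_dim TYPE('a) = enat (r + 1))"


section \<open>Valuations\<close>

text \<open>
  Only the values of \<open>v\<close> on nonzero elements are relevant. The order on the value group
  is that of the class \<open>linordered_ab_group_add\<close>.
\<close>

definition valuation ::
  "('k::field \<Rightarrow> 'a::idom) \<Rightarrow> ('a \<Rightarrow> 'g::linordered_ab_group_add) \<Rightarrow> bool" where
  "valuation \<iota> v \<longleftrightarrow>
     (\<exists>n. free_of_rank (UNIV :: 'g set) n) \<and>
     (\<forall>c. c \<noteq> 0 \<longrightarrow> v (\<iota> c) = 0) \<and>
     (\<forall>f g. f \<noteq> 0 \<longrightarrow> g \<noteq> 0 \<longrightarrow> v (f * g) = v f + v g) \<and>
     (\<forall>f g. f \<noteq> 0 \<longrightarrow> g \<noteq> 0 \<longrightarrow> f + g \<noteq> 0 \<longrightarrow> min (v f) (v g) \<le> v (f + g))"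

definition value_semigroup :: "('a::zero \<Rightarrow> 'g) \<Rightarrow> 'g set" where
  "value_semigroup v = v ` (UNIV - {0})"

definition full_rank :: "('a::idom \<Rightarrow> 'g::ab_group_add) \<Rightarrow> bool" where
  "full_rank v \<longleftrightarrow>
     (\<exists>d. krull_dim TYPE('a) = enat d \<and> free_of_rank (zmod.span (value_semigroup v)) d)"

definition homogeneous_valuation ::
  "('m \<Rightarrow> 'a::idom set) \<Rightarrow> ('a \<Rightarrow> 'g::linorder) \<Rightarrow> bool" where
  "homogeneous_valuation A v \<longleftrightarrow>
     (\<forall>f. f \<noteq> 0 \<longrightarrow>
        v f = Min ((\<lambda>u. v (Poly_Mapping.lookup (homogeneous_parts A f) u)) ` Poly_Mapping.keys (homogeneous_parts A f)))"

text \<open>Semigroups contain 0, and generation allows the empty sum.\<close>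

definition semigroup_generated :: "'s::comm_monoid_add set \<Rightarrow> 's set" where
  "semigroup_generated H = sum_list ` lists H"

definition khovanskii_basis ::
  "('a::zero \<Rightarrow> 'g::comm_monoid_add) \<Rightarrow> 'a set \<Rightarrow> bool" where
  "khovanskii_basis v B \<longleftrightarrow> semigroup_generated (v ` (B - {0})) = value_semigroup v"


section \<open>The projective line\<close>

text \<open>
  \<open>Some a\<close> is the point \<open>[a:1]\<close> and \<open>None\<close> is \<open>[1:0]\<close>;
  the function field is \<open>'k poly fract\<close>, whose variable is the coordinate
  \<open>s/t\<close> on the points \<open>[s:t]\<close>.
\<close>

type_synonym 'k P1 = "'k option"

fun hom_coords :: "'k::field P1 \<Rightarrow> 'k \<times> 'k" where
  "hom_coords (Some a) = (a, 1)"
| "hom_coords None = (1, 0)"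

fun poly_ord :: "'k::field P1 \<Rightarrow> 'k poly \<Rightarrow> int" where
  "poly_ord (Some a) p = int (order a p)"
| "poly_ord None p = - int (degree p)"

definition ord_at :: "'k::field P1 \<Rightarrow> 'k poly fract \<Rightarrow> int" where
  "ord_at x f =
     (THE n. \<exists>p q. p \<noteq> 0 \<and> q \<noteq> 0 \<and> f = Fract p q \<and> n = poly_ord x p - poly_ord x q)"

lemma poly_ord_mult: "p \<noteq> 0 \<Longrightarrow> q \<noteq> 0 \<Longrightarrow> poly_ord x (p * q) = poly_ord x p + poly_ord x q"
  by (cases x) (simp_all add: order_mult degree_mult_eq)

lemma ord_at_Fract:
  assumes "p \<noteq> 0" "q \<noteq> 0"
  shows "ord_at x (Fract p q) = poly_ord x p - poly_ord x q"
  unfolding ord_at_def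
proof (rule the_equality)
  show "\<exists>p' q'. p' \<noteq> 0 \<and> q' \<noteq> 0 \<and> Fract p q = Fract p' q' \<and>
      poly_ord x p - poly_ord x q = poly_ord x p' - poly_ord x q'"
    using assms by blast
next
  fix n assume "\<exists>p' q'. p' \<noteq> 0 \<and> q' \<noteq> 0 \<and> Fract p q = Fract p' q' \<and>
      n = poly_ord x p' - poly_ord x q'"
  then obtain p' q' where *: "p' \<noteq> 0" "q' \<noteq> 0" "Fract p q = Fract p' q'"
    "n = poly_ord x p' - poly_ord x q'" by blast
  then have "p * q' = p' * q" using assms by (simp add: eq_fract)
  then have "poly_ord x p + poly_ord x q' = poly_ord x p' + poly_ord x q"
    using * assms poly_ord_mult by metis
  then show "n = poly_ord x p - poly_ord x q" using * by simp
qed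

definition H0_P1 :: "('k::field P1 \<Rightarrow> int extended) \<Rightarrow> 'k poly fract set" where
  "H0_P1 D = {f. f = 0 \<or> (\<forall>x. 0 \<le> Fin (ord_at x f) + D x)}"


section \<open>Polyhedral divisors on the projective line\<close>

text \<open>\<open>N\<^sub>\<rat>\<close> is identified with the group of homomorphisms from \<open>M\<close> to the rationals.\<close>

definition NQ :: "('m::ab_group_add \<Rightarrow> rat) set" where
  "NQ = {v. additive v}"

definition polyhedron :: "('m::ab_group_add \<Rightarrow> rat) set \<Rightarrow> bool" where
  "polyhedron \<Delta> \<longleftrightarrow>
     (\<exists>S. finite S \<and> \<Delta> = {v \<in> NQ. \<forall>(u, a)\<in>S. a \<le> v u})"

definition polyhedral_cone :: "('m::ab_group_add \<Rightarrow> rat) set \<Rightarrow> bool" where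
  "polyhedral_cone \<sigma> \<longleftrightarrow> (\<exists>S. finite S \<and> \<sigma> = {v \<in> NQ. \<forall>u\<in>S. 0 \<le> v u})"

definition pointed_cone :: "('m \<Rightarrow> rat) set \<Rightarrow> bool" where
  "pointed_cone \<sigma> \<longleftrightarrow> {v \<in> \<sigma>. (\<lambda>u. - v u) \<in> \<sigma>} = {\<lambda>_. 0}"

definition tailcone :: "('m::ab_group_add \<Rightarrow> rat) set \<Rightarrow> ('m \<Rightarrow> rat) set" where
  "tailcone \<Delta> = {v \<in> NQ. \<forall>w\<in>\<Delta>. (\<lambda>u. w u + v u) \<in> \<Delta>}"

definition minkowski_sum :: "nat \<Rightarrow> (nat \<Rightarrow> ('m \<Rightarrow> rat) set) \<Rightarrow> ('m \<Rightarrow> rat) set" where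
  "minkowski_sum m \<Delta> = {\<lambda>u. \<Sum>i\<le>m. w i u | w. \<forall>i\<le>m. w i \<in> \<Delta> i}"

definition polyhedral_divisor ::
  "('m::ab_group_add \<Rightarrow> rat) set \<Rightarrow> nat \<Rightarrow> (nat \<Rightarrow> 'k P1) \<Rightarrow> (nat \<Rightarrow> ('m \<Rightarrow> rat) set) \<Rightarrow> bool"
  where
  "polyhedral_divisor \<sigma> m P \<Delta> \<longleftrightarrow>
     1 \<le> m \<and> inj_on P {..m} \<and>
     polyhedral_cone \<sigma> \<and> pointed_cone \<sigma> \<and>
     (\<forall>i\<le>m. \<Delta> i = {} \<or> (polyhedron (\<Delta> i) \<and> tailcone (\<Delta> i) = \<sigma>)) \<and>
     minkowski_sum m \<Delta> \<subset> \<sigma>"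

definition dual_cone_lattice :: "('m \<Rightarrow> rat) set \<Rightarrow> 'm set" where
  "dual_cone_lattice \<sigma> = {u. \<forall>v\<in>\<sigma>. 0 \<le> v u}"

text \<open>The \<open>LEAST\<close> below is the minimum of \<open>\<langle>v, u\<rangle>\<close> over \<open>v \<in> \<Delta>\<close>.\<close>

definition floor_coeff :: "('m \<Rightarrow> rat) set \<Rightarrow> 'm \<Rightarrow> int extended" where
  "floor_coeff \<Delta> u = (if \<Delta> = {} then Pinf else Fin \<lfloor>LEAST a. a \<in> (\<lambda>v. v u) ` \<Delta>\<rfloor>)"

definition divisor_at ::
  "nat \<Rightarrow> (nat \<Rightarrow> 'k P1) \<Rightarrow> (nat \<Rightarrow> ('m \<Rightarrow> rat) set) \<Rightarrow> 'm \<Rightarrow> 'k P1 \<Rightarrow> int extended" where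
  "divisor_at m P \<Delta> u x = (\<Sum>i\<le>m. if P i = x then floor_coeff (\<Delta> i) u else 0)"

text \<open>
  The coordinate ring of \<open>X(\<D>)\<close>, inside the group algebra of \<open>M\<close> over the function
  field of the projective line; \<open>Poly_Mapping.single u f\<close> is \<open>f \<cdot> \<chi>\<^sup>u\<close>.
\<close>

definition coordinate_ring ::
  "('m::ab_group_add \<Rightarrow> rat) set \<Rightarrow> nat \<Rightarrow> (nat \<Rightarrow> 'k::field P1) \<Rightarrow> (nat \<Rightarrow> ('m \<Rightarrow> rat) set) \<Rightarrow>
   ('m \<Rightarrow>\<^sub>0 'k poly fract) set" where
  "coordinate_ring \<sigma> m P \<Delta> =
     {F. \<forall>u\<in>Poly_Mapping.keys F. u \<in> dual_cone_lattice \<sigma> \<and> Poly_Mapping.lookup F u \<in> H0_P1 (divisor_at m P \<Delta> u)}"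

definition equivariant_iso ::
  "('k::field \<Rightarrow> 'a::idom) \<Rightarrow> ('m::ab_group_add \<Rightarrow> 'a set) \<Rightarrow> ('m \<Rightarrow>\<^sub>0 'k poly fract) set \<Rightarrow>
   ('a \<Rightarrow> ('m \<Rightarrow>\<^sub>0 'k poly fract)) \<Rightarrow> bool" where
  "equivariant_iso \<iota> A R \<psi> \<longleftrightarrow>
     bij_betw \<psi> UNIV R \<and>
     (\<forall>x y. \<psi> (x + y) = \<psi> x + \<psi> y) \<and> (\<forall>x y. \<psi> (x * y) = \<psi> x * \<psi> y) \<and>
     (\<forall>c. \<psi> (\<iota> c) = Poly_Mapping.single 0 (to_fract [:c:])) \<and>
     (\<forall>u. \<forall>f\<in>A u. Poly_Mapping.keys (\<psi> f) \<subseteq> {u})"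


section \<open>Semi-canonical embeddings\<close>

text \<open>
  Elements of \<open>N\<^sub>\<rat> \<times> \<rat>\<^sup>m\<close> are pairs whose second component is a function supported on
  \<open>{1..m}\<close>; elements of \<open>M \<times> \<int>\<^sup>m\<close> are pairs whose second component is a finitely
  supported function with keys in \<open>{1..m}\<close>.
\<close>

definition basis_vector :: "nat \<Rightarrow> nat \<Rightarrow> nat \<Rightarrow> rat" where
  "basis_vector m i j =
     (if j \<notin> {1..m} then 0 else if i = 0 then - 1 else if j = i then 1 else 0)"

definition cone_generated ::
  "(('m \<Rightarrow> rat) \<times> (nat \<Rightarrow> rat)) set \<Rightarrow> (('m \<Rightarrow> rat) \<times> (nat \<Rightarrow> rat)) set" where
  "cone_generated G =
     {((\<lambda>u. \<Sum>g\<in>F. c g * fst g u), (\<lambda>j. \<Sum>g\<in>F. c g * snd g j)) | F c.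
        finite F \<and> F \<subseteq> G \<and> (\<forall>g\<in>F. 0 \<le> c g)}"

definition cone_C ::
  "('m \<Rightarrow> rat) set \<Rightarrow> nat \<Rightarrow> (nat \<Rightarrow> ('m \<Rightarrow> rat) set) \<Rightarrow> (('m \<Rightarrow> rat) \<times> (nat \<Rightarrow> rat)) set" where
  "cone_C \<sigma> m \<Delta> = cone_generated (\<sigma> \<times> {\<lambda>_. 0} \<union> (\<Union>i\<le>m. \<Delta> i \<times> {basis_vector m i}))"

definition semigroup_C ::
  "('m \<Rightarrow> rat) set \<Rightarrow> nat \<Rightarrow> (nat \<Rightarrow> ('m \<Rightarrow> rat) set) \<Rightarrow> ('m \<times> (nat \<Rightarrow>\<^sub>0 int)) set" where
  "semigroup_C \<sigma> m \<Delta> =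
     {(u, a). Poly_Mapping.keys a \<subseteq> {1..m} \<and>
        (\<forall>(v, w)\<in>cone_C \<sigma> m \<Delta>. 0 \<le> v u + (\<Sum>j=1..m. w j * of_int (Poly_Mapping.lookup a j)))}"

text \<open>
  A linear map from the projective line to projective \<open>m\<close>-space is given by linear forms
  \<open>l 0, \<dots>, l m\<close>, the pullbacks of \<open>y\<^sub>0, \<dots>, y\<^sub>m\<close>, where
  \<open>(\<alpha>, \<beta>)\<close> stands for the form \<open>\<alpha> s + \<beta> t\<close>.
\<close>

fun linear_form :: "'k::field \<times> 'k \<Rightarrow> 'k \<times> 'k \<Rightarrow> 'k" where
  "linear_form (\<alpha>, \<beta>) (s, t) = \<alpha> * s + \<beta> * t"

definition linear_embedding ::
  "nat \<Rightarrow> (nat \<Rightarrow> 'k::field P1) \<Rightarrow> (nat \<Rightarrow> 'k \<times> 'k) \<Rightarrow> bool" where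
  "linear_embedding m P l \<longleftrightarrow>
     (\<forall>s t. (\<forall>i\<le>m. linear_form (l i) (s, t) = 0) \<longrightarrow> s = 0 \<and> t = 0) \<and>
     (\<forall>i\<le>m. {x. linear_form (l i) (hom_coords x) = 0} = {P i})"

definition affine_form :: "'k::field \<times> 'k \<Rightarrow> 'k poly" where
  "affine_form l = [:snd l, fst l:]"

text \<open>The restriction of \<open>z\<^sub>i = y\<^sub>i / y\<^sub>0\<close> to the embedded line.\<close>

definition z_coord :: "(nat \<Rightarrow> 'k::field \<times> 'k) \<Rightarrow> nat \<Rightarrow> 'k poly fract" where
  "z_coord l i = Fract (affine_form (l i)) (affine_form (l 0))"

text \<open>
  The linear extension of \<open>\<chi>\<^bsup>(u,a)\<^esup> \<mapsto> z\<^sup>a \<cdot> \<chi>\<^sup>u\<close>. On the semigroup algebra of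
  \<open>semigroup_C \<sigma> m \<Delta>\<close> this is the comorphism of the closed embedding
  of \<open>X(\<D>)\<close> into the toric variety \<open>X(C)\<close>.
\<close>

definition restrict_to_line ::
  "nat \<Rightarrow> (nat \<Rightarrow> 'k::field \<times> 'k) \<Rightarrow> (('m::ab_group_add \<times> (nat \<Rightarrow>\<^sub>0 int)) \<Rightarrow>\<^sub>0 'k) \<Rightarrow>
   ('m \<Rightarrow>\<^sub>0 'k poly fract)" where
  "restrict_to_line m l F =
     (\<Sum>(u, a)\<in>Poly_Mapping.keys F. Poly_Mapping.single u
        (to_fract [:Poly_Mapping.lookup F (u, a):] * (\<Prod>j=1..m. z_coord l j powi Poly_Mapping.lookup a j)))"

definition character :: "'s \<Rightarrow> ('s \<Rightarrow>\<^sub>0 'k::field)" where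
  "character h = Poly_Mapping.single h 1"

text \<open>
  The data of a semi-canonical embedding into affine space of dimension \<open>card H\<close>: the
  coordinate function of index \<open>h \<in> H\<close> pulls back to the element of the coordinate ring
  that \<open>\<psi>\<close> identifies with the restriction of \<open>\<chi>\<^sup>h\<close>.
\<close>

definition semi_canonical_embedding ::
  "('k::field \<Rightarrow> 'a::idom) \<Rightarrow> ('m::ab_group_add \<Rightarrow> 'a set) \<Rightarrow>
   ('m \<Rightarrow> rat) set \<Rightarrow> nat \<Rightarrow> (nat \<Rightarrow> 'k P1) \<Rightarrow> (nat \<Rightarrow> ('m \<Rightarrow> rat) set) \<Rightarrow>
   (nat \<Rightarrow> 'k \<times> 'k) \<Rightarrow> ('a \<Rightarrow> ('m \<Rightarrow>\<^sub>0 'k poly fract)) \<Rightarrow> ('m \<times> (nat \<Rightarrow>\<^sub>0 int)) set \<Rightarrow> bool"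
  where
  "semi_canonical_embedding \<iota> A \<sigma> m P \<Delta> l \<psi> H \<longleftrightarrow>
     polyhedral_divisor \<sigma> m P \<Delta> \<and>
     linear_embedding m P l \<and>
     equivariant_iso \<iota> A (coordinate_ring \<sigma> m P \<Delta>) \<psi> \<and>
     finite H \<and> semigroup_generated H = semigroup_C \<sigma> m \<Delta>"

definition embedding_generators ::
  "nat \<Rightarrow> (nat \<Rightarrow> 'k::field \<times> 'k) \<Rightarrow> ('a \<Rightarrow> ('m::ab_group_add \<Rightarrow>\<^sub>0 'k poly fract)) \<Rightarrow>
   ('m \<times> (nat \<Rightarrow>\<^sub>0 int)) set \<Rightarrow> 'a set" where
  "embedding_generators m l \<psi> H = (\<lambda>h. inv \<psi> (restrict_to_line m l (character h))) ` H"

end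

theory Submission
  imports Defs "Jordan_Normal_Form.Char_Poly"
begin

text \<open>
  Write \<open>R\<close> for the coordinate ring, \<open>K\<close> for the ground field and \<open>r\<close> for the rank of the
  character lattice \<open>M\<close>. The proof realises \<open>R\<close> inside the group algebra \<open>K(t)[M]\<close>, recognises its
  image as the coordinate ring of a polyhedral divisor on the projective line, and then compares
  values of \<open>v\<close> with orders at a point of that line.

  Embedding. If every quotient of two homogeneous elements of equal weight were constant, the
  value of a homogeneous element would depend on its weight only, and a homogeneous valuation
  would have rank at most \<open>r\<close>; but the rank of \<open>v\<close> is \<open>r + 1\<close>
  (\<open>nonconstant_homogeneous_quotient\<close>). Rationality gives homomorphisms \<open>R \<rightarrow> K(s)\<close> by restricting
  rational functions to a general line (\<open>rational_specialization\<close>). Such a homomorphism kills no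
  nonzero homogeneous element: otherwise its graded version and the homomorphisms to
  \<open>K[\<int>\<^sup>r], K[\<int>\<^sup>r\<^sup>-\<^sup>1], \<dots>, K\<close> obtained from one point of the line by forgetting more and more of
  the weight would have kernels that form, together with the zero ideal, a chain of primes longer
  than the Krull dimension (\<open>homogeneous_nonvanishing\<close>). Hence the field of quotients of
  homogeneous elements of equal weight embeds into \<open>K(s)\<close>; it is bigger than \<open>K\<close>, so it is some
  \<open>K(t)\<close> by Lueroth's theorem (\<open>lueroth\<close>), and splitting off a homomorphism from \<open>M\<close> to the
  nonzero elements of \<open>K(s)\<close> turns every homogeneous \<open>f\<close> of weight \<open>u\<close> into \<open>\<Phi> u f \<cdot> \<chi>\<^sup>u\<close> with
  \<open>\<Phi> u f \<in> K(t)\<close> (\<open>homogeneous_embedding_exists\<close>).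

  Polyhedral divisor. Let \<open>h\<close> range over finitely many homogeneous generators. The coefficient at
  a point \<open>x\<close> consists of the \<open>w\<close> with \<open>w (deg h) \<ge> - ord\<^sub>x (\<Phi> (deg h) h)\<close> for all \<open>h\<close>. The orders
  of all homogeneous elements obey the resulting bounds (\<open>homogeneous_bound\<close>). Conversely let
  \<open>z \<in> K(t)\<close> obey the bounds in weight \<open>u\<close>. Linear programming duality yields at each point \<open>x\<close> a
  monomial of weight \<open>N u\<close> in the generators whose order at \<open>x\<close> is at most \<open>N ord\<^sub>x z\<close>
  (\<open>monomial_with_small_order\<close>), and finitely many such monomials suffice for all \<open>x\<close>. A Bezout
  relation with bounded degrees then expresses \<open>t\<^sup>i z\<^sup>N\<close>, \<open>i \<le> e\<close>, through these monomials with
  polynomial coefficients of degree at most \<open>e\<close> (\<open>finite_module_relation\<close>). So \<open>z\<^sup>N\<close> is an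
  eigenvalue of a matrix over \<open>R\<close>, and as \<open>R\<close> is normal, \<open>z\<close> comes from an element of \<open>R\<close>
  (\<open>integral_homogeneous_element\<close>, \<open>section_is_homogeneous_element\<close>).

  Khovanskii basis. On \<open>K(t)\<close> the valuation is a multiple of the order at a single point \<open>x\<^sub>0\<close>
  (\<open>valuation_of_function_field\<close>), so \<open>v\<close> takes the same value on elements of equal weight and
  equal order at \<open>x\<^sub>0\<close> (\<open>valuation_is_order_at_point\<close>). Take \<open>x\<^sub>0\<close> as one of the marked points
  \<open>P\<^sub>i\<close>. Given a homogeneous element, raising its order at another marked point gives orders of
  total degree 0; these are the orders of a monomial \<open>z\<^sup>a\<close> in the coordinates of the embedded
  line, \<open>(u, a)\<close> lies in the dual of the cone \<open>C\<close>, and \<open>z\<^sup>a \<chi>\<^sup>u\<close> has the given value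
  (\<open>monomial_with_given_order\<close>). Hence the values of these monomials exhaust the value semigroup,
  and any finite generating set of \<open>C\<^sup>\<or> \<inter> (M \<times> \<int>\<^sup>m)\<close>, which exists by Gordan's lemma (\<open>gordan\<close>),
  yields a Khovanskii basis (\<open>khovanskii_basis_of_monomials\<close>).
\<close>

section \<open>Duality for rational polyhedral cones\<close>

lemma one_variable_inequalities:
  fixes p q :: "'l \<Rightarrow> rat"
  assumes "finite \<Lambda>"
  shows "(\<exists>x. \<forall>l\<in>\<Lambda>. p l \<le> q l * x) \<longleftrightarrow>
    (\<forall>l\<in>\<Lambda>. q l = 0 \<longrightarrow> p l \<le> 0) \<and>
    (\<forall>l\<in>\<Lambda>. \<forall>k\<in>\<Lambda>. 0 < q l \<longrightarrow> q k < 0 \<longrightarrow> - q k * p l + q l * p k \<le> 0)" (is "?L \<longleftrightarrow> ?R1 \<and> ?R2")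
proof
  assume ?L
  then obtain x where x: "\<And>l. l \<in> \<Lambda> \<Longrightarrow> p l \<le> q l * x" by blast
  have ?R1 using x by fastforce
  moreover have ?R2
  proof (intro ballI impI)
    fix l k assume *: "l \<in> \<Lambda>" "k \<in> \<Lambda>" "0 < q l" "q k < 0"
    have "- q k * p l \<le> - q k * (q l * x)" "q l * p k \<le> q l * (q k * x)"
      using x[of l] x[of k] * by (intro mult_left_mono; simp)+
    then show "- q k * p l + q l * p k \<le> 0" by (simp add: algebra_simps)
  qed
  ultimately show "?R1 \<and> ?R2" ..
next
  assume R: "?R1 \<and> ?R2"
  define Lo where "Lo = (\<lambda>l. p l / q l) ` {l\<in>\<Lambda>. 0 < q l}"
  define Up where "Up = (\<lambda>l. p l / q l) ` {l\<in>\<Lambda>. q l < 0}"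
  have fin: "finite Lo" "finite Up" using assms by (auto simp: Lo_def Up_def)
  have LU: "a \<le> b" if ab: "a \<in> Lo" "b \<in> Up" for a b
  proof -
    obtain l k where lk: "l \<in> \<Lambda>" "0 < q l" "a = p l / q l" "k \<in> \<Lambda>" "q k < 0" "b = p k / q k"
      using ab by (auto simp: Lo_def Up_def)
    then have "- q k * p l + q l * p k \<le> 0" using R by blast
    moreover have "p l = a * q l" "p k = b * q k" using lk by auto
    ultimately have "(b - a) * (q k * q l) \<le> 0" by (simp add: algebra_simps)
    moreover have "q k * q l < 0" using lk by (simp add: mult_neg_pos)
    ultimately show ?thesis by (simp add: mult_le_0_iff)
  qed
  obtain x where x: "\<And>a. a \<in> Lo \<Longrightarrow> a \<le> x" "\<And>b. b \<in> Up \<Longrightarrow> x \<le> b"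
  proof (cases "Lo = {}")
    case True
    then show ?thesis using that[of 0] that[of "Min Up"] fin by (cases "Up = {}") auto
  next
    case False
    then show ?thesis using that[of "Max Lo"] fin LU by auto
  qed
  have "p l \<le> q l * x" if l: "l \<in> \<Lambda>" for l
  proof -
    consider "q l = 0" | "0 < q l" | "q l < 0" by linarith
    then show ?thesis
    proof cases
      case 1 then show ?thesis using R l by simp
    next
      case 2
      then have "p l / q l \<le> x" using l by (intro x) (auto simp: Lo_def)
      then show ?thesis using 2 by (simp add: field_simps)
    next
      case 3
      then have "x \<le> p l / q l" using l by (intro x) (auto simp: Up_def)
      then show ?thesis using 3 by (simp add: field_simps)
    qed
  qed
  then show ?L by blast
qed

text \<open>
  Fourier--Motzkin elimination. The index set \<open>I\<close> of the inequalities stays fixed while variables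
  are eliminated; only the finite set of certificates \<open>l\<close> (integral combinations of the
  inequalities in which the variables cancel) changes. The certificates depend on the coefficients
  but not on \<open>b\<close>, and this uniformity gives finiteness in the duality statements below.
\<close>

lemma fourier_motzkin:
  fixes c :: "'i \<Rightarrow> 'j \<Rightarrow> int"
  assumes "finite J" "finite I"
  shows "\<exists>\<Lambda>. finite \<Lambda> \<and>
    (\<forall>b :: 'i \<Rightarrow> rat. (\<exists>x :: 'j \<Rightarrow> rat. \<forall>k\<in>I. b k \<le> (\<Sum>j\<in>J. of_int (c k j) * x j)) \<longleftrightarrow>
       (\<forall>l\<in>\<Lambda>. (\<Sum>k\<in>I. of_int (l k :: int) * b k) \<le> 0))"
  using assms(1)
proof (induction J rule: finite_induct)
  case empty
  have "(\<Sum>i\<in>I. of_int (if i = k then 1 else 0) * b i) = b k" if "k \<in> I" for k and b :: "'i \<Rightarrow> rat"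
  proof -
    have "(\<Sum>i\<in>I. of_int (if i = k then 1 else 0) * b i) = (\<Sum>i\<in>I. if i = k then b i else 0)"
      by (intro sum.cong) auto
    then show ?thesis using assms(2) that by simp
  qed
  then show ?case using assms(2)
    by (intro exI[of _ "(\<lambda>k i. if i = k then 1 else 0) ` I"]) auto
next
  case (insert j J)
  then obtain \<Lambda> where \<Lambda>: "finite \<Lambda>" and
    iff: "\<And>b :: 'i \<Rightarrow> rat. (\<exists>x :: 'j \<Rightarrow> rat. \<forall>k\<in>I. b k \<le> (\<Sum>j\<in>J. of_int (c k j) * x j)) \<longleftrightarrow>
       (\<forall>l\<in>\<Lambda>. (\<Sum>k\<in>I. of_int (l k) * b k) \<le> 0)" by auto
  define q where "q l = (\<Sum>k\<in>I. l k * c k j)" for l :: "'i \<Rightarrow> int"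
  define comb where "comb = (\<lambda>(l, m). \<lambda>k. - q m * l k + q l * m k)"
  define \<Lambda>' where "\<Lambda>' = {l \<in> \<Lambda>. q l = 0} \<union> comb ` ({l\<in>\<Lambda>. 0 < q l} \<times> {m\<in>\<Lambda>. q m < 0})"
  have "finite \<Lambda>'" using \<Lambda> by (auto simp: \<Lambda>'_def)
  moreover have "(\<exists>x :: 'j \<Rightarrow> rat. \<forall>k\<in>I. b k \<le> (\<Sum>j\<in>insert j J. of_int (c k j) * x j)) \<longleftrightarrow>
       (\<forall>l\<in>\<Lambda>'. (\<Sum>k\<in>I. of_int (l k) * b k) \<le> 0)" for b :: "'i \<Rightarrow> rat"
  proof -
    define p where "p l = (\<Sum>k\<in>I. of_int (l k) * b k)" for l :: "'i \<Rightarrow> int"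
    have ex: "(\<exists>x :: 'j \<Rightarrow> rat. \<forall>k\<in>I. b k \<le> (\<Sum>j\<in>insert j J. of_int (c k j) * x j)) \<longleftrightarrow>
      (\<exists>t. \<exists>x :: 'j \<Rightarrow> rat. \<forall>k\<in>I. b k - of_int (c k j) * t \<le> (\<Sum>j\<in>J. of_int (c k j) * x j))"
      (is "?A \<longleftrightarrow> ?B")
    proof
      assume ?A
      then obtain x where "\<forall>k\<in>I. b k \<le> (\<Sum>j\<in>insert j J. of_int (c k j) * x j)" ..
      then show ?B using insert.hyps by (intro exI[of _ "x j"] exI[of _ x]) auto
    next
      assume ?B
      then obtain t x where tx: "\<forall>k\<in>I. b k - of_int (c k j) * t \<le> (\<Sum>j\<in>J. of_int (c k j) * x j)"
        by blast
      have "(\<Sum>i\<in>J. of_int (c k i) * (x(j := t)) i) = (\<Sum>i\<in>J. of_int (c k i) * x i)" for k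
        using insert.hyps by (intro sum.cong) auto
      then show ?A using tx insert.hyps by (intro exI[of _ "x(j := t)"]) (auto simp: algebra_simps)
    qed
    have shift: "(\<Sum>k\<in>I. of_int (l k) * (b k - of_int (c k j) * t)) = p l - of_int (q l) * t"
      for l :: "'i \<Rightarrow> int" and t
      by (simp add: p_def q_def algebra_simps sum_subtractf sum_distrib_left)
    have pc: "p (comb (l, m)) = - of_int (q m) * p l + of_int (q l) * p m" for l m
      by (simp add: p_def comb_def ring_distribs sum.distrib sum_distrib_left sum_negf mult.assoc
          sum_subtractf)
    have "(\<exists>t. \<forall>l\<in>\<Lambda>. p l \<le> of_int (q l) * t) \<longleftrightarrow> (\<forall>l\<in>\<Lambda>'. p l \<le> 0)"
      unfolding one_variable_inequalities[OF \<Lambda>, of p "\<lambda>l. of_int (q l)"]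
      unfolding \<Lambda>'_def ball_Un by (auto simp: pc)
    then show ?thesis unfolding ex iff shift by (simp add: p_def)
  qed
  ultimately show ?case by blast
qed

text \<open>
  Weyl's theorem: a finitely generated cone is cut out by finitely many integral linear forms.
  Membership of \<open>x\<close> is the solvability in \<open>y\<close> of \<open>y \<ge> 0\<close>, \<open>g y \<ge> x\<close> and \<open>- g y \<ge> - x\<close>, so
  eliminating \<open>y\<close> leaves linear conditions on \<open>x\<close>.
\<close>

lemma weyl_dual_description:
  fixes g :: "'k \<Rightarrow> 'j \<Rightarrow> int"
  assumes "finite J" "finite K"
  shows "\<exists>L. finite L \<and>
    (\<forall>x :: 'j \<Rightarrow> rat. (\<exists>y. (\<forall>k\<in>K. 0 \<le> y k) \<and> (\<forall>j\<in>J. x j = (\<Sum>k\<in>K. y k * of_int (g k j)))) \<longleftrightarrow>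
       (\<forall>l\<in>L. 0 \<le> (\<Sum>j\<in>J. of_int (l j :: int) * x j)))"
proof -
  define I :: "('k + 'j + 'j) set" where "I = Inl ` K \<union> (Inr \<circ> Inl) ` J \<union> (Inr \<circ> Inr) ` J"
  define c :: "('k + 'j + 'j) \<Rightarrow> 'k \<Rightarrow> int" where
    "c i k = (case i of Inl k' \<Rightarrow> (if k' = k then 1 else 0) | Inr (Inl j) \<Rightarrow> g k j | Inr (Inr j) \<Rightarrow> - g k j)" for i k
  have "finite I" using assms by (simp add: I_def)
  then obtain \<Lambda> where \<Lambda>: "finite \<Lambda>" and
    iff: "\<And>b :: _ \<Rightarrow> rat. (\<exists>x. \<forall>i\<in>I. b i \<le> (\<Sum>k\<in>K. of_int (c i k) * x k)) \<longleftrightarrow>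
       (\<forall>l\<in>\<Lambda>. (\<Sum>i\<in>I. of_int (l i) * b i) \<le> 0)"
    using fourier_motzkin[OF assms(2), of I c] by blast
  define dual where "dual l j = l (Inr (Inr j)) - l (Inr (Inl j))" for l :: "('k + 'j + 'j) \<Rightarrow> int" and j
  have "(\<exists>y. (\<forall>k\<in>K. 0 \<le> y k) \<and> (\<forall>j\<in>J. x j = (\<Sum>k\<in>K. y k * of_int (g k j)))) \<longleftrightarrow>
       (\<forall>l\<in>dual ` \<Lambda>. 0 \<le> (\<Sum>j\<in>J. of_int (l j :: int) * x j))" for x :: "'j \<Rightarrow> rat"
  proof -
    define b :: "('k + 'j + 'j) \<Rightarrow> rat" where
      "b i = (case i of Inl k' \<Rightarrow> 0 | Inr (Inl j) \<Rightarrow> x j | Inr (Inr j) \<Rightarrow> - x j)" for i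
    have sumK: "(\<Sum>k'\<in>K. y k' * of_int (if k = k' then 1 else 0)) = (y k :: rat)" if "k \<in> K" for k y
    proof -
      have "(\<Sum>k'\<in>K. y k' * of_int (if k = k' then 1 else 0)) = (\<Sum>k'\<in>K. if k = k' then y k' else 0)"
        by (intro sum.cong) auto
      then show ?thesis using that assms by simp
    qed
    have row: "(\<forall>i\<in>I. b i \<le> (\<Sum>k\<in>K. of_int (c i k) * y k)) \<longleftrightarrow>
      (\<forall>k\<in>K. 0 \<le> y k) \<and> (\<forall>j\<in>J. x j = (\<Sum>k\<in>K. y k * of_int (g k j)))" for y
      unfolding I_def ball_Un
      by (auto simp: b_def c_def sumK sum_negf mult.commute intro!: antisym)
    have col: "(\<Sum>i\<in>I. of_int (l i) * b i) = - (\<Sum>j\<in>J. of_int (dual l j) * x j)" for l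
      unfolding I_def using assms
      by (subst sum.union_disjoint; force?)+
         (simp add: sum.reindex inj_on_def b_def dual_def algebra_simps sum_subtractf sum_negf)
    show ?thesis using iff[of b] unfolding row col by simp
  qed
  then show ?thesis using \<Lambda> by (intro exI[of _ "dual ` \<Lambda>"]) auto
qed

lemma common_denominator:
  fixes y :: "'k \<Rightarrow> rat"
  assumes "finite K" "\<forall>k\<in>K. 0 \<le> y k"
  shows "\<exists>N::nat. 1 \<le> N \<and> (\<exists>c :: 'k \<Rightarrow> nat. \<forall>k\<in>K. of_nat N * y k = of_nat (c k))"
  using assms
proof (induction K rule: finite_induct)
  case empty
  then show ?case by auto
next
  case (insert k K)
  then obtain N c where N: "1 \<le> N" "\<forall>k\<in>K. of_nat N * y k = of_nat (c k)" by auto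
  obtain p q where pq: "q > 0" "y k = of_int p / of_int q"
    by (metis quotient_of_div quotient_of_denom_pos old.prod.exhaust)
  have p0: "p \<ge> 0" using insert.prems pq by (simp add: zero_le_divide_iff)
  have "1 \<le> N * nat q" using N pq by simp
  moreover have "of_nat (N * nat q) * y k' = of_nat (if k' = k then N * nat p else nat q * c k')" if "k' \<in> insert k K" for k'
  proof (cases "k' = k")
    case True then show ?thesis using pq p0 by simp
  next
    case False
    then have "of_nat (N * nat q) * y k' = of_nat (nat q) * (of_nat N * y k')" by simp
    also have "\<dots> = of_nat (nat q) * of_nat (c k')" using N that False by simp
    finally show ?thesis using False by simp
  qed
  ultimately show ?case by (intro exI[of _ "N * nat q"] conjI exI[of _ "\<lambda>k'. if k' = k then N * nat p else nat q * c k'"] ballI)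
qed

section \<open>Cones and polyhedra over a free abelian group\<close>

definition coords :: "'m::ab_group_add set \<Rightarrow> 'm \<Rightarrow> 'm \<Rightarrow> int" where
  "coords B u b = zmod.representation B u b"

definition lattice_basis :: "'m::ab_group_add set \<Rightarrow> bool" where
  "lattice_basis B \<longleftrightarrow> finite B \<and> zmod.independent B \<and> zmod.span B = UNIV"

lemma coords_add: "lattice_basis B \<Longrightarrow> coords B (u + w) b = coords B u b + coords B w b"
  unfolding coords_def lattice_basis_def by (simp add: zmod.representation_add)

lemma coords_sum: "lattice_basis B \<Longrightarrow> (\<Sum>b\<in>B. zscale (coords B u b) b) = u"
  unfolding coords_def lattice_basis_def by (intro zmod.sum_representation_eq) auto

lemma coords_zscale: "lattice_basis B \<Longrightarrow> coords B (zscale n u) b = n * coords B u b"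
  unfolding coords_def lattice_basis_def by (simp add: zmod.representation_scale)

lemma coords_0: "coords B 0 b = 0"
  unfolding coords_def by (simp add: zmod.representation_zero)

lemma coords_setsum: "lattice_basis B \<Longrightarrow> coords B (\<Sum>i\<in>I. f i) b = (\<Sum>i\<in>I. coords B (f i) b)"
  by (induction I rule: infinite_finite_induct) (auto simp: coords_0 coords_add)

lemma coords_basis: "lattice_basis B \<Longrightarrow> b \<in> B \<Longrightarrow> coords B b b' = (if b' = b then 1 else 0)"
  unfolding coords_def lattice_basis_def by (simp add: zmod.representation_basis)

lemma coords_eqI: "lattice_basis B \<Longrightarrow> (\<And>b. b \<in> B \<Longrightarrow> coords B u b = coords B w b) \<Longrightarrow> u = w"
  by (subst (1 2) coords_sum[of B, symmetric]) simp_all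

lemma additive_zscale:
  fixes v :: "'m::ab_group_add \<Rightarrow> 'r::ring_1"
  assumes "additive v" shows "v (zscale n u) = of_int n * v u"
proof -
  interpret additive v by fact
  show ?thesis
    by (induction n rule: int_induct[where k = 0])
      (simp_all add: zero add diff zscale_add_left zmod.scale_left_diff_distrib algebra_simps)
qed

lemma additive_sum: "additive v \<Longrightarrow> v (\<Sum>i\<in>I. f i) = (\<Sum>i\<in>I. v (f i))"
  by (rule additive.sum)

text \<open>
  A finite set of integral functionals \<open>(v, h)\<close> on \<open>M \<times> \<int>\<close> that cuts out the cone generated by the
  pairs \<open>(u k, ord k)\<close> and \<open>(0, 1)\<close>. The last clause is the nontrivial inclusion in a form free of
  denominators; the generator \<open>(0, 1)\<close> turns its second component into an inequality. Functionals
  of positive height \<open>h\<close> give points of the polyhedron of lower bounds \<open>- ord k\<close>, those of height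
  0 give elements of its tailcone.
\<close>

definition dual_description ::
  "'k set \<Rightarrow> ('k \<Rightarrow> 'm::ab_group_add) \<Rightarrow> ('k \<Rightarrow> int) \<Rightarrow> (('m \<Rightarrow> int) \<times> int) set \<Rightarrow> bool" where
  "dual_description K u ord L \<longleftrightarrow> finite L \<and>
    (\<forall>v h. (v, h) \<in> L \<longrightarrow> additive v \<and> 0 \<le> h \<and> (\<forall>k\<in>K. 0 \<le> v (u k) + h * ord k)) \<and>
    (\<forall>x n. (\<forall>v h. (v, h) \<in> L \<longrightarrow> 0 \<le> v x + h * n) \<longrightarrow>
      (\<exists>N\<ge>1. \<exists>c. zscale (int N) x = (\<Sum>k\<in>K. zscale (int (c k)) (u k)) \<and>
         (\<Sum>k\<in>K. int (c k) * ord k) \<le> int N * n))"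

lemma dual_descriptionD:
  assumes "dual_description K u ord L"
  shows "finite L" "(v, h) \<in> L \<Longrightarrow> additive v" "(v, h) \<in> L \<Longrightarrow> 0 \<le> h"
    "(v, h) \<in> L \<Longrightarrow> k \<in> K \<Longrightarrow> 0 \<le> v (u k) + h * ord k"
  using assms unfolding dual_description_def by blast+

lemma dual_description_combination:
  assumes "dual_description K u ord L" "\<And>v h. (v, h) \<in> L \<Longrightarrow> 0 \<le> v x + h * n"
  shows "\<exists>N\<ge>1. \<exists>c. zscale (int N) x = (\<Sum>k\<in>K. zscale (int (c k)) (u k)) \<and>
         (\<Sum>k\<in>K. int (c k) * ord k) \<le> int N * n"
  using assms(1)[unfolded dual_description_def] assms(2) by blast

text \<open>
  Weyl's theorem in coordinates. The index \<open>None\<close> stands for the factor \<open>\<int>\<close> in \<open>J\<close> and for the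
  generator \<open>(0, 1)\<close> in \<open>K'\<close>.
\<close>

lemma dual_description_of_cone:
  fixes B :: "'m::ab_group_add set" and u :: "'k \<Rightarrow> 'm" and ord :: "'k \<Rightarrow> int"
  assumes B: "lattice_basis B" and K: "finite K"
  shows "\<exists>L. dual_description K u ord L"
proof -
  have finB: "finite B" using B by (simp add: lattice_basis_def)
  define J where "J = insert None (Some ` B)"
  define K' where "K' = insert None (Some ` K)"
  define g :: "'k option \<Rightarrow> 'm option \<Rightarrow> int" where
    "g k j = (case (k, j) of (Some k, Some b) \<Rightarrow> coords B (u k) b | (Some k, None) \<Rightarrow> ord k
       | (None, Some b) \<Rightarrow> 0 | (None, None) \<Rightarrow> 1)" for k j
  have fin: "finite J" "finite K'" using finB K by (auto simp: J_def K'_def)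
  obtain L where L: "finite L" and iff: "\<And>x :: 'm option \<Rightarrow> rat.
    (\<exists>y. (\<forall>k\<in>K'. 0 \<le> y k) \<and> (\<forall>j\<in>J. x j = (\<Sum>k\<in>K'. y k * of_int (g k j)))) \<longleftrightarrow>
       (\<forall>l\<in>L. 0 \<le> (\<Sum>j\<in>J. of_int (l j :: int) * x j))"
    using weyl_dual_description[OF fin, of g] by blast
  define X :: "'m \<Rightarrow> int \<Rightarrow> 'm option \<Rightarrow> rat" where
    "X x n j = (case j of None \<Rightarrow> of_int n | Some b \<Rightarrow> of_int (coords B x b))" for x n j
  define fn where "fn l = ((\<lambda>x. \<Sum>b\<in>B. l (Some b) * coords B x b), l None)" for l :: "'m option \<Rightarrow> int"
  have pair: "(\<Sum>j\<in>J. of_int (l j) * X x n j) = of_int (fst (fn l) x + snd (fn l) * n)" for l x n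
    unfolding J_def using finB by (simp add: sum.reindex X_def fn_def add.commute)
  have add: "additive (fst (fn l))" for l
    by standard (simp add: fn_def coords_add[OF B] algebra_simps sum.distrib)
  have iff': "(\<exists>y. (\<forall>k\<in>K'. 0 \<le> y k) \<and> (\<forall>j\<in>J. X x n j = (\<Sum>k\<in>K'. y k * of_int (g k j)))) \<longleftrightarrow>
     (\<forall>l\<in>L. 0 \<le> fst (fn l) x + snd (fn l) * n)" for x n
    unfolding iff[of "X x n"] pair by (simp only: of_int_0_le_iff)
  have unit: "(\<Sum>k'\<in>K'. (if k' = k then 1 else 0) * of_int (g k' j)) = (of_int (g k j) :: rat)" if "k \<in> K'" for k j
  proof -
    have "(\<Sum>k'\<in>K'. (if k' = k then 1 else 0) * of_int (g k' j)) = (\<Sum>k'\<in>K'. if k' = k then (of_int (g k' j)::rat) else 0)"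
      by (intro sum.cong) auto
    then show ?thesis using that fin by simp
  qed
  have gen: "0 \<le> fst (fn l) x + snd (fn l) * n" if "l \<in> L" "k \<in> K'" "\<And>j. j \<in> J \<Longrightarrow> X x n j = of_int (g k j)" for l k x n
    using iff'[of x n] that unit[OF that(2)] by (auto intro!: exI[of _ "\<lambda>k'. if k' = k then 1 else 0"])
  have L1: "0 \<le> fst (fn l) (u k) + snd (fn l) * ord k" if "l \<in> L" "k \<in> K" for l k
    using that by (intro gen[of _ "Some k"]) (auto simp: K'_def J_def X_def g_def)
  have L2: "0 \<le> snd (fn l)" if "l \<in> L" for l
  proof -
    have "0 \<le> fst (fn l) 0 + snd (fn l) * 1"
      using that by (intro gen[of _ None]) (auto simp: K'_def J_def X_def g_def coords_0)
    then show ?thesis using additive.zero[OF add[of l]] by simp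
  qed
  have L3: "\<exists>N\<ge>1. \<exists>c. zscale (int N) x = (\<Sum>k\<in>K. zscale (int (c k)) (u k)) \<and>
         (\<Sum>k\<in>K. int (c k) * ord k) \<le> int N * n" if "\<forall>l\<in>L. 0 \<le> fst (fn l) x + snd (fn l) * n" for x n
  proof -
    obtain y where y: "\<forall>k\<in>K'. 0 \<le> y k" "\<forall>j\<in>J. X x n j = (\<Sum>k\<in>K'. y k * of_int (g k j))"
      using iff'[of x n] \<open>\<forall>l\<in>L. _\<close> by blast
    obtain N c where N: "1 \<le> N" "\<forall>k\<in>K'. of_nat N * y k = of_nat (c k)"
      using common_denominator[OF fin(2) y(1)] by blast
    have eq: "of_nat N * X x n j = of_int (\<Sum>k\<in>K'. int (c k) * g k j)" if "j \<in> J" for j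
    proof -
      have "of_nat N * X x n j = (\<Sum>k\<in>K'. (of_nat N * y k) * of_int (g k j))"
        using y that by (simp add: sum_distrib_left mult.assoc)
      also have "\<dots> = (\<Sum>k\<in>K'. of_nat (c k) * of_int (g k j))" using N by (intro sum.cong) auto
      finally show ?thesis by simp
    qed
    have split: "(\<Sum>k\<in>K'. int (c k) * g k j) = int (c None) * g None j + (\<Sum>k\<in>K. int (c (Some k)) * g (Some k) j)" for j
      unfolding K'_def using K by (simp add: sum.reindex)
    have "rat_of_int (int N * coords B x b) = of_int (\<Sum>k\<in>K. int (c (Some k)) * coords B (u k) b)" if "b \<in> B" for b
      using eq[of "Some b"] that unfolding split by (simp add: J_def X_def g_def)
    then have "int N * coords B x b = (\<Sum>k\<in>K. int (c (Some k)) * coords B (u k) b)" if "b \<in> B" for b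
      using that by (simp only: of_int_eq_iff)
    then have "zscale (int N) x = (\<Sum>k\<in>K. zscale (int (c (Some k))) (u k))"
      by (intro coords_eqI[OF B]) (simp add: coords_zscale[OF B] coords_setsum[OF B])
    moreover have "rat_of_int (int N * n) = of_int (int (c None) + (\<Sum>k\<in>K. int (c (Some k)) * ord k))"
      using eq[of None] unfolding split by (simp add: J_def X_def g_def)
    then have "int N * n = int (c None) + (\<Sum>k\<in>K. int (c (Some k)) * ord k)" by (simp only: of_int_eq_iff)
    ultimately show ?thesis using N by (intro exI[of _ N] conjI exI[of _ "\<lambda>k. c (Some k)"]) auto
  qed
  show ?thesis
    unfolding dual_description_def
  proof (intro exI[of _ "fn ` L"] conjI allI impI)
    show "finite (fn ` L)" using L by simp
    fix v h assume "(v, h) \<in> fn ` L"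
    then obtain l where "l \<in> L" "(v, h) = fn l" by blast
    then have l: "l \<in> L" "v = fst (fn l)" "h = snd (fn l)" by (simp_all flip: \<open>(v, h) = fn l\<close>)
    show "additive v" "0 \<le> h" unfolding l by (rule add, rule L2[OF l(1)])
    show "\<forall>k\<in>K. 0 \<le> v (u k) + h * ord k" unfolding l using L1[OF l(1)] by blast
  next
    fix x n assume *: "\<forall>v h. (v, h) \<in> fn ` L \<longrightarrow> 0 \<le> v x + h * n"
    show "\<exists>N\<ge>1. \<exists>c. zscale (int N) x = (\<Sum>k\<in>K. zscale (int (c k)) (u k)) \<and>
         (\<Sum>k\<in>K. int (c k) * ord k) \<le> int N * n"
    proof (rule L3, rule ballI)
      fix l assume "l \<in> L"
      then have "(fst (fn l), snd (fn l)) \<in> fn ` L" by simp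
      then show "0 \<le> fst (fn l) x + snd (fn l) * n" using * by blast
    qed
  qed
qed

definition lower_bound_polyhedron ::
  "'k set \<Rightarrow> ('k \<Rightarrow> 'm::ab_group_add) \<Rightarrow> ('k \<Rightarrow> int) \<Rightarrow> ('m \<Rightarrow> rat) set" where
  "lower_bound_polyhedron K u ord = {v \<in> NQ. \<forall>k\<in>K. - of_int (ord k) \<le> v (u k)}"

lemma lower_bound_polyhedronD:
  assumes "v \<in> lower_bound_polyhedron K u ord"
  shows "additive v" "k \<in> K \<Longrightarrow> - of_int (ord k) \<le> v (u k)"
  using assms by (simp_all add: lower_bound_polyhedron_def NQ_def)

lemma additive_of_int: "additive v \<Longrightarrow> additive (\<lambda>x. of_int (v x) :: rat)"
  by (simp add: additive_def)

lemma additive_scale: "additive v \<Longrightarrow> additive (\<lambda>x. v x / (c::rat))"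
  by (simp add: additive_def add_divide_distrib)

lemma dual_description_point:
  assumes "dual_description K u ord L" "(v, h) \<in> L" "0 < h"
  shows "(\<lambda>x. rat_of_int (v x) / of_int h) \<in> lower_bound_polyhedron K u ord"
proof -
  note D = dual_descriptionD(2,4)[OF assms(1,2)]
  have "- of_int (ord k) \<le> rat_of_int (v (u k)) / of_int h" if "k \<in> K" for k
  proof -
    have "rat_of_int 0 \<le> of_int (v (u k) + h * ord k)" using D(2)[OF that] by (simp only: of_int_le_iff)
    then show ?thesis using assms(3) by (simp add: field_simps)
  qed
  then show ?thesis
    using D(1) by (simp add: lower_bound_polyhedron_def NQ_def additive_scale additive_of_int)
qed

lemma dual_description_direction:
  assumes "dual_description K u ord L" "(v, 0) \<in> L"
    and x: "x \<in> dual_cone_lattice (lower_bound_polyhedron K u (\<lambda>_. 0))"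
  shows "0 \<le> v x"
proof -
  have "(\<lambda>x. rat_of_int (v x)) \<in> lower_bound_polyhedron K u (\<lambda>_. 0)"
    using dual_descriptionD(2,4)[OF assms(1,2)]
    by (simp add: lower_bound_polyhedron_def NQ_def additive_of_int)
  then have "0 \<le> rat_of_int (v x)" using x by (auto simp: dual_cone_lattice_def)
  then show ?thesis by simp
qed

text \<open>
  The easy half of linear programming duality: pairing a combination of the \<open>u k\<close> with a point of
  the polyhedron bounds the total order of that combination from below.
\<close>

lemma weak_duality:
  assumes v: "v \<in> lower_bound_polyhedron K u ord"
    and x: "zscale (int N) x = (\<Sum>k\<in>K. zscale (int (c k)) (u k))"
  shows "- of_nat N * v x \<le> of_int (\<Sum>k\<in>K. int (c k) * ord k)"
proof -
  note D = lower_bound_polyhedronD[OF v]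
  have "of_nat N * v x = (\<Sum>k\<in>K. of_nat (c k) * v (u k))"
    using arg_cong[OF x, of v] by (simp add: additive_zscale[OF D(1)] additive_sum[OF D(1)])
  also have "\<dots> \<ge> (\<Sum>k\<in>K. of_nat (c k) * (- of_int (ord k)))"
    using D(2) by (intro sum_mono mult_left_mono) auto
  finally show ?thesis by (simp add: sum_negf)
qed

text \<open>
  The finitely many functionals of a dual description test an inequality on the whole polyhedron.
  This stays true for an empty polyhedron, where all functionals have height 0. It gives the
  finitely many integral inequalities for Gordan's lemma.
\<close>

lemma dual_description_bound:
  assumes L: "dual_description K u ord L"
    and x: "x \<in> dual_cone_lattice (lower_bound_polyhedron K u (\<lambda>_. 0))"
  shows "(\<forall>v\<in>lower_bound_polyhedron K u ord. 0 \<le> v x + of_int n) \<longleftrightarrow>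
    (\<forall>v h. (v, h) \<in> L \<longrightarrow> 0 \<le> v x + h * n)"
proof
  assume *: "\<forall>v\<in>lower_bound_polyhedron K u ord. 0 \<le> v x + of_int n"
  show "\<forall>v h. (v, h) \<in> L \<longrightarrow> 0 \<le> v x + h * n"
  proof (intro allI impI)
    fix v h assume vh: "(v, h) \<in> L"
    show "0 \<le> v x + h * n"
    proof (cases "h = 0")
      case True
      then show ?thesis using dual_description_direction[OF L _ x] vh by simp
    next
      case False
      then have h: "0 < h" using dual_descriptionD(3)[OF L vh] by simp
      from bspec[OF * dual_description_point[OF L vh h]]
      have "rat_of_int 0 \<le> of_int (v x + h * n)" using h by (simp add: field_simps)
      then show ?thesis by (simp only: of_int_le_iff)
    qed
  qed
next
  assume *: "\<forall>v h. (v, h) \<in> L \<longrightarrow> 0 \<le> v x + h * n"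
  have "\<exists>N\<ge>1. \<exists>c. zscale (int N) x = (\<Sum>k\<in>K. zscale (int (c k)) (u k)) \<and>
    (\<Sum>k\<in>K. int (c k) * ord k) \<le> int N * n"
    by (rule dual_description_combination[OF L]) (use * in blast)
  then obtain N :: nat and c where N: "N \<ge> 1" "zscale (int N) x = (\<Sum>k\<in>K. zscale (int (c k)) (u k))"
    "(\<Sum>k\<in>K. int (c k) * ord k) \<le> int N * n" by blast
  show "\<forall>v\<in>lower_bound_polyhedron K u ord. 0 \<le> v x + of_int n"
  proof
    fix v assume "v \<in> lower_bound_polyhedron K u ord"
    from weak_duality[OF this N(2)]
    have "- of_nat N * v x \<le> rat_of_int (\<Sum>k\<in>K. int (c k) * ord k)" .
    also have "\<dots> \<le> of_int (int N * n)" using N(3) by (simp only: of_int_le_iff)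
    finally have "0 \<le> of_nat N * (v x + of_int n)" by (simp add: distrib_left)
    then show "0 \<le> v x + of_int n" using N(1) by (simp add: zero_le_mult_iff)
  qed
qed

lemma dual_cone_iff:
  assumes L: "dual_description K u (\<lambda>_. 0) L"
  shows "x \<in> dual_cone_lattice (lower_bound_polyhedron K u (\<lambda>_. 0)) \<longleftrightarrow> (\<forall>v h. (v, h) \<in> L \<longrightarrow> 0 \<le> v x)"
proof
  assume x: "x \<in> dual_cone_lattice (lower_bound_polyhedron K u (\<lambda>_. 0))"
  then show "\<forall>v h. (v, h) \<in> L \<longrightarrow> 0 \<le> v x"
    using dual_description_bound[OF L x, of 0] by (simp add: dual_cone_lattice_def)
next
  assume *: "\<forall>v h. (v, h) \<in> L \<longrightarrow> 0 \<le> v x"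
  have "\<exists>N\<ge>1. \<exists>c. zscale (int N) x = (\<Sum>k\<in>K. zscale (int (c k)) (u k)) \<and>
    (\<Sum>k\<in>K. int (c k) * 0) \<le> int N * 0"
  proof (rule dual_description_combination[OF L])
    fix v h assume "(v, h) \<in> L"
    then have "0 \<le> v x" using * by blast
    then show "0 \<le> v x + h * 0" by simp
  qed
  then obtain N :: nat and c where N: "N \<ge> 1" "zscale (int N) x = (\<Sum>k\<in>K. zscale (int (c k)) (u k))"
    by blast
  have "0 \<le> v x" if "v \<in> lower_bound_polyhedron K u (\<lambda>_. 0)" for v
    using weak_duality[OF that N(2)] N(1) by (simp add: zero_le_mult_iff)
  then show "x \<in> dual_cone_lattice (lower_bound_polyhedron K u (\<lambda>_. 0))"
    by (simp add: dual_cone_lattice_def)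
qed

lemma combination_in_dual_cone:
  fixes B :: "'m::ab_group_add set" and u :: "'k \<Rightarrow> 'm"
  assumes "lattice_basis B" "finite K" and x: "x \<in> dual_cone_lattice (lower_bound_polyhedron K u (\<lambda>_. 0))"
  shows "\<exists>N\<ge>1. \<exists>c. zscale (int N) x = (\<Sum>k\<in>K. zscale (int (c k)) (u k))"
proof -
  obtain L where L: "dual_description K u (\<lambda>_. 0) L"
    using dual_description_of_cone[OF assms(1,2)] by blast
  have "\<exists>N\<ge>1. \<exists>c. zscale (int N) x = (\<Sum>k\<in>K. zscale (int (c k)) (u k)) \<and>
    (\<Sum>k\<in>K. int (c k) * 0) \<le> int N * 0"
  proof (rule dual_description_combination[OF L])
    fix v h assume "(v, h) \<in> L"
    then have "0 \<le> v x" using dual_cone_iff[OF L, of x] x by blast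
    then show "0 \<le> v x + h * 0" by simp
  qed
  then show ?thesis by blast
qed

text \<open>
  If all functionals have height 0, they are nonnegative at \<open>(0, -1)\<close>, so a multiple of \<open>(0, -1)\<close>
  lies in the cone.
\<close>

lemma positive_height_or_certificate:
  assumes L: "dual_description K u ord L"
  shows "(\<exists>v h. (v, h) \<in> L \<and> 0 < h) \<or>
    (\<exists>c. (\<Sum>k\<in>K. zscale (int (c k)) (u k)) = 0 \<and> (\<Sum>k\<in>K. int (c k) * ord k) < 0)"
proof (cases "\<exists>v h. (v, h) \<in> L \<and> 0 < h")
  case False
  have nn: "0 \<le> v 0 + h * (-1)" if "(v, h) \<in> L" for v h
    using additive.zero[OF dual_descriptionD(2)[OF L that]] dual_descriptionD(3)[OF L that] False that
    by fastforce
  have "\<exists>N\<ge>1. \<exists>c. zscale (int N) 0 = (\<Sum>k\<in>K. zscale (int (c k)) (u k)) \<and>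
      (\<Sum>k\<in>K. int (c k) * ord k) \<le> int N * (- 1)"
    by (rule dual_description_combination[OF L]) (rule nn)
  then obtain N :: nat and c where "N \<ge> 1" "zscale (int N) 0 = (\<Sum>k\<in>K. zscale (int (c k)) (u k))"
    "(\<Sum>k\<in>K. int (c k) * ord k) \<le> int N * (- 1)" by blast
  then show ?thesis by (intro disjI2 exI[of _ c]) auto
qed blast

lemma empty_polyhedron_certificate:
  fixes B :: "'m::ab_group_add set" and u :: "'k \<Rightarrow> 'm"
  assumes "lattice_basis B" "finite K" "lower_bound_polyhedron K u ord = {}"
  shows "\<exists>c. (\<Sum>k\<in>K. zscale (int (c k)) (u k)) = 0 \<and> (\<Sum>k\<in>K. int (c k) * ord k) < 0"
proof -
  obtain L where L: "dual_description K u ord L"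
    using dual_description_of_cone[OF assms(1,2)] by blast
  have "\<not> (\<exists>v h. (v, h) \<in> L \<and> 0 < h)" using dual_description_point[OF L] assms(3) by blast
  then show ?thesis using positive_height_or_certificate[OF L] by blast
qed

text \<open>
  Strong duality. The minimum over the polyhedron is the least of the finitely many values at the
  points given by functionals of positive height, and minimality of \<open>a\<close> says that \<open>(x, - a)\<close>,
  cleared of denominators, satisfies all functionals of the dual description. The resulting
  combination of the \<open>u k\<close> will be the exponent vector of a monomial.
\<close>

lemma polyhedron_minimum:
  fixes B :: "'m::ab_group_add set" and u :: "'k \<Rightarrow> 'm"
  assumes "lattice_basis B" "finite K" "lower_bound_polyhedron K u ord \<noteq> {}"
    and x: "x \<in> dual_cone_lattice (lower_bound_polyhedron K u (\<lambda>_. 0))"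
  shows "\<exists>a. (\<exists>v\<in>lower_bound_polyhedron K u ord. v x = a) \<and>
    (\<forall>v\<in>lower_bound_polyhedron K u ord. a \<le> v x) \<and>
    (\<exists>N\<ge>1. \<exists>c. zscale (int N) x = (\<Sum>k\<in>K. zscale (int (c k)) (u k)) \<and>
       of_int (\<Sum>k\<in>K. int (c k) * ord k) \<le> - of_nat N * a)"
proof -
  obtain L where D: "dual_description K u ord L"
    using dual_description_of_cone[OF assms(1,2)] by blast
  let ?D = "lower_bound_polyhedron K u ord"
  define S where "S = (\<lambda>(v, h). rat_of_int (v x) / of_int h) ` {(v, h) \<in> L. h > 0}"
  have S: "finite S" unfolding S_def
    by (intro finite_imageI finite_subset[OF _ dual_descriptionD(1)[OF D]]) auto
  have "\<not> (\<exists>c. (\<Sum>k\<in>K. zscale (int (c k)) (u k)) = 0 \<and> (\<Sum>k\<in>K. int (c k) * ord k) < 0)"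
  proof
    assume "\<exists>c. (\<Sum>k\<in>K. zscale (int (c k)) (u k)) = 0 \<and> (\<Sum>k\<in>K. int (c k) * ord k) < 0"
    then obtain c where c: "(\<Sum>k\<in>K. zscale (int (c k)) (u k)) = 0" "(\<Sum>k\<in>K. int (c k) * ord k) < 0" by blast
    obtain w where w: "w \<in> ?D" using assms(3) by blast
    have "zscale (int 1) 0 = (\<Sum>k\<in>K. zscale (int (c k)) (u k))" using c(1) by simp
    from weak_duality[OF w this] have "0 \<le> rat_of_int (\<Sum>k\<in>K. int (c k) * ord k)"
      using additive.zero[OF lower_bound_polyhedronD(1)[OF w]] by simp
    then have "0 \<le> (\<Sum>k\<in>K. int (c k) * ord k)" by (simp only: of_int_0_le_iff)
    then show False using c(2) by simp
  qed
  then have "S \<noteq> {}" using positive_height_or_certificate[OF D] by (auto simp: S_def)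
  define a where "a = Min S"
  have "a \<in> S" using S \<open>S \<noteq> {}\<close> by (simp add: a_def)
  then obtain v h where vh: "(v, h) \<in> L" "h > 0" "a = rat_of_int (v x) / of_int h" by (auto simp: S_def)
  obtain p q where pq: "q > 0" "a = of_int p / of_int q"
    by (metis quotient_of_div quotient_of_denom_pos old.prod.exhaust)
  have nn: "0 \<le> v (zscale q x) + h * (- p)" if l: "(v, h) \<in> L" for v h
  proof -
    have e: "v (zscale q x) = q * v x" using additive_zscale[OF dual_descriptionD(2)[OF D l]] by simp
    show ?thesis
    proof (cases "h = 0")
      case True
      then show ?thesis using dual_description_direction[OF D _ x] l pq e by simp
    next
      case False
      then have "h > 0" using dual_descriptionD(3)[OF D l] by simp
      then have "rat_of_int (v x) / of_int h \<in> S" using l unfolding S_def by force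
      then have "of_int p / of_int q \<le> rat_of_int (v x) / of_int h"
        using S pq unfolding a_def by (metis Min_le)
      then have "rat_of_int (p * h) \<le> of_int (q * v x)" using pq \<open>h > 0\<close> by (simp add: field_simps)
      then have "p * h \<le> q * v x" by (simp only: of_int_le_iff)
      then show ?thesis using e by (simp add: algebra_simps)
    qed
  qed
  have "\<exists>N\<ge>1. \<exists>c. zscale (int N) (zscale q x) = (\<Sum>k\<in>K. zscale (int (c k)) (u k)) \<and>
      (\<Sum>k\<in>K. int (c k) * ord k) \<le> int N * (- p)"
    by (rule dual_description_combination[OF D]) (rule nn)
  then obtain N :: nat and c where N: "N \<ge> 1"
    "zscale (int N) (zscale q x) = (\<Sum>k\<in>K. zscale (int (c k)) (u k))"
    "(\<Sum>k\<in>K. int (c k) * ord k) \<le> int N * (- p)" by blast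
  have z: "zscale (int (N * nat q)) x = (\<Sum>k\<in>K. zscale (int (c k)) (u k))"
    using N(2) pq unfolding zscale_zscale by simp
  have "rat_of_int (\<Sum>k\<in>K. int (c k) * ord k) \<le> of_int (int N * (- p))" using N(3) by (simp only: of_int_le_iff)
  also have "\<dots> = - of_nat (N * nat q) * a" using pq by simp
  finally have le: "of_int (\<Sum>k\<in>K. int (c k) * ord k) \<le> - of_nat (N * nat q) * a" .
  have pos: "1 \<le> N * nat q" using N pq by simp
  have "a \<le> w x" if "w \<in> ?D" for w
  proof -
    have "- of_nat (N * nat q) * w x \<le> - of_nat (N * nat q) * a"
      using weak_duality[OF that z] le by linarith
    moreover have "0 < rat_of_nat (N * nat q)" using N pq by simp
    ultimately show ?thesis by (metis mult_minus_left neg_le_iff_le mult_le_cancel_left_pos)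
  qed
  moreover have "\<exists>v\<in>?D. v x = a" using dual_description_point[OF D vh(1,2)] vh(3) by (intro bexI) auto
  ultimately show ?thesis using z le pos by blast
qed

section \<open>Gordan's lemma\<close>

text \<open>
  Dickson's lemma. In the induction step, the finite basis \<open>B0\<close> for the coordinates in \<open>J\<close> serves
  every \<open>a\<close> with large \<open>a j\<close>; each of the finitely many smaller values of \<open>a j\<close> gets its own
  basis.
\<close>

lemma dickson:
  fixes A :: "('j \<Rightarrow> nat) set"
  assumes "finite J"
  shows "\<exists>B\<subseteq>A. finite B \<and> (\<forall>a\<in>A. \<exists>b\<in>B. \<forall>j\<in>J. b j \<le> a j)"
  using assms
proof (induction J arbitrary: A rule: finite_induct)
  case empty
  show ?case
  proof (cases "A = {}")
    case True
    then show ?thesis by (intro exI[of _ "{}"]) auto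
  next
    case False
    then obtain a where "a \<in> A" by blast
    then show ?thesis by (intro exI[of _ "{a}"]) auto
  qed
next
  case (insert j J)
  obtain B0 where B0: "B0 \<subseteq> A" "finite B0" "\<forall>a\<in>A. \<exists>b\<in>B0. \<forall>j\<in>J. b j \<le> a j"
    using insert.IH[of A] by blast
  have "\<forall>n. \<exists>B\<subseteq>{a\<in>A. a j = n}. finite B \<and> (\<forall>a\<in>{a\<in>A. a j = n}. \<exists>b\<in>B. \<forall>j\<in>J. b j \<le> a j)"
    using insert.IH by blast
  from choice[OF this] obtain C where C': "\<forall>n. C n \<subseteq> {a\<in>A. a j = n} \<and> finite (C n) \<and>
    (\<forall>a\<in>{a\<in>A. a j = n}. \<exists>b\<in>C n. \<forall>j\<in>J. b j \<le> a j)" ..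
  then have C: "\<And>n. C n \<subseteq> {a\<in>A. a j = n}" "\<And>n. finite (C n)"
    "\<And>n. \<forall>a\<in>{a\<in>A. a j = n}. \<exists>b\<in>C n. \<forall>j\<in>J. b j \<le> a j" by simp_all
  define N where "N = (\<Sum>b\<in>B0. b j)"
  have N: "b j \<le> N" if "b \<in> B0" for b using that B0(2) by (auto simp: N_def intro: member_le_sum)
  have "\<exists>b\<in>B0 \<union> (\<Union>n<N. C n). \<forall>i\<in>insert j J. b i \<le> a i" if aA: "a \<in> A" for a
  proof (cases "a j < N")
    case True
    obtain b where "b \<in> C (a j)" "\<forall>i\<in>J. b i \<le> a i" using C(3)[of "a j"] aA by blast
    moreover from this have "b j = a j" using C(1) by auto
    ultimately show ?thesis using True by (intro bexI[of _ b]) auto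
  next
    case False
    obtain b where "b \<in> B0" "\<forall>j\<in>J. b j \<le> a j" using B0 aA by blast
    then show ?thesis using False N[of b] by (intro bexI[of _ b]) auto
  qed
  moreover have "B0 \<union> (\<Union>n<N. C n) \<subseteq> A" using B0 C(1) by blast
  moreover have "finite (B0 \<union> (\<Union>n<N. C n))" using B0 C(2) by auto
  ultimately show ?case by blast
qed

lemma semigroup_generated_mono: "H \<subseteq> H' \<Longrightarrow> semigroup_generated H \<subseteq> semigroup_generated H'"
  unfolding semigroup_generated_def by (auto simp: lists_mono)

lemma semigroup_generated_zero: "0 \<in> semigroup_generated H"
  unfolding semigroup_generated_def by (rule image_eqI[of _ _ "[]"]) auto

lemma semigroup_generated_add: "h \<in> H \<Longrightarrow> x \<in> semigroup_generated H \<Longrightarrow> h + x \<in> semigroup_generated H"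
  unfolding semigroup_generated_def by (auto intro!: image_eqI[of _ _ "h # _"])

lemma semigroup_generated_least:
  assumes "H \<subseteq> S" "0 \<in> S" "\<And>x y. x \<in> S \<Longrightarrow> y \<in> S \<Longrightarrow> x + y \<in> S"
  shows "semigroup_generated H \<subseteq> S"
proof -
  have "sum_list xs \<in> S" if "set xs \<subseteq> H" for xs using that assms by (induction xs) auto
  then show ?thesis by (auto simp: semigroup_generated_def lists_eq_set)
qed

text \<open>
  When the forms separate points, the map \<open>x \<mapsto> (l x)\<^sub>l\<close> embeds the cone into vectors of natural
  numbers. The elements lying over the minimal vectors generate: subtracting such an element
  strictly decreases the sum of the entries.
\<close>

lemma gordan_pointed:
  fixes X :: "'b::ab_group_add set" and L :: "('b \<Rightarrow> int) set"
  assumes L: "finite L" "\<And>l. l \<in> L \<Longrightarrow> additive l"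
    and X: "\<And>x y. x \<in> X \<Longrightarrow> y \<in> X \<Longrightarrow> x - y \<in> X"
    and inj: "\<And>x. x \<in> X \<Longrightarrow> (\<forall>l\<in>L. l x = 0) \<Longrightarrow> x = 0"
  shows "\<exists>H. finite H \<and> H \<subseteq> {x\<in>X. \<forall>l\<in>L. 0 \<le> l x} \<and> {x\<in>X. \<forall>l\<in>L. 0 \<le> l x} \<subseteq> semigroup_generated H"
proof -
  define S where "S = {x\<in>X. \<forall>l\<in>L. 0 \<le> l x}"
  define f where "f x l = nat (l x)" for x and l :: "'b \<Rightarrow> int"
  obtain B where B: "B \<subseteq> f ` (S - {0})" "finite B" "\<forall>a\<in>f ` (S - {0}). \<exists>b\<in>B. \<forall>l\<in>L. b l \<le> a l"
    using dickson[OF L(1), of "f ` (S - {0})"] by blast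
  obtain H where H: "H \<subseteq> S - {0}" "finite H" "B = f ` H"
    using finite_subset_image[OF B(2,1)] by blast
  have "x \<in> semigroup_generated H" if "x \<in> S" for x
    using that
  proof (induction "\<Sum>l\<in>L. f x l" arbitrary: x rule: less_induct)
    case less
    show ?case
    proof (cases "x = 0")
      case True then show ?thesis by (simp add: semigroup_generated_zero)
    next
      case False
      then obtain h where h: "h \<in> H" "\<forall>l\<in>L. f h l \<le> f x l" using B(3) H(3) less.prems by blast
      have hS: "h \<in> S" "h \<noteq> 0" using h H by auto
      have diff: "l (x - h) = l x - l h" if "l \<in> L" for l using L(2)[OF that] by (rule additive.diff)
      have le: "l h \<le> l x" "0 \<le> l h" if "l \<in> L" for l using h(2)[rule_format, OF that] that less.prems hS
        by (auto simp: f_def S_def)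
      have "0 \<le> l (x - h)" if "l \<in> L" for l using le(1)[OF that] diff[OF that] by simp
      then have "x - h \<in> S" using less.prems hS X by (auto simp: S_def)
      moreover have "(\<Sum>l\<in>L. f (x - h) l) < (\<Sum>l\<in>L. f x l)"
      proof (rule sum_strict_mono_ex1[OF L(1)])
        show "\<forall>l\<in>L. f (x - h) l \<le> f x l"
        proof
          fix l assume "l \<in> L"
          then show "f (x - h) l \<le> f x l" using le[of l] diff[of l] by (simp add: f_def)
        qed
        obtain l where "l \<in> L" "l h \<noteq> 0" using inj[of h] hS by (auto simp: S_def)
        then show "\<exists>l\<in>L. f (x - h) l < f x l" using le[of l] diff[of l]
          by (intro bexI[of _ l]) (auto simp: f_def)
      qed
      ultimately have "x - h \<in> semigroup_generated H" using less.hyps by blast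
      then have "h + (x - h) \<in> semigroup_generated H" by (rule semigroup_generated_add[OF h(1)])
      then show ?thesis by simp
    qed
  qed
  then show ?thesis using H unfolding S_def by (intro exI[of _ H]) auto
qed

text \<open>
  The forms in \<open>L\<close> alone may vanish on a subgroup. Prescribing in addition a sign for every form
  of the separating family \<open>C\<close> cuts the cone into finitely many pieces to which \<open>gordan_pointed\<close>
  applies; \<open>T\<close> is the set of forms prescribed to be nonpositive.
\<close>

lemma gordan:
  fixes X :: "'b::ab_group_add set" and L C :: "('b \<Rightarrow> int) set"
  assumes L: "finite L" "\<And>l. l \<in> L \<Longrightarrow> additive l"
    and C: "finite C" "\<And>l. l \<in> C \<Longrightarrow> additive l"
    and X: "0 \<in> X" "\<And>x y. x \<in> X \<Longrightarrow> y \<in> X \<Longrightarrow> x - y \<in> X"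
    and inj: "\<And>x. x \<in> X \<Longrightarrow> (\<forall>l\<in>C. l x = 0) \<Longrightarrow> x = 0"
  shows "\<exists>H. finite H \<and> semigroup_generated H = {x\<in>X. \<forall>l\<in>L. 0 \<le> l x}"
proof -
  define S where "S = {x\<in>X. \<forall>l\<in>L. 0 \<le> l x}"
  define ext where "ext T = L \<union> (\<lambda>l x. - l x) ` T \<union> (C - T)" for T :: "('b \<Rightarrow> int) set"
  have "\<exists>H. finite H \<and> H \<subseteq> {x\<in>X. \<forall>l\<in>ext T. 0 \<le> l x} \<and> {x\<in>X. \<forall>l\<in>ext T. 0 \<le> l x} \<subseteq> semigroup_generated H"
    if T: "T \<subseteq> C" for T
  proof (rule gordan_pointed)
    show "finite (ext T)" using L(1) C(1) finite_subset[OF T C(1)] by (simp add: ext_def)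
    show "additive l" if "l \<in> ext T" for l
      using that L(2) C(2) T unfolding ext_def additive_def by (fastforce simp: subset_iff)
    show "x = 0" if x: "x \<in> X" "\<forall>l\<in>ext T. l x = 0" for x
    proof (rule inj[OF x(1)], rule ballI)
      fix l assume "l \<in> C"
      then have "l \<in> ext T \<or> (\<lambda>x. - l x) \<in> ext T" by (auto simp: ext_def)
      then show "l x = 0" using x(2) by fastforce
    qed
  qed (fact X)
  then have "\<forall>T\<in>Pow C. \<exists>H. finite H \<and> H \<subseteq> {x\<in>X. \<forall>l\<in>ext T. 0 \<le> l x} \<and>
    {x\<in>X. \<forall>l\<in>ext T. 0 \<le> l x} \<subseteq> semigroup_generated H" by simp
  from bchoice[OF this] obtain H where H': "\<forall>T\<in>Pow C. finite (H T) \<and> H T \<subseteq> {x\<in>X. \<forall>l\<in>ext T. 0 \<le> l x} \<and>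
    {x\<in>X. \<forall>l\<in>ext T. 0 \<le> l x} \<subseteq> semigroup_generated (H T)" ..
  then have H: "\<And>T. T \<subseteq> C \<Longrightarrow> finite (H T)"
    "\<And>T. T \<subseteq> C \<Longrightarrow> H T \<subseteq> {x\<in>X. \<forall>l\<in>ext T. 0 \<le> l x}"
    "\<And>T. T \<subseteq> C \<Longrightarrow> {x\<in>X. \<forall>l\<in>ext T. 0 \<le> l x} \<subseteq> semigroup_generated (H T)" by simp_all
  define HH where "HH = (\<Union>T\<in>Pow C. H T)"
  have "finite HH" using H(1) C(1) by (auto simp: HH_def)
  have "HH \<subseteq> S"
  proof
    fix x assume "x \<in> HH"
    then obtain T where "T \<subseteq> C" "x \<in> H T" by (auto simp: HH_def)
    then have "x \<in> {x\<in>X. \<forall>l\<in>ext T. 0 \<le> l x}" using H(2) by blast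
    then show "x \<in> S" by (simp add: S_def ext_def)
  qed
  then have "semigroup_generated HH \<subseteq> S"
  proof (rule semigroup_generated_least)
    have "0 \<le> l 0" if "l \<in> L" for l using additive.zero[OF L(2)[OF that]] by simp
    then show "0 \<in> S" using X(1) by (simp add: S_def)
    fix x y assume xy: "x \<in> S" "y \<in> S"
    then have "x - (0 - y) \<in> X" by (intro X) (simp_all add: S_def)
    moreover have "0 \<le> l (x + y)" if "l \<in> L" for l
      using additive.add[OF L(2)[OF that], of x y] xy that by (simp add: S_def)
    ultimately show "x + y \<in> S" by (simp add: S_def)
  qed
  moreover have "S \<subseteq> semigroup_generated HH"
  proof
    fix x assume x: "x \<in> S"
    define T where "T = {l\<in>C. l x < 0}"
    have T: "T \<subseteq> C" by (auto simp: T_def)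
    have "x \<in> {x\<in>X. \<forall>l\<in>ext T. 0 \<le> l x}" using x by (auto simp: S_def ext_def T_def)
    then have "x \<in> semigroup_generated (H T)" using H(3)[OF T] by blast
    then show "x \<in> semigroup_generated HH"
      using semigroup_generated_mono[of "H T" HH] T by (auto simp: HH_def)
  qed
  ultimately show ?thesis using \<open>finite HH\<close> unfolding S_def by blast
qed

section \<open>The projective line\<close>

text \<open>
  Over a finite field the product of all \<open>X - a\<close>, plus 1, has no root.
\<close>

lemma infinite_UNIV_alg_closed: "infinite (UNIV :: 'k::alg_closed_field set)"
proof
  assume fin: "finite (UNIV :: 'k set)"
  define p :: "'k poly" where "p = (\<Prod>a\<in>UNIV. [:- a, 1:]) + 1"
  have d: "degree (\<Prod>a\<in>(UNIV::'k set). [:- a, 1:]) = card (UNIV::'k set)"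
    by (subst degree_prod_eq_sum_degree) auto
  have "card (UNIV::'k set) > 0" using fin by (simp add: card_gt_0_iff)
  then have "degree p > 0" using d unfolding p_def by (subst degree_add_eq_left) auto
  then obtain x where "poly p x = 0" using alg_closed_imp_poly_has_root by blast
  moreover have "poly p x = 1" using fin by (auto simp: p_def poly_prod prod_zero_iff)
  ultimately show False by simp
qed

subsection \<open>Orders at points\<close>

lemma Fract_obtain:
  fixes f :: "'a::idom fract"
  assumes "f \<noteq> 0"
  obtains p q where "f = Fract p q" "p \<noteq> 0" "q \<noteq> 0"
proof (cases f)
  case (Fract a b)
  with assms have "a \<noteq> 0" by (metis fract_collapse(1))
  with Fract that show ?thesis by blast
qed

lemma poly_ord_1 [simp]: "poly_ord x 1 = 0"
  by (cases x) auto

lemma poly_ord_add: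
  assumes "p \<noteq> 0" "q \<noteq> 0" "p + q \<noteq> 0"
  shows "min (poly_ord x p) (poly_ord x q) \<le> poly_ord x (p + q)"
proof (cases x)
  case None
  then show ?thesis using degree_add_le_max[of p q] by auto
next
  case (Some a)
  let ?n = "min (order a p) (order a q)"
  have "[:- a, 1:] ^ ?n dvd p" "[:- a, 1:] ^ ?n dvd q" by (simp_all add: order_divides)
  then have "[:- a, 1:] ^ ?n dvd p + q" by (rule dvd_add)
  then have "?n \<le> order a (p + q)" using assms by (simp add: order_divides)
  then show ?thesis using Some by auto
qed

lemma ord_at_mult:
  assumes "f \<noteq> 0" "g \<noteq> 0"
  shows "ord_at x (f * g) = ord_at x f + ord_at x g"
proof -
  obtain p q where f: "f = Fract p q" "p \<noteq> 0" "q \<noteq> 0" using Fract_obtain assms by metis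
  obtain r s where g: "g = Fract r s" "r \<noteq> 0" "s \<noteq> 0" using Fract_obtain assms by metis
  show ?thesis using f g by (simp add: ord_at_Fract poly_ord_mult)
qed

lemma ord_at_to_fract: "p \<noteq> 0 \<Longrightarrow> ord_at x (to_fract p) = poly_ord x p"
  unfolding to_fract_def by (subst ord_at_Fract) auto

lemma ord_at_const [simp]: "c \<noteq> 0 \<Longrightarrow> ord_at x (to_fract [:c:]) = 0"
  by (subst ord_at_to_fract) (cases x; auto intro: order_0I)+

lemma ord_at_1 [simp]: "ord_at x 1 = 0"
  using ord_at_to_fract[of 1 x] by simp

lemma ord_at_inverse: "f \<noteq> 0 \<Longrightarrow> ord_at x (inverse f) = - ord_at x f"
  using ord_at_mult[of f "inverse f" x] by simp

lemma ord_at_divide: "f \<noteq> 0 \<Longrightarrow> g \<noteq> 0 \<Longrightarrow> ord_at x (f / g) = ord_at x f - ord_at x g"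
  by (simp add: divide_inverse ord_at_mult ord_at_inverse)

lemma ord_at_power: "f \<noteq> 0 \<Longrightarrow> ord_at x (f ^ n) = int n * ord_at x f"
  by (induction n) (simp_all add: ord_at_mult algebra_simps)

lemma ord_at_power_int: "f \<noteq> 0 \<Longrightarrow> ord_at x (f powi n) = n * ord_at x f"
  by (simp add: power_int_def ord_at_power ord_at_inverse power_inverse)

lemma ord_at_prod: "(\<And>i. i \<in> I \<Longrightarrow> f i \<noteq> 0) \<Longrightarrow> ord_at x (\<Prod>i\<in>I. f i) = (\<Sum>i\<in>I. ord_at x (f i))"
  by (induction I rule: infinite_finite_induct) (auto simp: ord_at_mult)

lemma to_fract_minus_one: "to_fract [:-1:] = (-1 :: 'k::field poly fract)"
proof -
  have "[:-1:] = (- 1 :: 'k poly)" by (simp add: one_pCons)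
  then show ?thesis by simp
qed

lemma ord_at_uminus: "ord_at x (- f) = ord_at x f"
proof (cases "f = 0")
  case False
  have "- f = to_fract [:-1:] * f" unfolding to_fract_minus_one by simp
  then show ?thesis using False ord_at_mult[of "to_fract [:-1:]" f x] by simp
qed simp

lemma ord_at_add:
  assumes "f \<noteq> 0" "g \<noteq> 0" "f + g \<noteq> 0"
  shows "min (ord_at x f) (ord_at x g) \<le> ord_at x (f + g)"
proof -
  obtain p q where f: "f = Fract p q" "p \<noteq> 0" "q \<noteq> 0" using Fract_obtain assms by metis
  obtain r s where g: "g = Fract r s" "r \<noteq> 0" "s \<noteq> 0" using Fract_obtain assms by metis
  have eq: "f + g = Fract (p * s + r * q) (q * s)" using f g by simp
  then have ne: "p * s + r * q \<noteq> 0" using assms by (metis fract_collapse(1))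
  have "min (poly_ord x (p * s)) (poly_ord x (r * q)) \<le> poly_ord x (p * s + r * q)"
    using f g ne by (intro poly_ord_add) auto
  then show ?thesis unfolding eq using f g ne by (simp add: ord_at_Fract poly_ord_mult)
qed

lemma ord_at_add_ge:
  assumes "f + g \<noteq> 0" "f \<noteq> 0 \<Longrightarrow> n \<le> ord_at x f" "g \<noteq> 0 \<Longrightarrow> n \<le> ord_at x g"
  shows "n \<le> ord_at x (f + g)"
  using assms ord_at_add[of f g x] by (cases "f = 0"; cases "g = 0") auto

lemma ord_at_sum_ge:
  assumes "(\<Sum>i\<in>I. f i) \<noteq> 0" "\<And>i. i \<in> I \<Longrightarrow> f i \<noteq> 0 \<Longrightarrow> n \<le> ord_at x (f i)"
  shows "n \<le> ord_at x (\<Sum>i\<in>I. f i)"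
proof -
  have "(\<Sum>i\<in>I. f i) \<noteq> 0 \<longrightarrow> n \<le> ord_at x (\<Sum>i\<in>I. f i)"
    using assms(2)
  proof (induction I rule: infinite_finite_induct)
    case (insert i I)
    then show ?case by (auto intro!: ord_at_add_ge)
  qed auto
  then show ?thesis using assms(1) by blast
qed

lemma ord_at_add_dominant:
  assumes "f \<noteq> 0" "g \<noteq> 0 \<Longrightarrow> ord_at x f < ord_at x g"
  shows "f + g \<noteq> 0 \<and> ord_at x (f + g) = ord_at x f"
proof (cases "g = 0")
  case False
  then have lt: "ord_at x f < ord_at x g" using assms by blast
  have ne: "f + g \<noteq> 0"
  proof
    assume "f + g = 0" then have "f = - g" by (simp add: eq_neg_iff_add_eq_0)
    then show False using lt by (simp add: ord_at_uminus)
  qed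
  have "ord_at x f \<le> ord_at x (f + g)" using ord_at_add[OF assms(1) False ne, of x] lt by auto
  moreover have "min (ord_at x (f + g)) (ord_at x (- g)) \<le> ord_at x ((f + g) + - g)"
    using ne False assms(1) by (intro ord_at_add) auto
  then have "min (ord_at x (f + g)) (ord_at x g) \<le> ord_at x f" by (simp add: ord_at_uminus)
  ultimately show ?thesis using ne lt by auto
qed (use assms in simp)

text \<open>
  The constant is the value of \<open>f\<close> at \<open>x\<close>: at infinity the quotient of the coefficients in degree
  \<open>degree q\<close>, at a finite point the quotient of the values after cancelling a power of \<open>X - a\<close>.
\<close>

lemma residue_exists:
  fixes f :: "'k::field poly fract"
  assumes "f = 0 \<or> 0 \<le> ord_at x f"
  shows "\<exists>c. f = to_fract [:c:] \<or> 0 < ord_at x (f - to_fract [:c:])"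
proof (cases "f = 0")
  case True
  then show ?thesis by (intro exI[of _ 0]) simp
next
  case False
  then obtain p q where f: "f = Fract p q" "p \<noteq> 0" "q \<noteq> 0" using Fract_obtain by metis
  then have le: "poly_ord x q \<le> poly_ord x p" using assms False by (simp add: ord_at_Fract)
  obtain c where c: "p - Polynomial.smult c q = 0 \<or> poly_ord x q < poly_ord x (p - Polynomial.smult c q)"
  proof (cases x)
    case None
    define c where "c = coeff p (degree q) / lead_coeff q"
    have "coeff (p - Polynomial.smult c q) (degree q) = 0" using f by (simp add: c_def)
    moreover have "degree (p - Polynomial.smult c q) \<le> degree q"
      using le None by (intro degree_diff_le) auto
    ultimately have "p - Polynomial.smult c q = 0 \<or> degree (p - Polynomial.smult c q) < degree q"
      by (metis leading_coeff_0_iff le_neq_implies_less)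
    then show ?thesis using None by (intro that[of c]) auto
  next
    case (Some a)
    define n where "n = order a q"
    obtain q' where q': "q = [:- a, 1:] ^ n * q'" "poly q' a \<noteq> 0"
      using order_decomp[OF f(3), of a] unfolding n_def poly_eq_0_iff_dvd by blast
    obtain p' where p': "p = [:- a, 1:] ^ n * p'"
    proof -
      have "[:- a, 1:] ^ n dvd p" using le Some by (simp add: n_def order_divides)
      then show ?thesis by (rule dvdE) (rule that)
    qed
    define c where "c = poly p' a / poly q' a"
    have "poly (p' - Polynomial.smult c q') a = 0" using q' by (simp add: c_def)
    then have "[:- a, 1:] dvd p' - Polynomial.smult c q'" by (simp only: poly_eq_0_iff_dvd)
    then have "[:- a, 1:] ^ n * [:- a, 1:] dvd [:- a, 1:] ^ n * (p' - Polynomial.smult c q')" by (rule mult_dvd_mono[OF dvd_refl])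
    moreover have "[:- a, 1:] ^ n * (p' - Polynomial.smult c q') = p - Polynomial.smult c q" unfolding p' q'(1) by (simp add: algebra_simps)
    ultimately have "[:- a, 1:] ^ Suc n dvd p - Polynomial.smult c q" by (simp only: power_Suc2)
    then show ?thesis using Some that[of c] order_divides[of a "Suc n"] by (auto simp: n_def)
  qed
  have eq: "f - to_fract [:c:] = Fract (p - Polynomial.smult c q) q"
    unfolding f(1) to_fract_def using f(3) by simp
  show ?thesis
  proof (cases "p - Polynomial.smult c q = 0")
    case True
    then have "f - to_fract [:c:] = 0" unfolding eq by (simp add: fract_collapse)
    then show ?thesis by auto
  next
    case False
    then have "0 < ord_at x (f - to_fract [:c:])" unfolding eq using c f by (simp add: ord_at_Fract)
    then show ?thesis by blast
  qed
qed

subsection \<open>Principal divisors\<close>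

lemma poly_linear_induct [consumes 1, case_names const linear]:
  fixes p :: "'k::alg_closed_field poly"
  assumes "p \<noteq> 0" "\<And>c. c \<noteq> 0 \<Longrightarrow> P [:c:]" "\<And>a q. q \<noteq> 0 \<Longrightarrow> P q \<Longrightarrow> P ([:- a, 1:] * q)"
  shows "P p"
  using assms(1)
proof (induction "degree p" arbitrary: p rule: less_induct)
  case less
  show ?case
  proof (cases "degree p = 0")
    case True
    then obtain c where "p = [:c:]" by (metis degree_eq_zeroE)
    then show ?thesis using assms(2) less.prems by auto
  next
    case False
    then obtain a where "poly p a = 0" using alg_closed_imp_poly_has_root[of p] by auto
    then obtain q where q: "p = [:- a, 1:] * q" by (auto simp: poly_eq_0_iff_dvd elim: dvdE)
    then have "q \<noteq> 0" using less.prems by auto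
    then have "degree p = 1 + degree q" unfolding q by (subst degree_mult_eq) auto
    then show ?thesis using less.hyps[of q] \<open>q \<noteq> 0\<close> assms(3) q by auto
  qed
qed

lemma poly_ord_linear: "poly_ord x [:- a, 1:] = (if x = Some a then 1 else 0) - (if x = None then 1 else 0)"
proof (cases x)
  case (Some b)
  have "order b [:- a, 1:] = (if b = a then 1 else 0)"
  proof (cases "b = a")
    case True then show ?thesis using order_power_n_n[of a 1] by simp
  next
    case False then show ?thesis by (simp add: order_0I)
  qed
  then show ?thesis using Some by simp
qed simp

text \<open>
  By induction on linear factors: \<open>X - a\<close> has a simple zero at \<open>a\<close> and a simple pole at infinity.
  The sum runs over any finite set that contains the support, so that divisors can be added on a
  common set.
\<close>

lemma degree_poly_divisor:
  fixes p :: "'k::alg_closed_field poly"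
  assumes "p \<noteq> 0"
  shows "finite {x. poly_ord x p \<noteq> 0} \<and> (\<forall>S. finite S \<longrightarrow> {x. poly_ord x p \<noteq> 0} \<subseteq> S \<longrightarrow> (\<Sum>x\<in>S. poly_ord x p) = 0)"
  using assms
proof (induction p rule: poly_linear_induct)
  case (const c)
  have "poly_ord x [:c:] = 0" for x using const by (cases x) (auto intro: order_0I)
  then show ?case by simp
next
  case (linear a q)
  have eq: "poly_ord x ([:- a, 1:] * q) = poly_ord x [:- a, 1:] + poly_ord x q" for x
    using linear(1) by (intro poly_ord_mult) auto
  have "{x. poly_ord x ([:- a, 1:] * q) \<noteq> 0} \<subseteq> {x. poly_ord x q \<noteq> 0} \<union> {Some a, None}"
    unfolding eq poly_ord_linear by auto
  then have fin: "finite {x. poly_ord x ([:- a, 1:] * q) \<noteq> 0}"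
    by (rule finite_subset) (use linear(2) in simp)
  have "(\<Sum>x\<in>S. poly_ord x ([:- a, 1:] * q)) = 0" if S: "finite S" "{x. poly_ord x ([:- a, 1:] * q) \<noteq> 0} \<subseteq> S" for S
  proof -
    define T where "T = S \<union> {x. poly_ord x q \<noteq> 0} \<union> {Some a, None}"
    have T: "finite T" using S linear(2) by (auto simp: T_def)
    have "(\<Sum>x\<in>S. poly_ord x ([:- a, 1:] * q)) = (\<Sum>x\<in>T. poly_ord x ([:- a, 1:] * q))"
      by (rule sum.mono_neutral_left[OF T]) (use S in \<open>auto simp: T_def\<close>)
    also have "\<dots> = (\<Sum>x\<in>T. poly_ord x [:- a, 1:]) + (\<Sum>x\<in>T. poly_ord x q)"
      unfolding eq by (simp add: sum.distrib)
    also have "(\<Sum>x\<in>T. poly_ord x q) = 0"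
      by (rule conjunct2[OF linear(2), rule_format, OF T]) (auto simp: T_def)
    also have "(\<Sum>x\<in>T. poly_ord x [:- a, 1:]) = 0"
      unfolding poly_ord_linear using T by (simp add: sum_subtractf T_def)
    finally show ?thesis by simp
  qed
  then show ?case using fin by blast
qed

lemmas finite_poly_ord_support = conjunct1[OF degree_poly_divisor]
lemmas sum_poly_ord = conjunct2[OF degree_poly_divisor, rule_format]

lemma finite_ord_support:
  fixes f :: "'k::alg_closed_field poly fract"
  assumes "f \<noteq> 0"
  shows "finite {x. ord_at x f \<noteq> 0}"
proof -
  obtain p q where f: "f = Fract p q" "p \<noteq> 0" "q \<noteq> 0" using Fract_obtain assms by metis
  have "{x. ord_at x f \<noteq> 0} \<subseteq> {x. poly_ord x p \<noteq> 0} \<union> {x. poly_ord x q \<noteq> 0}"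
    using f by (auto simp: ord_at_Fract)
  then show ?thesis
    by (rule finite_subset)
      (simp add: finite_poly_ord_support f)
qed

lemma degree_principal_divisor:
  fixes f :: "'k::alg_closed_field poly fract"
  assumes "f \<noteq> 0" "finite S" "{x. ord_at x f \<noteq> 0} \<subseteq> S"
  shows "(\<Sum>x\<in>S. ord_at x f) = 0"
proof -
  obtain p q where f: "f = Fract p q" "p \<noteq> 0" "q \<noteq> 0" using Fract_obtain assms by metis
  define T where "T = S \<union> {x. poly_ord x p \<noteq> 0} \<union> {x. poly_ord x q \<noteq> 0}"
  have T: "finite T" using assms f by (simp add: T_def finite_poly_ord_support)
  have "(\<Sum>x\<in>S. ord_at x f) = (\<Sum>x\<in>T. ord_at x f)"
    by (rule sum.mono_neutral_left[OF T]) (use assms in \<open>auto simp: T_def\<close>)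
  also have "\<dots> = (\<Sum>x\<in>T. poly_ord x p) - (\<Sum>x\<in>T. poly_ord x q)"
    using f by (simp add: ord_at_Fract sum_subtractf)
  also have "\<dots> = 0" by (subst (1 2) sum_poly_ord[OF _ T]) (use f in \<open>auto simp: T_def\<close>)
  finally show ?thesis .
qed

text \<open>
  The zeros outside \<open>S\<close> account for the defect to degree 0.
\<close>

lemma sum_ord_le_0:
  fixes f :: "'k::alg_closed_field poly fract"
  assumes "f \<noteq> 0" "finite S" "\<And>x. x \<notin> S \<Longrightarrow> 0 \<le> ord_at x f"
  shows "(\<Sum>x\<in>S. ord_at x f) \<le> 0"
proof -
  define T where "T = S \<union> {x. ord_at x f \<noteq> 0}"
  have T: "finite T" using assms finite_ord_support[OF assms(1)] by (auto simp: T_def)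
  have "0 = (\<Sum>x\<in>T. ord_at x f)" by (subst degree_principal_divisor[OF assms(1) T]) (simp_all add: T_def)
  also have "\<dots> = (\<Sum>x\<in>S. ord_at x f) + (\<Sum>x\<in>T - S. ord_at x f)"
    using T by (subst sum.subset_diff[of S T]) (auto simp: T_def)
  also have "\<dots> \<ge> (\<Sum>x\<in>S. ord_at x f)" using assms(3) by (auto intro!: sum_nonneg)
  finally show ?thesis .
qed

text \<open>
  Subtracting the value at infinity would leave a nonzero function with a zero and no pole,
  contrary to degree 0.
\<close>

lemma regular_everywhere_const:
  fixes f :: "'k::alg_closed_field poly fract"
  assumes "\<And>x. f \<noteq> 0 \<Longrightarrow> 0 \<le> ord_at x f"
  shows "\<exists>c. f = to_fract [:c:]"
proof (rule ccontr)
  assume nc: "\<not> ?thesis"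
  then have "f \<noteq> 0" by (metis pCons_0_0 to_fract_0)
  then obtain c where c: "0 < ord_at None (f - to_fract [:c:])"
    using residue_exists[of f None] assms nc by blast
  let ?g = "f - to_fract [:c:]"
  have g: "?g \<noteq> 0" using nc by auto
  have nn: "0 \<le> ord_at x ?g" for x
    using ord_at_add_ge[of f "- to_fract [:c:]" 0 x] g assms \<open>f \<noteq> 0\<close>
    by (cases "c = 0") (auto simp: ord_at_uminus simp del: to_fract_uminus)
  define S where "S = insert None {x. ord_at x ?g \<noteq> 0}"
  have S: "finite S" using finite_ord_support[OF g] by (simp add: S_def)
  have "0 = (\<Sum>x\<in>S. ord_at x ?g)" by (subst degree_principal_divisor[OF g S]) (auto simp: S_def)
  moreover have "\<dots> \<ge> ord_at None ?g" using S nn by (intro member_le_sum) (auto simp: S_def)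
  ultimately show False using c by simp
qed

lemma lowest_terms:
  fixes f :: "'k::field poly fract"
  shows "\<exists>p q. f = Fract p q \<and> q \<noteq> 0 \<and> (\<forall>a. poly p a \<noteq> 0 \<or> poly q a \<noteq> 0)"
proof -
  have "\<exists>p' q'. Fract p q = Fract p' q' \<and> q' \<noteq> 0 \<and> (\<forall>a. poly p' a \<noteq> 0 \<or> poly q' a \<noteq> 0)"
    if "q \<noteq> 0" for p q :: "'k poly"
    using that
  proof (induction "degree q" arbitrary: p q rule: less_induct)
    case less
    show ?case
    proof (cases "\<exists>a. poly p a = 0 \<and> poly q a = 0")
      case False
      then show ?thesis using less.prems by blast
    next
      case True
      then obtain a p' q' where pq: "p = [:- a, 1:] * p'" "q = [:- a, 1:] * q'"
        by (auto simp: poly_eq_0_iff_dvd elim!: dvdE)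
      then have "q' \<noteq> 0" using less.prems by auto
      moreover from this have "degree q' < degree q" unfolding pq by (subst degree_mult_eq) auto
      moreover have "Fract p q = Fract p' q'"
        using less.prems \<open>q' \<noteq> 0\<close> unfolding pq by (subst eq_fract) (auto simp: algebra_simps)
      ultimately show ?thesis using less.hyps[of q' p'] by metis
    qed
  qed
  then show ?thesis by (cases f) blast
qed

subsection \<open>Valuations of the function field\<close>

text \<open>
  A valuation is determined by its values on the linear polynomials \<open>t a = X - a\<close>, any two of
  which differ by a constant. So if one of these values is negative, all of them agree and the
  valuation is a multiple of the order at infinity. Otherwise at most one of them is positive,
  because a nonzero constant cannot be the difference of two elements of positive value, and that
  one marks a finite point. If all values vanish, \<open>c = 0\<close> works with any point.
\<close>

lemma valuation_of_function_field:
  fixes \<nu> :: "'k::alg_closed_field poly fract \<Rightarrow> 'g::linordered_ab_group_add"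
  assumes const_rule: "\<And>c. c \<noteq> 0 \<Longrightarrow> \<nu> (to_fract [:c:]) = 0"
    and mult: "\<And>f g. f \<noteq> 0 \<Longrightarrow> g \<noteq> 0 \<Longrightarrow> \<nu> (f * g) = \<nu> f + \<nu> g"
    and add: "\<And>f g. f \<noteq> 0 \<Longrightarrow> g \<noteq> 0 \<Longrightarrow> f + g \<noteq> 0 \<Longrightarrow> min (\<nu> f) (\<nu> g) \<le> \<nu> (f + g)"
  shows "\<exists>x c. \<forall>f. f \<noteq> 0 \<longrightarrow> \<nu> f = zscale (ord_at x f) c"
proof -
  have red: "\<forall>f. f \<noteq> 0 \<longrightarrow> \<nu> f = zscale (ord_at x f) c"
    if lin: "\<And>a. \<nu> (to_fract [:- a, 1:]) = zscale (poly_ord x [:- a, 1:]) c" for x c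
  proof (intro allI impI)
    have p: "\<nu> (to_fract p) = zscale (poly_ord x p) c" if "p \<noteq> 0" for p
      using that
    proof (induction p rule: poly_linear_induct)
      case (const d)
      have "poly_ord x [:d:] = 0" using const by (cases x) (auto intro: order_0I)
      then show ?case using const_rule[OF const] by simp
    next
      case (linear a q)
      have "poly_ord x ([:- a, 1:] * q) = poly_ord x [:- a, 1:] + poly_ord x q"
        using linear by (intro poly_ord_mult) auto
      then show ?case using linear lin[of a] mult[of "to_fract [:- a, 1:]" "to_fract q"]
        by (simp only: to_fract_mult zscale_add_left to_fract_eq_0_iff) simp
    qed
    fix f :: "'k poly fract" assume "f \<noteq> 0"
    then obtain p q where f: "f = Fract p q" "p \<noteq> 0" "q \<noteq> 0" using Fract_obtain by metis
    have "f * to_fract q = to_fract p" using f by (simp add: Fract_conv_to_fract)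
    then have "\<nu> f + \<nu> (to_fract q) = \<nu> (to_fract p)" using mult[of f "to_fract q"] f \<open>f \<noteq> 0\<close> by simp
    then have "\<nu> f = zscale (poly_ord x p) c - zscale (poly_ord x q) c"
      using p f by (simp add: algebra_simps)
    then show "\<nu> f = zscale (ord_at x f) c" using f by (simp add: ord_at_Fract zmod.scale_left_diff_distrib)
  qed
  define t :: "'k \<Rightarrow> 'k poly fract" where "t a = to_fract [:- a, 1:]" for a
  have t0: "t a \<noteq> 0" for a by (simp add: t_def)
  have diff: "t a = t b + to_fract [:b - a:]" for a b
    by (simp add: t_def to_fract_add[symmetric] del: to_fract_add)
  have min0: "min (\<nu> (t b)) 0 \<le> \<nu> (t a)" for a b
  proof (cases "a = b")
    case False
    then show ?thesis using add[OF t0, of "to_fract [:b - a:]" b] diff[of a b] t0[of a] const_rule[of "b - a"] by auto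
  qed simp
  show ?thesis
  proof (cases "\<exists>b. \<nu> (t b) \<noteq> 0")
    case False
    then have "\<nu> (t a) = zscale (poly_ord None [:- a, 1:]) 0" for a by simp
    then show ?thesis using red[of None 0] unfolding t_def by blast
  next
    case True
    then obtain b where b: "\<nu> (t b) \<noteq> 0" by blast
    show ?thesis
    proof (cases "\<nu> (t b) < 0")
      case True
      have "\<nu> (t a) = \<nu> (t b)" for a
      proof -
        have le: "\<nu> (t b) \<le> \<nu> (t a)" using min0[of b a] True by auto
        have "min (\<nu> (t a)) 0 \<le> \<nu> (t b)" by (rule min0)
        then show ?thesis using True le by (auto simp: min_def split: if_splits)
      qed
      then have "\<nu> (t a) = zscale (poly_ord None [:- a, 1:]) (- \<nu> (t b))" for a
        by (simp add: zscale_minus_one[of 0, simplified])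
      then show ?thesis using red[of None "- \<nu> (t b)"] unfolding t_def by blast
    next
      case False
      then have pos: "0 < \<nu> (t b)" using b by auto
      have nn: "0 \<le> \<nu> (t a)" for a using min0[of b a] pos by auto
      have "\<nu> (t a) = 0" if "a \<noteq> b" for a
      proof (rule ccontr)
        assume "\<nu> (t a) \<noteq> 0"
        then have pa: "0 < \<nu> (t a)" using nn[of a] by auto
        have ne: "- t b \<noteq> 0" using t0 by simp
        have eq: "t a + - t b = to_fract [:b - a:]" using diff[of a b] by simp
        have "- t b = to_fract [:-1:] * t b" unfolding to_fract_minus_one by simp
        then have "\<nu> (- t b) = \<nu> (t b)" using mult[of "to_fract [:-1:]" "t b"] const_rule[of "-1"] t0 by simp
        moreover have "min (\<nu> (t a)) (\<nu> (- t b)) \<le> \<nu> (t a + - t b)"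
          using that ne t0 by (intro add) (simp_all only: eq, simp_all)
        ultimately have "min (\<nu> (t a)) (\<nu> (t b)) \<le> 0" using const_rule[of "b - a"] that unfolding eq by simp
        then show False using pa pos by (auto simp: min_def split: if_splits)
      qed
      then have "\<nu> (t a) = zscale (poly_ord (Some b) [:- a, 1:]) (\<nu> (t b))" for a
        unfolding poly_ord_linear by (cases "a = b") (auto simp: zscale_plus_one[of 0, simplified])
      then show ?thesis using red[of "Some b" "\<nu> (t b)"] unfolding t_def by blast
    qed
  qed
qed

subsection \<open>Divisibility and Bezout relations\<close>

lemma dvd_of_orders:
  fixes d p :: "'k::alg_closed_field poly"
  assumes "d \<noteq> 0" "p \<noteq> 0" "\<And>a. order a d \<le> order a p"
  shows "d dvd p"
  using assms
proof (induction d arbitrary: p rule: poly_linear_induct)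
  case (const c)
  then show ?case by (simp add: const_poly_dvd_iff dvd_field_iff)
next
  case (linear a q)
  have o: "order b ([:- a, 1:] * q) = order b [:- a, 1:] + order b q" for b
    using linear(1) by (intro order_mult) (simp del: mult_pCons_left)
  have oa: "order a [:- a, 1:] = 1" using order_power_n_n[of a 1] by simp
  have "poly p a = 0" using linear(4)[of a] linear(3) unfolding o oa by (subst order_root) auto
  then obtain r where r: "p = [:- a, 1:] * r" by (auto simp: poly_eq_0_iff_dvd elim: dvdE)
  then have "r \<noteq> 0" using linear(3) by auto
  then have o': "order b p = order b [:- a, 1:] + order b r" for b
    unfolding r by (intro order_mult) (simp del: mult_pCons_left)
  have "order b q \<le> order b r" for b using linear(4)[of b] unfolding o o' by simp
  then have "q dvd r" using linear(2) \<open>r \<noteq> 0\<close> by blast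
  then show ?case unfolding r by (rule mult_dvd_mono[OF dvd_refl])
qed

text \<open>
  A nonzero combination \<open>d\<close> of least degree divides every \<open>p j\<close>, since the remainder of \<open>p j\<close>
  modulo \<open>d\<close> is again a combination.
\<close>

lemma polynomial_bezout:
  fixes p :: "'j \<Rightarrow> 'k::field poly"
  assumes "finite J" "j0 \<in> J" "p j0 \<noteq> 0"
  shows "\<exists>d r. d \<noteq> 0 \<and> d = (\<Sum>j\<in>J. r j * p j) \<and> (\<forall>j\<in>J. d dvd p j)"
proof -
  define I where "I = {d. d \<noteq> 0 \<and> (\<exists>r. d = (\<Sum>j\<in>J. r j * p j))}"
  have single: "(\<Sum>i\<in>J. (if i = j then c else 0) * p i) = c * p j" if "j \<in> J" for j c
  proof -
    have "(\<Sum>i\<in>J. (if i = j then c else 0) * p i) = (\<Sum>i\<in>J. if i = j then c * p i else 0)"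
      by (intro sum.cong) auto
    then show ?thesis using that assms by simp
  qed
  have "p j0 \<in> I" using single[OF assms(2), of 1] assms(3) unfolding I_def
    by (auto intro!: exI[of _ "\<lambda>i. if i = j0 then 1 else 0"])
  then obtain d where d: "d \<in> I" "\<And>e. e \<in> I \<Longrightarrow> degree d \<le> degree e"
    using ex_has_least_nat[of "\<lambda>d. d \<in> I" "p j0" degree] by blast
  then obtain r where r: "d \<noteq> 0" "d = (\<Sum>j\<in>J. r j * p j)" by (auto simp: I_def)
  have "d dvd p j" if j: "j \<in> J" for j
  proof (rule ccontr)
    assume "\<not> d dvd p j"
    then have ne: "p j mod d \<noteq> 0" by (simp add: dvd_eq_mod_eq_0)
    define s where "s i = (if i = j then 1 else 0) - (p j div d) * r i" for i
    have "(\<Sum>i\<in>J. s i * p i) = 1 * p j - (p j div d) * (\<Sum>i\<in>J. r i * p i)"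
      unfolding s_def single[OF j, symmetric] by (simp add: algebra_simps sum_subtractf sum_distrib_left)
    also have "\<dots> = p j mod d" using r(2)[symmetric] by (simp add: minus_div_mult_eq_mod)
    finally have "p j mod d \<in> I" using ne unfolding I_def by (auto intro!: exI[of _ s])
    then have "degree d \<le> degree (p j mod d)" by (rule d(2))
    then show False using degree_mod_less'[OF r(1) ne] by simp
  qed
  then show ?thesis using r by blast
qed

section \<open>Lueroth's theorem\<close>

abbreviation const_fract :: "'k::field \<Rightarrow> 'k poly fract" where
  "const_fract c \<equiv> to_fract [:c:]"

lemma const_fract_add: "const_fract (a + b) = const_fract a + const_fract b"
  by (simp flip: to_fract_add)

lemma const_fract_mult: "const_fract (a * b) = const_fract a * const_fract b"
  by (simp flip: to_fract_mult)

lemma const_fract_0: "const_fract 0 = 0" by simp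

lemma const_fract_1: "const_fract 1 = 1" by (simp flip: one_pCons)

lemma const_fract_divide: "b \<noteq> 0 \<Longrightarrow> const_fract (a / b) = const_fract a / const_fract b"
  by (simp add: field_simps flip: const_fract_mult)

lemma const_fract_sum: "const_fract (\<Sum>i\<in>I. f i) = (\<Sum>i\<in>I. const_fract (f i))"
  by (induction I rule: infinite_finite_induct) (auto simp: const_fract_add)

definition const_poly :: "'k::field poly \<Rightarrow> 'k poly fract poly" where
  "const_poly p = map_poly const_fract p"

lemma coeff_const_poly [simp]: "coeff (const_poly p) i = const_fract (coeff p i)"
  unfolding const_poly_def by (simp add: coeff_map_poly)

lemma const_poly_add: "const_poly (p + q) = const_poly p + const_poly q"
  by (intro poly_eqI) (simp add: const_fract_add)

lemma const_poly_mult: "const_poly (p * q) = const_poly p * const_poly q"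
  by (intro poly_eqI) (simp add: coeff_mult const_fract_sum const_fract_mult)

lemma const_poly_1 [simp]: "const_poly 1 = 1"
  by (intro poly_eqI) (auto simp: coeff_1 const_fract_1)

lemma const_poly_0 [simp]: "const_poly 0 = 0"
  by (intro poly_eqI) auto

lemma const_poly_pCons: "const_poly (pCons a p) = pCons (const_fract a) (const_poly p)"
  by (intro poly_eqI) (auto simp: coeff_pCons split: nat.splits)

lemma const_poly_const [simp]: "const_poly [:c:] = [:const_fract c:]"
  by (simp add: const_poly_pCons)

lemma poly_const_poly_const: "poly (const_poly p) (const_fract a) = const_fract (poly p a)"
  by (induction p) (simp_all add: const_poly_pCons const_fract_add const_fract_mult)

lemma poly_const_poly_var: "poly (const_poly p) (to_fract [:0, 1:]) = to_fract p"
proof (induction p)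
  case (pCons a p)
  have "to_fract (pCons a p) = to_fract ([:a:] + [:0, 1:] * p)" by simp
  then show ?case using pCons by (simp add: const_poly_pCons del: mult_pCons_left)
qed simp

definition nonconstant :: "'k::field poly fract \<Rightarrow> bool" where
  "nonconstant y \<longleftrightarrow> y \<notin> range const_fract"

lemma poly_const_poly_nonzero:
  fixes y :: "'k::alg_closed_field poly fract"
  assumes "nonconstant y" "p \<noteq> 0"
  shows "poly (const_poly p) y \<noteq> 0"
  using assms(2)
proof (induction p rule: poly_linear_induct)
  case (linear a q)
  have "y \<noteq> const_fract a" using assms(1) by (auto simp: nonconstant_def)
  then have "poly (const_poly [:- a, 1:]) y \<noteq> 0"
    by (simp add: const_poly_pCons const_fract_1)
       (metis add.inverse_inverse add_eq_0_iff to_fract_uminus minus_pCons minus_zero)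
  then show ?case using linear by (simp only: const_poly_mult poly_mult) simp
qed simp

text \<open>
  The substitution of \<open>y\<close> for the variable. The chosen representative does not matter when \<open>y\<close> is
  nonconstant: by \<open>poly_const_poly_nonzero\<close> no denominator vanishes at \<open>y\<close>, so substitution is a
  field homomorphism whose image is \<open>K(y)\<close>.
\<close>

definition compose_fract :: "'k::field poly fract \<Rightarrow> 'k poly fract \<Rightarrow> 'k poly fract" where
  "compose_fract y f =
     poly (const_poly (fst (SOME (p, q). q \<noteq> 0 \<and> f = Fract p q))) y /
     poly (const_poly (snd (SOME (p, q). q \<noteq> 0 \<and> f = Fract p q))) y"

lemma compose_fract_Fract:
  fixes y :: "'k::alg_closed_field poly fract"
  assumes y: "nonconstant y" and q: "q \<noteq> 0"
  shows "compose_fract y (Fract p q) = poly (const_poly p) y / poly (const_poly q) y"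
proof -
  obtain p' q' where pq': "(SOME (p', q'). q' \<noteq> 0 \<and> Fract p q = Fract p' q') = (p', q')" by fastforce
  have "(\<lambda>(p', q'). q' \<noteq> 0 \<and> Fract p q = Fract p' q') (SOME (p', q'). q' \<noteq> 0 \<and> Fract p q = Fract p' q')"
    by (rule someI[of _ "(p, q)"]) (use q in simp)
  then have *: "q' \<noteq> 0" "Fract p q = Fract p' q'" unfolding pq' by auto
  then have "p * q' = p' * q" using q by (simp add: eq_fract)
  then have "poly (const_poly p) y * poly (const_poly q') y = poly (const_poly p') y * poly (const_poly q) y"
    by (simp flip: poly_mult const_poly_mult)
  then show ?thesis unfolding compose_fract_def pq'
    using poly_const_poly_nonzero[OF y] * q by (simp add: field_simps)
qed

lemma compose_fract_hom:
  fixes y :: "'k::alg_closed_field poly fract"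
  assumes y: "nonconstant y"
  shows "compose_fract y (f + g) = compose_fract y f + compose_fract y g"
    "compose_fract y (f * g) = compose_fract y f * compose_fract y g"
    "compose_fract y (const_fract c) = const_fract c"
    "f \<noteq> 0 \<Longrightarrow> compose_fract y f \<noteq> 0"
    "compose_fract y (to_fract [:0, 1:]) = y"
proof -
  obtain p q where f: "f = Fract p q" "q \<noteq> 0" by (cases f)
  obtain r s where g: "g = Fract r s" "s \<noteq> 0" by (cases g)
  note nz = poly_const_poly_nonzero[OF y]
  show "compose_fract y (f + g) = compose_fract y f + compose_fract y g"
    "compose_fract y (f * g) = compose_fract y f * compose_fract y g"
    using f g nz[of q] nz[of s]
    by (simp_all add: compose_fract_Fract[OF y] const_poly_add const_poly_mult field_simps)
  have poly: "compose_fract y (to_fract r) = poly (const_poly r) y" for r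
    using compose_fract_Fract[OF y, of 1 r] by (simp add: to_fract_def)
  show "compose_fract y (const_fract c) = const_fract c"
    "compose_fract y (to_fract [:0, 1:]) = y"
    unfolding poly by (simp_all add: const_poly_pCons const_fract_1)
  assume "f \<noteq> 0"
  then have "p \<noteq> 0" using f by (auto simp: fract_collapse)
  then show "compose_fract y f \<noteq> 0" using f nz by (simp add: compose_fract_Fract[OF y])
qed

subsection \<open>Polynomials over a subfield\<close>

definition coeffs_in :: "'a::field set \<Rightarrow> 'a poly \<Rightarrow> bool" where
  "coeffs_in L F \<longleftrightarrow> (\<forall>i. coeff F i \<in> L)"

lemma subfield_setD:
  assumes "subfield_set L"
  shows "0 \<in> L" "1 \<in> L" "x \<in> L \<Longrightarrow> y \<in> L \<Longrightarrow> x - y \<in> L" "x \<in> L \<Longrightarrow> y \<in> L \<Longrightarrow> x * y \<in> L"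
    "x \<in> L \<Longrightarrow> inverse x \<in> L" "x \<in> L \<Longrightarrow> y \<in> L \<Longrightarrow> x / y \<in> L" "x \<in> L \<Longrightarrow> y \<in> L \<Longrightarrow> x + y \<in> L"
proof -
  show *: "0 \<in> L" "1 \<in> L" "x \<in> L \<Longrightarrow> y \<in> L \<Longrightarrow> x - y \<in> L" "x \<in> L \<Longrightarrow> y \<in> L \<Longrightarrow> x * y \<in> L"
    "x \<in> L \<Longrightarrow> inverse x \<in> L" for x y
    using assms unfolding subfield_set_def subring_set_def by blast+
  show "x \<in> L \<Longrightarrow> y \<in> L \<Longrightarrow> x / y \<in> L" unfolding divide_inverse using * by blast
  assume "x \<in> L" "y \<in> L"
  then have "x - (0 - y) \<in> L" by (intro *(3) *(1))
  then show "x + y \<in> L" by simp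
qed

lemma coeffs_in_closed:
  assumes L: "subfield_set L"
  shows "coeffs_in L F \<Longrightarrow> coeffs_in L G \<Longrightarrow> coeffs_in L (F + G)"
    "coeffs_in L F \<Longrightarrow> coeffs_in L G \<Longrightarrow> coeffs_in L (F - G)"
    "c \<in> L \<Longrightarrow> coeffs_in L F \<Longrightarrow> coeffs_in L (Polynomial.smult c F)"
    "c \<in> L \<Longrightarrow> coeffs_in L (monom c n)"
    "coeffs_in L F \<Longrightarrow> coeffs_in L (monom 1 n * F)"
  using subfield_setD[OF L] by (auto simp: coeffs_in_def coeff_monom_mult)

text \<open>
  Only the remainder is recorded as having coefficients in \<open>L\<close>: remainders are what gets compared
  with a minimal polynomial over \<open>L\<close>.
\<close>

lemma coeffs_in_division:
  assumes L: "subfield_set L" and G: "coeffs_in L G" "G \<noteq> 0" and F: "coeffs_in L F"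
  shows "\<exists>Q R. coeffs_in L R \<and> F = Q * G + R \<and> (R = 0 \<or> degree R < degree G)"
  using F
proof (induction "degree F" arbitrary: F rule: less_induct)
  case less
  show ?case
  proof (cases "F = 0 \<or> degree F < degree G")
    case True
    then show ?thesis using less.prems by (intro exI[of _ 0] exI[of _ F]) auto
  next
    case False
    define n where "n = degree F - degree G"
    define c where "c = lead_coeff F / lead_coeff G"
    define F' where "F' = F - Polynomial.smult c (monom 1 n * G)"
    have c: "c \<in> L" unfolding c_def using subfield_setD[OF L] G less.prems by (auto simp: coeffs_in_def)
    have F': "coeffs_in L F'" unfolding F'_def
      by (intro coeffs_in_closed[OF L] c less.prems G)
    have "coeff F' (degree F) = 0" unfolding F'_def using False G
      by (simp add: coeff_monom_mult n_def c_def)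
    moreover have "degree F' \<le> degree F" unfolding F'_def using False
      by (intro degree_diff_le order_trans[OF degree_smult_le] order_trans[OF degree_mult_le])
         (auto simp: n_def degree_monom_eq)
    ultimately have deg: "F' = 0 \<or> degree F' < degree F"
      by (metis leading_coeff_0_iff le_neq_implies_less)
    have "\<exists>Q R. coeffs_in L R \<and> F' = Q * G + R \<and> (R = 0 \<or> degree R < degree G)"
    proof (cases "F' = 0")
      case True
      then show ?thesis using F' by (intro exI[of _ 0] exI[of _ 0]) auto
    next
      case False
      then show ?thesis using less.hyps[OF _ F'] deg by blast
    qed
    then obtain Q R where QR: "coeffs_in L R" "F' = Q * G + R" "R = 0 \<or> degree R < degree G" by blast
    have "F = (Polynomial.smult c (monom 1 n) + Q) * G + R" using QR(2) by (simp add: F'_def algebra_simps)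
    then show ?thesis using QR by blast
  qed
qed

subsection \<open>Gauss extensions of the orders\<close>

text \<open>
  The Gauss extension of the order at \<open>x\<close> to nonzero polynomials over the function field.
\<close>

definition gauss_ord :: "'k::field P1 \<Rightarrow> 'k poly fract poly \<Rightarrow> int" where
  "gauss_ord x F = Min ((\<lambda>i. ord_at x (coeff F i)) ` {i. coeff F i \<noteq> 0})"

lemma finite_coeff_support: "finite {i. coeff F i \<noteq> 0}"
  by (rule finite_subset[of _ "{..degree F}"]) (auto intro: le_degree)

lemma gauss_ord_le: "coeff F i \<noteq> 0 \<Longrightarrow> gauss_ord x F \<le> ord_at x (coeff F i)"
  unfolding gauss_ord_def using finite_coeff_support by (intro Min_le) auto

lemma gauss_ord_first:
  assumes "F \<noteq> 0"
  obtains i where "coeff F i \<noteq> 0" "ord_at x (coeff F i) = gauss_ord x F"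
    "\<And>j. j < i \<Longrightarrow> coeff F j \<noteq> 0 \<Longrightarrow> gauss_ord x F < ord_at x (coeff F j)"
proof -
  let ?P = "\<lambda>i. coeff F i \<noteq> 0 \<and> ord_at x (coeff F i) = gauss_ord x F"
  have "{i. coeff F i \<noteq> 0} \<noteq> {}" using assms leading_coeff_0_iff by blast
  then have "gauss_ord x F \<in> (\<lambda>i. ord_at x (coeff F i)) ` {i. coeff F i \<noteq> 0}"
    unfolding gauss_ord_def using finite_coeff_support by (intro Min_in) auto
  then have ex: "\<exists>i. ?P i" by auto
  have "?P (LEAST i. ?P i)" by (rule LeastI_ex[OF ex])
  moreover have "gauss_ord x F < ord_at x (coeff F j)" if "j < (LEAST i. ?P i)" "coeff F j \<noteq> 0" for j
    using not_less_Least[OF that(1)] that(2) gauss_ord_le[of F j x] by auto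
  ultimately show ?thesis using that by blast
qed

text \<open>
  Half of Gauss's lemma: the product of the first coefficients of minimal order dominates all
  other terms in its degree, so the least order of a coefficient of \<open>F * G\<close> is at most the sum.
\<close>

lemma gauss_ord_mult:
  assumes "F \<noteq> 0" "G \<noteq> 0"
  shows "\<exists>k. coeff (F * G) k \<noteq> 0 \<and> ord_at x (coeff (F * G) k) = gauss_ord x F + gauss_ord x G"
proof -
  obtain i where i: "coeff F i \<noteq> 0" "ord_at x (coeff F i) = gauss_ord x F"
    "\<And>j. j < i \<Longrightarrow> coeff F j \<noteq> 0 \<Longrightarrow> gauss_ord x F < ord_at x (coeff F j)"
    using gauss_ord_first[OF assms(1), of x] by metis
  obtain j where j: "coeff G j \<noteq> 0" "ord_at x (coeff G j) = gauss_ord x G"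
    "\<And>i. i < j \<Longrightarrow> coeff G i \<noteq> 0 \<Longrightarrow> gauss_ord x G < ord_at x (coeff G i)"
    using gauss_ord_first[OF assms(2), of x] by metis
  define a where "a = coeff F i * coeff G j"
  define b where "b = (\<Sum>l\<in>{..i + j} - {i}. coeff F l * coeff G (i + j - l))"
  have eq: "coeff (F * G) (i + j) = a + b"
    unfolding coeff_mult a_def b_def by (subst sum.remove[of _ i]) auto
  have a: "a \<noteq> 0" "ord_at x a = gauss_ord x F + gauss_ord x G"
    unfolding a_def using i j by (simp_all add: ord_at_mult)
  have "gauss_ord x F + gauss_ord x G + 1 \<le> ord_at x b" if "b \<noteq> 0"
    unfolding b_def
  proof (rule ord_at_sum_ge)
    show "(\<Sum>l\<in>{..i + j} - {i}. coeff F l * coeff G (i + j - l)) \<noteq> 0" using that by (simp add: b_def)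
    fix l assume l: "l \<in> {..i + j} - {i}" and ne: "coeff F l * coeff G (i + j - l) \<noteq> 0"
    then have ne': "coeff F l \<noteq> 0" "coeff G (i + j - l) \<noteq> 0" by auto
    have ge: "gauss_ord x F \<le> ord_at x (coeff F l)" "gauss_ord x G \<le> ord_at x (coeff G (i + j - l))"
      using ne' by (simp_all add: gauss_ord_le)
    have "gauss_ord x F < ord_at x (coeff F l) \<or> gauss_ord x G < ord_at x (coeff G (i + j - l))"
    proof (cases "l < i")
      case False
      then have "i + j - l < j" using l by auto
      then show ?thesis using j(3) ne' by blast
    qed (use i(3) ne' in blast)
    then show "gauss_ord x F + gauss_ord x G + 1 \<le> ord_at x (coeff F l * coeff G (i + j - l))"
      using ge ne' by (auto simp: ord_at_mult)
  qed
  then have "a + b \<noteq> 0 \<and> ord_at x (a + b) = ord_at x a"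
    using a by (intro ord_at_add_dominant) auto
  then show ?thesis using a eq by (intro exI[of _ "i + j"]) auto
qed

lemma const_polyI:
  assumes "\<And>i. coeff F i \<in> range const_fract"
  shows "\<exists>f. F = const_poly f"
proof -
  have "\<forall>i. \<exists>c. coeff F i = const_fract c" using assms by blast
  then obtain c where c: "\<And>i. coeff F i = const_fract (c i)" by metis
  define f where "f = (\<Sum>i\<le>degree F. monom (c i) i)"
  have "coeff f i = c i" for i
  proof (cases "i \<le> degree F")
    case False
    then have "c i = 0" using c[of i] by (simp add: coeff_eq_0)
    then show ?thesis using False by (simp add: f_def coeff_sum)
  qed (simp add: f_def coeff_sum)
  then have "F = const_poly f" using c by (intro poly_eqI) simp
  then show ?thesis by blast
qed

subsection \<open>Intermediate fields\<close>

text \<open>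
  A polynomial over \<open>K(y)\<close> that has the variable of the function field as a root when \<open>y = p / q\<close>.
\<close>

definition graph_poly :: "'k::field poly fract \<Rightarrow> 'k poly \<Rightarrow> 'k poly \<Rightarrow> 'k poly fract poly" where
  "graph_poly y p q = const_poly p - Polynomial.smult y (const_poly q)"

lemma graph_poly_vanishes:
  "q \<noteq> 0 \<Longrightarrow> poly (graph_poly (Fract p q) p q) (to_fract [:0, 1:]) = 0"
  by (simp add: graph_poly_def poly_const_poly_var Fract_conv_to_fract)

lemma graph_poly_nonzero:
  assumes "nonconstant y" "q \<noteq> 0"
  shows "graph_poly y p q \<noteq> 0"
proof
  assume "graph_poly y p q = 0"
  then have "coeff (graph_poly y p q) (degree q) = 0" by simp
  then have "const_fract (coeff p (degree q)) = y * const_fract (lead_coeff q)"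
    by (simp add: graph_poly_def)
  then have "y = const_fract (coeff p (degree q) / lead_coeff q)"
    using assms(2) by (simp add: const_fract_divide field_simps)
  then show False using assms(1) by (auto simp: nonconstant_def)
qed

text \<open>
  Let \<open>F\<close> be the minimal polynomial over \<open>L\<close> of the variable \<open>s\<close>, let \<open>y\<close> be a nonconstant
  coefficient of \<open>F\<close> and \<open>y = p / q\<close> in lowest terms. Then \<open>F\<close> divides \<open>H = p(X) - y q(X)\<close>.
  Comparing Gauss orders at every point of the line shows that the quotient has constant
  coefficients, and a root \<open>a\<close> of it would satisfy \<open>p(a) = y q(a)\<close>, so that \<open>y\<close> is constant or \<open>p\<close>
  and \<open>q\<close> have a common zero. So \<open>F\<close> equals \<open>H\<close> up to a constant and has coefficients in \<open>K(y)\<close>.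
  Thus \<open>s\<close> has the same minimal polynomial over \<open>K(y)\<close> and over the bigger field \<open>L\<close>, and the two
  fields coincide.
\<close>

theorem lueroth:
  fixes L :: "'k::alg_closed_field poly fract set"
  assumes L: "subfield_set L" and cst: "range const_fract \<subseteq> L"
    and z: "z \<in> L" "nonconstant z"
  shows "\<exists>y\<in>L. nonconstant y \<and> L = range (compose_fract y)"
proof -
  let ?s = "to_fract [:0, 1:] :: 'k poly fract"
  have const_in: "coeffs_in L' (const_poly p)" if "range const_fract \<subseteq> L'" for L' and p :: "'k poly"
    using that by (auto simp: coeffs_in_def)
  have graph_in: "coeffs_in L' (graph_poly y p q)" if "subfield_set L'" "range const_fract \<subseteq> L'" "y \<in> L'" for L' y and p q :: "'k poly"
    unfolding graph_poly_def using that const_in by (intro coeffs_in_closed) auto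
  define V where "V F \<longleftrightarrow> coeffs_in L F \<and> F \<noteq> 0 \<and> poly F ?s = 0" for F
  obtain pz qz where pz: "z = Fract pz qz" "qz \<noteq> 0" by (cases z)
  have "V (graph_poly z pz qz)"
    using graph_in[OF L cst z(1)] graph_poly_nonzero[OF z(2) pz(2)] graph_poly_vanishes[OF pz(2)]
    unfolding V_def pz(1) by blast
  then obtain F0 where F0: "V F0" "\<And>G. V G \<Longrightarrow> degree F0 \<le> degree G"
    using ex_has_least_nat[of V _ degree] by blast
  define F where "F = Polynomial.smult (inverse (lead_coeff F0)) F0"
  have "lead_coeff F0 \<noteq> 0" using F0(1) by (simp add: V_def)
  then have F: "coeffs_in L F" "poly F ?s = 0" "lead_coeff F = 1" "F \<noteq> 0" "degree F = degree F0"
    using F0(1) subfield_setD(5)[OF L] by (auto simp: V_def F_def coeffs_in_def intro!: subfield_setD(4)[OF L])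
  have min: "G = 0" if "coeffs_in L G" "poly G ?s = 0" "G = 0 \<or> degree G < degree F" for G
  proof (rule ccontr)
    assume "G \<noteq> 0"
    then have "degree F0 \<le> degree G" using that by (intro F0(2)) (simp add: V_def)
    then show False using that(3) \<open>G \<noteq> 0\<close> F(5) by simp
  qed
  \<comment> \<open>A polynomial with constant coefficients cannot have the variable as a root.\<close>
  have "\<exists>i. nonconstant (coeff F i)"
  proof (rule ccontr)
    assume "\<not> ?thesis"
    then obtain f where f: "F = const_poly f" using const_polyI[of F] unfolding nonconstant_def by blast
    then have "to_fract f = 0" using F(2) by (simp add: poly_const_poly_var)
    then show False using f F(4) by simp
  qed
  then obtain i where i: "nonconstant (coeff F i)" ..
  define y where "y = coeff F i"
  have y: "y \<in> L" "nonconstant y" using i F(1) by (auto simp: y_def coeffs_in_def)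
  have y0: "y \<noteq> 0" using y(2) const_fract_0 unfolding nonconstant_def by (metis rangeI)
  obtain p q where pq: "y = Fract p q" "q \<noteq> 0" "\<And>a. poly p a \<noteq> 0 \<or> poly q a \<noteq> 0"
    using lowest_terms[of y] by metis
  define H where "H = graph_poly y p q"
  have H: "coeffs_in L H" "H \<noteq> 0" "poly H ?s = 0"
    unfolding H_def using graph_in[OF L cst y(1)] graph_poly_nonzero[OF y(2) pq(2)] graph_poly_vanishes[OF pq(2)] pq(1)
    by auto
  obtain Q R where QR: "coeffs_in L R" "H = Q * F + R" "R = 0 \<or> degree R < degree F"
    using coeffs_in_division[OF L F(1) F(4) H(1)] by blast
  have "R = 0" using QR H(3) F(2) by (intro min) auto
  then have HQ: "H = Q * F" using QR(2) by simp
  then have Q0: "Q \<noteq> 0" using H(2) by auto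
  \<comment> \<open>\<open>F\<close> has the coefficients \<open>1\<close> and \<open>y\<close>, and no coefficient of \<open>H\<close> has a smaller order than
    both of them; so \<open>Q\<close> has no pole anywhere.\<close>
  have Qreg: "0 \<le> gauss_ord x Q" for x
  proof -
    obtain k where k: "coeff H k \<noteq> 0" "ord_at x (coeff H k) = gauss_ord x Q + gauss_ord x F"
      using gauss_ord_mult[OF Q0 F(4)] HQ by metis
    have "gauss_ord x F \<le> 0" using gauss_ord_le[of F "degree F" x] F(3,4) by simp
    moreover have "gauss_ord x F \<le> ord_at x y" using gauss_ord_le[of F i x] y0 by (simp add: y_def)
    ultimately have le: "gauss_ord x F \<le> min 0 (ord_at x y)" by simp
    have eq: "coeff H k = const_fract (coeff p k) + - (y * const_fract (coeff q k))"
      by (simp add: H_def graph_poly_def)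
    have "min 0 (ord_at x y) \<le> ord_at x (coeff H k)"
      unfolding eq
    proof (rule ord_at_add_ge)
      show "const_fract (coeff p k) + - (y * const_fract (coeff q k)) \<noteq> 0" using k(1) unfolding eq .
    qed (use y0 in \<open>auto simp: ord_at_uminus ord_at_mult\<close>)
    then show ?thesis using le k(2) by linarith
  qed
  have "\<exists>c. coeff Q j = const_fract c" for j
  proof (rule regular_everywhere_const)
    fix x assume "coeff Q j \<noteq> 0"
    then show "0 \<le> ord_at x (coeff Q j)" using Qreg[of x] gauss_ord_le[of Q j x] by linarith
  qed
  then obtain g where Qg: "Q = const_poly g" using const_polyI[of Q] by blast
  have "degree g = 0"
  proof (rule ccontr)
    assume "degree g \<noteq> 0"
    then obtain a where a: "poly g a = 0" using alg_closed_imp_poly_has_root[of g] by auto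
    have "poly H (const_fract a) = 0" using a by (simp add: HQ Qg poly_const_poly_const)
    then have *: "const_fract (poly p a) = y * const_fract (poly q a)"
      by (simp add: H_def graph_poly_def poly_const_poly_const)
    show False
    proof (cases "poly q a = 0")
      case True
      then show False using * pq(3)[of a] by simp
    next
      case False
      then have "y = const_fract (poly p a / poly q a)" using * by (simp add: const_fract_divide field_simps)
      then show False using y(2) by (auto simp: nonconstant_def)
    qed
  qed
  then obtain d where d: "g = [:d:]" by (metis degree_eq_zeroE)
  then have d0: "d \<noteq> 0" using Q0 Qg by auto
  define L' where "L' = range (compose_fract y)"
  note hom = compose_fract_hom[OF y(2)]
  have hom_neg: "compose_fract y (- f) = - compose_fract y f" for f
    using hom(1)[of "- f" f] hom(3)[of 0] by (simp add: eq_neg_iff_add_eq_0)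
  have hom_inv: "compose_fract y (inverse f) = inverse (compose_fract y f)" for f
  proof (cases "f = 0")
    case True then show ?thesis using hom(3)[of 0] by simp
  next
    case False
    then have "compose_fract y f * compose_fract y (inverse f) = 1"
      using hom(2)[of f "inverse f"] hom(3)[of 1] False by (simp add: const_fract_1)
    then show ?thesis using hom(4)[OF False] by (simp add: field_simps)
  qed
  have L'cst: "range const_fract \<subseteq> L'" 
  proof
    fix x :: "'k poly fract" assume "x \<in> range const_fract"
    then obtain c where "x = compose_fract y (const_fract c)" using hom(3) by auto
    then show "x \<in> L'" by (simp add: L'_def)
  qed
  have L': "subfield_set L'"
    unfolding subfield_set_def subring_set_def
  proof (intro conjI ballI)
    show "0 \<in> L'" "1 \<in> L'" using L'cst const_fract_0 const_fract_1 by (metis range_subsetD)+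
    show "a - b \<in> L'" if "a \<in> L'" "b \<in> L'" for a b
    proof -
      obtain f g where "a = compose_fract y f" "b = compose_fract y g" using \<open>a \<in> L'\<close> \<open>b \<in> L'\<close> by (auto simp: L'_def)
      then have "a - b = compose_fract y (f + - g)" unfolding hom(1) hom_neg by simp
      then show ?thesis by (simp add: L'_def)
    qed
    show "a * b \<in> L'" if "a \<in> L'" "b \<in> L'" for a b
      using \<open>a \<in> L'\<close> \<open>b \<in> L'\<close> unfolding L'_def by (auto simp flip: hom(2))
    show "inverse a \<in> L'" if "a \<in> L'" for a
      using \<open>a \<in> L'\<close> unfolding L'_def by (auto simp flip: hom_inv)
  qed
  have yL': "y \<in> L'" unfolding L'_def using hom(5) by (metis rangeI)
  have FL': "coeffs_in L' F"
  proof -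
    have "F = Polynomial.smult (inverse (const_fract d)) H" unfolding HQ Qg d using d0 by simp
    then show ?thesis
      using graph_in[OF L' L'cst yL', of p q] subfield_setD(5)[OF L'] L'cst
      unfolding H_def by (auto intro!: coeffs_in_closed[OF L'])
  qed
  have L'L: "L' \<subseteq> L"
  proof
    fix x assume "x \<in> L'"
    then obtain f where f: "x = compose_fract y f" by (auto simp: L'_def)
    obtain r s where rs: "f = Fract r s" "s \<noteq> 0" by (cases f)
    have "poly (const_poly r) y \<in> L" for r
    proof (induction r)
      case (pCons a r)
      then show ?case using cst y(1) by (auto simp: const_poly_pCons intro!: subfield_setD[OF L])
    qed (use subfield_setD[OF L] in simp)
    then show "x \<in> L" unfolding f rs(1) compose_fract_Fract[OF y(2) rs(2)] by (intro subfield_setD[OF L])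
  qed
  \<comment> \<open>For \<open>w = a / b\<close> reduce \<open>a\<close> and \<open>b\<close> modulo \<open>F\<close> over \<open>K(y)\<close>. The remainders satisfy
    \<open>a' = w b'\<close>, as the difference has \<open>s\<close> as a root and too small a degree; so \<open>w\<close> is a
    quotient of coefficients in \<open>K(y)\<close>.\<close>
  have "L \<subseteq> L'"
  proof
    fix w assume w: "w \<in> L"
    obtain a b where ab: "w = Fract a b" "b \<noteq> 0" by (cases w)
    obtain A a' where A: "coeffs_in L' a'" "const_poly a = A * F + a'" "a' = 0 \<or> degree a' < degree F"
      using coeffs_in_division[OF L' FL' F(4) const_in[OF L'cst]] by blast
    obtain B b' where B: "coeffs_in L' b'" "const_poly b = B * F + b'" "b' = 0 \<or> degree b' < degree F"
      using coeffs_in_division[OF L' FL' F(4) const_in[OF L'cst]] by blast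
    have sa: "poly a' ?s = to_fract a" using A(2) F(2) poly_const_poly_var[of a] by simp
    have sb: "poly b' ?s = to_fract b" using B(2) F(2) poly_const_poly_var[of b] by simp
    have "a' - Polynomial.smult w b' = 0"
    proof (rule min)
      show "coeffs_in L (a' - Polynomial.smult w b')"
        using A(1) B(1) L'L w by (intro coeffs_in_closed[OF L]) (auto simp: coeffs_in_def)
      show "poly (a' - Polynomial.smult w b') ?s = 0" using sa sb ab by (simp add: Fract_conv_to_fract)
      have "degree (Polynomial.smult w b') \<le> degree b'" by (rule degree_smult_le)
      then show "a' - Polynomial.smult w b' = 0 \<or> degree (a' - Polynomial.smult w b') < degree F"
        using A(3) B(3) degree_diff_less[of a' "degree F" "Polynomial.smult w b'"]
        by (cases "degree F = 0") auto
    qed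
    then have e: "coeff a' j = w * coeff b' j" for j by (metis coeff_smult eq_iff_diff_eq_0)
    have "b' \<noteq> 0" using sb ab by auto
    then have "coeff b' (degree b') \<noteq> 0" by simp
    then have "w = coeff a' (degree b') / coeff b' (degree b')" using e by simp
    also have "\<dots> \<in> L'" using A(1) B(1) by (intro subfield_setD[OF L']) (auto simp: coeffs_in_def)
    finally show "w \<in> L'" .
  qed
  with L'L show ?thesis using y unfolding L'_def by blast
qed

section \<open>Specialization of rational varieties\<close>

subsection \<open>Evaluation of polynomials\<close>

type_synonym 'k mpol = "(nat \<Rightarrow>\<^sub>0 nat) \<Rightarrow>\<^sub>0 'k"

definition monomial_value :: "(nat \<Rightarrow> 'b::comm_ring_1) \<Rightarrow> (nat \<Rightarrow>\<^sub>0 nat) \<Rightarrow> 'b" where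
  "monomial_value x \<alpha> = (\<Prod>j\<in>Poly_Mapping.keys \<alpha>. x j ^ Poly_Mapping.lookup \<alpha> j)"

text \<open>
  The same expression as \<open>eval_mpoly\<close>, but with values in a commutative ring: restriction to a
  line has values in \<open>K[s]\<close>.
\<close>

definition evaluate :: "('k::zero \<Rightarrow> 'b::comm_ring_1) \<Rightarrow> (nat \<Rightarrow> 'b) \<Rightarrow> 'k mpol \<Rightarrow> 'b" where
  "evaluate \<phi> x p = (\<Sum>\<alpha>\<in>Poly_Mapping.keys p. \<phi> (Poly_Mapping.lookup p \<alpha>) * monomial_value x \<alpha>)"

lemma evaluate_eval_mpoly: "eval_mpoly \<phi> x p = evaluate \<phi> x p"
  by (simp add: eval_mpoly_def evaluate_def monomial_value_def)

definition ring_hom_map :: "('a::comm_ring_1 \<Rightarrow> 'b::comm_ring_1) \<Rightarrow> bool" where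
  "ring_hom_map f \<longleftrightarrow> f 1 = 1 \<and> (\<forall>x y. f (x + y) = f x + f y) \<and> (\<forall>x y. f (x * y) = f x * f y)"

lemma ring_hom_mapD:
  assumes "ring_hom_map f"
  shows "f 1 = 1" "f (x + y) = f x + f y" "f (x * y) = f x * f y" "f 0 = 0" "f (- x) = - f x" "f (x - y) = f x - f y"
    "f (\<Sum>i\<in>I. g i) = (\<Sum>i\<in>I. f (g i))" "f (\<Prod>i\<in>I. g i) = (\<Prod>i\<in>I. f (g i))" "f (x ^ n) = f x ^ n"
proof -
  note h = assms[unfolded ring_hom_map_def]
  show 1: "f 1 = 1" "f (x + y) = f x + f y" "f (x * y) = f x * f y" for x y using h by auto
  have "f 0 + f 0 = f 0" using 1(2)[of 0 0] by simp
  then show z: "f 0 = 0" by simp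
  show m: "f (- x) = - f x" for x using 1(2)[of "- x" x] z by (simp add: eq_neg_iff_add_eq_0)
  show "f (x - y) = f x - f y" using 1(2)[of x "- y"] m[of y] by simp
  show "f (\<Sum>i\<in>I. g i) = (\<Sum>i\<in>I. f (g i))" by (induction I rule: infinite_finite_induct) (auto simp: z 1)
  show "f (\<Prod>i\<in>I. g i) = (\<Prod>i\<in>I. f (g i))" by (induction I rule: infinite_finite_induct) (auto simp: 1)
  show "f (x ^ n) = f x ^ n" by (induction n) (auto simp: 1)
qed

lemma monomial_value_superset:
  assumes "finite S" "Poly_Mapping.keys \<alpha> \<subseteq> S"
  shows "monomial_value x \<alpha> = (\<Prod>j\<in>S. x j ^ Poly_Mapping.lookup \<alpha> j)"
  unfolding monomial_value_def
  by (rule prod.mono_neutral_left[OF assms]) (auto simp: in_keys_iff)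

lemma monomial_value_add: "monomial_value x (\<alpha> + \<beta>) = monomial_value x \<alpha> * monomial_value x \<beta>"
proof -
  let ?S = "Poly_Mapping.keys \<alpha> \<union> Poly_Mapping.keys \<beta>"
  have "monomial_value x (\<alpha> + \<beta>) = (\<Prod>j\<in>?S. x j ^ Poly_Mapping.lookup (\<alpha> + \<beta>) j)"
    by (rule monomial_value_superset) (auto simp: keys_add)
  also have "\<dots> = monomial_value x \<alpha> * monomial_value x \<beta>"
    by (simp add: lookup_add power_add prod.distrib monomial_value_superset[of ?S])
  finally show ?thesis .
qed

lemma evaluate_superset:
  assumes "ring_hom_map \<phi>" "finite S" "Poly_Mapping.keys p \<subseteq> S"
  shows "evaluate \<phi> x p = (\<Sum>\<alpha>\<in>S. \<phi> (Poly_Mapping.lookup p \<alpha>) * monomial_value x \<alpha>)"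
  unfolding evaluate_def
  by (rule sum.mono_neutral_left[OF assms(2,3)]) (auto simp: in_keys_iff ring_hom_mapD(4)[OF assms(1)])

lemma evaluate_add:
  assumes "ring_hom_map \<phi>"
  shows "evaluate \<phi> x (p + q) = evaluate \<phi> x p + evaluate \<phi> x q"
proof -
  let ?S = "Poly_Mapping.keys p \<union> Poly_Mapping.keys q"
  have "evaluate \<phi> x (p + q) = (\<Sum>\<alpha>\<in>?S. \<phi> (Poly_Mapping.lookup (p + q) \<alpha>) * monomial_value x \<alpha>)"
    by (rule evaluate_superset[OF assms]) (auto simp: keys_add)
  also have "\<dots> = evaluate \<phi> x p + evaluate \<phi> x q"
    by (simp add: lookup_add ring_hom_mapD[OF assms] distrib_right sum.distrib evaluate_superset[OF assms, of ?S])
  finally show ?thesis .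
qed

lemma evaluate_0 [simp]: "evaluate \<phi> x 0 = 0"
  by (simp add: evaluate_def)

lemma evaluate_sum:
  assumes "ring_hom_map \<phi>"
  shows "evaluate \<phi> x (\<Sum>i\<in>I. p i) = (\<Sum>i\<in>I. evaluate \<phi> x (p i))"
  by (induction I rule: infinite_finite_induct) (auto simp: evaluate_add[OF assms])

lemma evaluate_single:
  assumes "ring_hom_map \<phi>"
  shows "evaluate \<phi> x (Poly_Mapping.single \<alpha> c) = \<phi> c * monomial_value x \<alpha>"
  by (simp add: evaluate_def ring_hom_mapD(4)[OF assms])

lemma poly_mapping_sum_singles:
  fixes p :: "'s \<Rightarrow>\<^sub>0 'b::comm_monoid_add"
  shows "(\<Sum>\<alpha>\<in>Poly_Mapping.keys p. Poly_Mapping.single \<alpha> (Poly_Mapping.lookup p \<alpha>)) = p"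
proof (rule poly_mapping_eqI)
  fix \<beta>
  have "Poly_Mapping.lookup (\<Sum>\<alpha>\<in>Poly_Mapping.keys p. Poly_Mapping.single \<alpha> (Poly_Mapping.lookup p \<alpha>)) \<beta>
    = (\<Sum>\<alpha>\<in>Poly_Mapping.keys p. if \<alpha> = \<beta> then Poly_Mapping.lookup p \<alpha> else 0)"
    unfolding lookup_sum by (intro sum.cong) (auto simp: lookup_single)
  then show "Poly_Mapping.lookup (\<Sum>\<alpha>\<in>Poly_Mapping.keys p. Poly_Mapping.single \<alpha> (Poly_Mapping.lookup p \<alpha>)) \<beta>
    = Poly_Mapping.lookup p \<beta>" by (auto simp: in_keys_iff)
qed

lemma evaluate_mult:
  fixes \<phi> :: "'k::comm_ring_1 \<Rightarrow> 'b::comm_ring_1"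
  assumes "ring_hom_map \<phi>"
  shows "evaluate \<phi> x (p * q) = evaluate \<phi> x p * evaluate \<phi> x q"
proof -
  let ?s = "\<lambda>p \<alpha>. Poly_Mapping.single \<alpha> (Poly_Mapping.lookup p \<alpha>)"
  have "p * q = (\<Sum>\<alpha>\<in>Poly_Mapping.keys p. ?s p \<alpha>) * (\<Sum>\<beta>\<in>Poly_Mapping.keys q. ?s q \<beta>)"
    by (simp add: poly_mapping_sum_singles)
  also have "\<dots> = (\<Sum>\<alpha>\<in>Poly_Mapping.keys p. \<Sum>\<beta>\<in>Poly_Mapping.keys q. ?s p \<alpha> * ?s q \<beta>)"
    by (rule sum_product)
  finally have "evaluate \<phi> x (p * q) = (\<Sum>\<alpha>\<in>Poly_Mapping.keys p. \<Sum>\<beta>\<in>Poly_Mapping.keys q.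
     (\<phi> (Poly_Mapping.lookup p \<alpha>) * monomial_value x \<alpha>) * (\<phi> (Poly_Mapping.lookup q \<beta>) * monomial_value x \<beta>))"
    by (simp add: evaluate_sum[OF assms] mult_single evaluate_single[OF assms] monomial_value_add
        ring_hom_mapD(3)[OF assms] ac_simps)
  then show ?thesis unfolding evaluate_def sum_product .
qed

lemma evaluate_const:
  assumes "ring_hom_map \<phi>"
  shows "evaluate \<phi> x (Poly_Mapping.single 0 c) = \<phi> c"
  by (simp add: evaluate_single[OF assms] monomial_value_def)

lemma evaluate_1: "ring_hom_map \<phi> \<Longrightarrow> evaluate \<phi> x 1 = 1"
  using evaluate_const[of \<phi> x 1] by (simp add: ring_hom_mapD)

lemma evaluate_ring_hom: "ring_hom_map \<phi> \<Longrightarrow> ring_hom_map (evaluate \<phi> x)"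
  by (simp add: ring_hom_map_def[of "evaluate \<phi> x"] evaluate_1 evaluate_add evaluate_mult)

lemma hom_evaluate:
  assumes "ring_hom_map g"
  shows "g (evaluate \<phi> x p) = evaluate (\<lambda>c. g (\<phi> c)) (\<lambda>j. g (x j)) p"
  unfolding evaluate_def monomial_value_def by (simp add: ring_hom_mapD[OF assms])

subsection \<open>Points at which a polynomial does not vanish\<close>

lemma digits_unique:
  fixes a b :: "nat \<Rightarrow> nat"
  assumes "\<And>j. j < n \<Longrightarrow> a j < D" "\<And>j. j < n \<Longrightarrow> b j < D"
    and "(\<Sum>j<n. a j * D ^ j) = (\<Sum>j<n. b j * D ^ j)" "j < n"
  shows "a j = b j"
  using assms
proof (induction n arbitrary: a b j)
  case (Suc n)
  have D: "D > 0" using Suc.prems(1)[of 0] by simp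
  have shift: "(\<Sum>j<Suc n. c j * D ^ j) = c 0 + D * (\<Sum>j<n. c (Suc j) * D ^ j)" for c :: "nat \<Rightarrow> nat"
    by (simp only: sum.lessThan_Suc_shift) (simp add: sum_distrib_left ac_simps)
  have eq: "a 0 + D * (\<Sum>j<n. a (Suc j) * D ^ j) = b 0 + D * (\<Sum>j<n. b (Suc j) * D ^ j)"
    using Suc.prems(3) unfolding shift .
  have 0: "a 0 < D" "b 0 < D" using Suc.prems(1)[of 0] Suc.prems(2)[of 0] by simp_all
  have "a 0 = b 0" using arg_cong[OF eq, of "\<lambda>m. m mod D"] 0 by simp
  then have "(\<Sum>j<n. a (Suc j) * D ^ j) = (\<Sum>j<n. b (Suc j) * D ^ j)" using eq D by simp
  then have "a (Suc i) = b (Suc i)" if "i < n" for i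
    using Suc.IH[of "\<lambda>j. a (Suc j)" "\<lambda>j. b (Suc j)" i] that Suc.prems(1,2) by simp
  then show ?case using \<open>a 0 = b 0\<close> Suc.prems(4) by (cases j) auto
qed simp

lemma ring_hom_id: "ring_hom_map (\<lambda>c. c)" by (simp add: ring_hom_map_def)

text \<open>
  Kronecker substitution: putting \<open>t ^ (D ^ j)\<close> for the \<open>j\<close>-th variable, with \<open>D\<close> bigger than all
  exponents, sends distinct monomials to distinct powers of \<open>t\<close> by uniqueness of \<open>D\<close>-adic digits.
  The result is a nonzero polynomial in one variable.
\<close>

lemma nonzero_mpoly_nonvanishing:
  fixes p :: "'k::alg_closed_field mpol"
  assumes "p \<noteq> 0"
  shows "\<exists>x. evaluate (\<lambda>c. c) x p \<noteq> 0"
proof -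
  let ?K = "Poly_Mapping.keys p"
  define n where "n = Suc (\<Sum>\<alpha>\<in>?K. \<Sum>j\<in>Poly_Mapping.keys \<alpha>. j)"
  define D where "D = Suc (\<Sum>\<alpha>\<in>?K. \<Sum>j\<in>Poly_Mapping.keys \<alpha>. Poly_Mapping.lookup \<alpha> j)"
  have n: "Poly_Mapping.keys \<alpha> \<subseteq> {..<n}" if "\<alpha> \<in> ?K" for \<alpha>
  proof
    fix j assume j: "j \<in> Poly_Mapping.keys \<alpha>"
    have "j \<le> (\<Sum>j\<in>Poly_Mapping.keys \<alpha>. j)" using j by (intro member_le_sum) auto
    also have "\<dots> \<le> (\<Sum>\<alpha>\<in>?K. \<Sum>j\<in>Poly_Mapping.keys \<alpha>. j)"
      using that by (intro member_le_sum[of _ _ "\<lambda>\<alpha>. \<Sum>j\<in>Poly_Mapping.keys \<alpha>. j"]) auto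
    finally show "j \<in> {..<n}" by (simp add: n_def)
  qed
  have D: "Poly_Mapping.lookup \<alpha> j < D" if "\<alpha> \<in> ?K" for \<alpha> j
  proof (cases "j \<in> Poly_Mapping.keys \<alpha>")
    case True
    have "Poly_Mapping.lookup \<alpha> j \<le> (\<Sum>j\<in>Poly_Mapping.keys \<alpha>. Poly_Mapping.lookup \<alpha> j)"
      using True by (intro member_le_sum) auto
    also have "\<dots> \<le> (\<Sum>\<alpha>\<in>?K. \<Sum>j\<in>Poly_Mapping.keys \<alpha>. Poly_Mapping.lookup \<alpha> j)"
      using that by (intro member_le_sum[of _ _ "\<lambda>\<alpha>. \<Sum>j\<in>Poly_Mapping.keys \<alpha>. Poly_Mapping.lookup \<alpha> j"]) auto
    finally show ?thesis by (simp add: D_def)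
  next
    case False
    then show ?thesis by (simp add: in_keys_iff D_def)
  qed
  define code where "code \<alpha> = (\<Sum>j<n. Poly_Mapping.lookup \<alpha> j * D ^ j)" for \<alpha> :: "nat \<Rightarrow>\<^sub>0 nat"
  have inj: "\<alpha> = \<beta>" if "\<alpha> \<in> ?K" "\<beta> \<in> ?K" "code \<alpha> = code \<beta>" for \<alpha> \<beta>
  proof (rule poly_mapping_eqI)
    fix j show "Poly_Mapping.lookup \<alpha> j = Poly_Mapping.lookup \<beta> j"
    proof (cases "j < n")
      case True
      show ?thesis
        by (rule digits_unique[of n _ D]) (use that D True in \<open>auto simp: code_def\<close>)
    next
      case False
      then have "j \<notin> Poly_Mapping.keys \<alpha>" "j \<notin> Poly_Mapping.keys \<beta>" using n that by auto
      then show ?thesis by (simp add: in_keys_iff)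
    qed
  qed
  define q where "q = (\<Sum>\<alpha>\<in>?K. monom (Poly_Mapping.lookup p \<alpha>) (code \<alpha>))"
  obtain \<alpha> where \<alpha>: "\<alpha> \<in> ?K" using assms by fastforce
  have "coeff q (code \<alpha>) = (\<Sum>\<beta>\<in>?K. if \<beta> = \<alpha> then Poly_Mapping.lookup p \<alpha> else 0)"
    unfolding q_def coeff_sum using inj[OF _ \<alpha>] by (intro sum.cong) auto
  then have "coeff q (code \<alpha>) = Poly_Mapping.lookup p \<alpha>" using \<alpha> by simp
  then have "q \<noteq> 0" using \<alpha> by (auto simp: in_keys_iff)
  then have "finite {t. poly q t = 0}" by (rule poly_roots_finite)
  then obtain t where t: "poly q t \<noteq> 0" using infinite_UNIV_alg_closed
    by (metis (mono_tags, lifting) UNIV_eq_I mem_Collect_eq)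
  have "monomial_value (\<lambda>j. t ^ (D ^ j)) \<alpha> = t ^ code \<alpha>" if "\<alpha> \<in> ?K" for \<alpha>
    using n[OF that] by (simp add: monomial_value_superset[of "{..<n}"] code_def power_sum mult.commute flip: power_mult)
  then have "evaluate (\<lambda>c. c) (\<lambda>j. t ^ (D ^ j)) p = poly q t"
    by (simp add: evaluate_def q_def poly_sum poly_monom)
  then show ?thesis using t by metis
qed

subsection \<open>Restriction to a line\<close>

definition in_variables :: "nat \<Rightarrow> 'k::zero mpol \<Rightarrow> bool" where
  "in_variables n p \<longleftrightarrow> (\<forall>\<alpha>\<in>Poly_Mapping.keys p. Poly_Mapping.keys \<alpha> \<subseteq> {..<n})"

lemma in_variables_add: "in_variables n p \<Longrightarrow> in_variables n q \<Longrightarrow> in_variables n (p + q)"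
  using keys_add[of p q] by (fastforce simp: in_variables_def)

lemma in_variables_uminus: "in_variables n p \<Longrightarrow> in_variables n (- p :: 'k::ab_group_add mpol)"
  by (simp add: in_variables_def in_keys_iff)

lemma in_variables_diff: "in_variables n p \<Longrightarrow> in_variables n q \<Longrightarrow> in_variables n (p - q :: 'k::ab_group_add mpol)"
  using in_variables_add[of n p "- q"] in_variables_uminus[of n q] by simp

lemma in_variables_mult:
  fixes p q :: "'k::semiring_0 mpol"
  assumes "in_variables n p" "in_variables n q"
  shows "in_variables n (p * q)"
  unfolding in_variables_def
proof
  fix \<gamma> assume "\<gamma> \<in> Poly_Mapping.keys (p * q)"
  then obtain \<alpha> \<beta> where "\<alpha> \<in> Poly_Mapping.keys p" "\<beta> \<in> Poly_Mapping.keys q" "\<gamma> = \<alpha> + \<beta>"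
    using keys_mult[of p q] by blast
  then show "Poly_Mapping.keys \<gamma> \<subseteq> {..<n}"
    using assms keys_add[of \<alpha> \<beta>] unfolding in_variables_def by blast
qed

lemma in_variables_const: "in_variables n (Poly_Mapping.single 0 c)"
  by (simp add: in_variables_def)

lemma in_variables_0: "in_variables n 0" by (simp add: in_variables_def)
lemma in_variables_1: "in_variables n 1" by (simp add: in_variables_def)

lemma in_variables_var: "j < n \<Longrightarrow> in_variables n (Poly_Mapping.single (Poly_Mapping.single j 1) c)"
  by (auto simp: in_variables_def)

lemma subring_setD:
  assumes "subring_set S"
  shows "0 \<in> S" "1 \<in> S" "x \<in> S \<Longrightarrow> y \<in> S \<Longrightarrow> x - y \<in> S" "x \<in> S \<Longrightarrow> y \<in> S \<Longrightarrow> x * y \<in> S" "x \<in> S \<Longrightarrow> y \<in> S \<Longrightarrow> x + y \<in> S"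
proof -
  show *: "0 \<in> S" "1 \<in> S" "x \<in> S \<Longrightarrow> y \<in> S \<Longrightarrow> x - y \<in> S" "x \<in> S \<Longrightarrow> y \<in> S \<Longrightarrow> x * y \<in> S" for x y
    using assms unfolding subring_set_def by blast+
  assume "x \<in> S" "y \<in> S"
  then have "x - (0 - y) \<in> S" by (intro *(3) *(1))
  then show "x + y \<in> S" by simp
qed

lemma subring_hull_induct:
  assumes "subring_set hull G = UNIV" "\<And>g. g \<in> G \<Longrightarrow> P g" "P 0" "P 1"
    "\<And>x y. P x \<Longrightarrow> P y \<Longrightarrow> P (x - y)" "\<And>x y. P x \<Longrightarrow> P y \<Longrightarrow> P (x * y)"
  shows "P x"
proof -
  have "subring_set hull G \<subseteq> {x. P x}"
    by (rule hull_minimal) (use assms in \<open>auto simp: subring_set_def\<close>)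
  then show ?thesis using assms(1) by blast
qed

lemma k_algebra_ring_hom: "k_algebra \<iota> \<longleftrightarrow> ring_hom_map \<iota>"
  by (simp add: k_algebra_def ring_hom_map_def)

text \<open>
  Elements of the algebra are rational functions in independent variables. Restriction to the line
  through two points \<open>p0\<close> and \<open>p1\<close> is the homomorphism \<open>\<theta>\<close> to \<open>K(s)\<close>, and \<open>\<theta>0\<close> and \<open>\<theta>1\<close> are
  evaluation at the two points. The points are chosen such that the finitely many generators are
  defined at both and do not vanish at \<open>p0\<close>, and such that \<open>a / b\<close>, which is nonconstant, takes
  different values there.
\<close>

theorem rational_specialization:
  fixes \<iota> :: "'k::alg_closed_field \<Rightarrow> 'a::idom"
  assumes alg: "k_algebra \<iota>" and rat: "rational_variety \<iota>"
    and H: "finite H" "0 \<notin> H" "subring_set hull (range \<iota> \<union> H) = UNIV"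
    and b: "b \<noteq> 0" and ab: "\<And>c. a \<noteq> \<iota> c * b"
  shows "\<exists>(\<theta> :: 'a \<Rightarrow> 'k poly fract) (\<theta>0 :: 'a \<Rightarrow> 'k) (\<theta>1 :: 'a \<Rightarrow> 'k).
    ring_hom_map \<theta> \<and> ring_hom_map \<theta>0 \<and> ring_hom_map \<theta>1 \<and>
    (\<forall>c. \<theta> (\<iota> c) = to_fract [:c:]) \<and> (\<forall>c. \<theta>0 (\<iota> c) = c) \<and> (\<forall>c. \<theta>1 (\<iota> c) = c) \<and>
    (\<forall>f. \<theta> f = 0 \<longrightarrow> \<theta>0 f = 0 \<and> \<theta>1 f = 0) \<and> (\<forall>h\<in>H. \<theta>0 h \<noteq> 0) \<and> \<theta>0 b \<noteq> 0 \<and>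
    \<theta>0 a * \<theta>1 b \<noteq> \<theta>1 a * \<theta>0 b"
proof -
  have \<iota>: "ring_hom_map \<iota>" using alg by (simp add: k_algebra_ring_hom)
  have \<iota>F: "ring_hom_map (to_fract \<circ> \<iota>)" using ring_hom_mapD[OF \<iota>] by (simp add: ring_hom_map_def)
  obtain n x where indep: "algebraically_independent (to_fract \<circ> \<iota>) n x"
    and gen: "subfield_set hull (range (to_fract \<circ> \<iota>) \<union> x ` {..<n}) = UNIV"
    using rat unfolding rational_variety_def by blast
  define ev where "ev = evaluate (to_fract \<circ> \<iota>) x"
  have ev: "ring_hom_map ev" unfolding ev_def by (rule evaluate_ring_hom[OF \<iota>F])
  note evD = ring_hom_mapD[OF ev]
  have ev0: "p = 0" if "in_variables n p" "ev p = 0" for p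
    using that indep unfolding algebraically_independent_def evaluate_eval_mpoly ev_def in_variables_def by blast
  \<comment> \<open>The quotients of polynomials in the independent elements \<open>x j\<close> form a subfield.\<close>
  define FF where "FF = {z. \<exists>P Q. in_variables n P \<and> in_variables n Q \<and> ev Q \<noteq> 0 \<and> z * ev Q = ev P}"
  have FFI: "z \<in> FF" if "in_variables n P" "in_variables n Q" "ev Q \<noteq> 0" "z * ev Q = ev P" for z P Q
    using that by (auto simp: FF_def)
  have "subfield_set FF"
    unfolding subfield_set_def subring_set_def
  proof (intro conjI ballI)
    show "0 \<in> FF" by (rule FFI[of 0 1]) (simp_all add: in_variables_0 in_variables_1 evD)
    show "1 \<in> FF" by (rule FFI[of 1 1]) (simp_all add: in_variables_1 evD)
  next
    fix y z assume "y \<in> FF" "z \<in> FF"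
    then obtain P Q R S where *: "in_variables n P" "in_variables n Q" "ev Q \<noteq> 0" "y * ev Q = ev P"
      "in_variables n R" "in_variables n S" "ev S \<noteq> 0" "z * ev S = ev R" by (auto simp: FF_def)
    show "y - z \<in> FF"
      by (rule FFI[of "P * S - R * Q" "Q * S"]) (use * in \<open>simp_all add: in_variables_mult in_variables_diff evD algebra_simps flip: *(4,8)\<close>)
    show "y * z \<in> FF"
      by (rule FFI[of "P * R" "Q * S"]) (use * in \<open>simp_all add: in_variables_mult evD algebra_simps flip: *(4,8)\<close>)
  next
    fix y assume "y \<in> FF"
    then obtain P Q where *: "in_variables n P" "in_variables n Q" "ev Q \<noteq> 0" "y * ev Q = ev P" by (auto simp: FF_def)
    show "inverse y \<in> FF"
    proof (cases "y = 0")
      case True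
      then show ?thesis using * by (auto intro!: FFI[of 0 1] simp: in_variables_0 in_variables_1 evD)
    next
      case False
      then show ?thesis by (intro FFI[of Q P]) (use * in \<open>simp_all flip: *(4)\<close>)
    qed
  qed
  moreover have "range (to_fract \<circ> \<iota>) \<union> x ` {..<n} \<subseteq> FF"
  proof (intro Un_least image_subsetI)
    fix c show "(to_fract \<circ> \<iota>) c \<in> FF"
      by (rule FFI[of "Poly_Mapping.single 0 c" 1]) (simp_all add: in_variables_const in_variables_1 evD, simp add: ev_def evaluate_const[OF \<iota>F])
  next
    fix j assume j: "j \<in> {..<n}"
    show "x j \<in> FF"
    proof (rule FFI)
      show "in_variables n (Poly_Mapping.single (Poly_Mapping.single j 1) 1)"
        using j by (intro in_variables_var) simp
      show "in_variables n 1" by (rule in_variables_1)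
      show "ev 1 \<noteq> 0" by (simp add: evD)
      show "x j * ev 1 = ev (Poly_Mapping.single (Poly_Mapping.single j 1) 1)"
        unfolding evD(1) by (simp add: ev_def evaluate_single[OF \<iota>F] monomial_value_def ring_hom_mapD(1)[OF \<iota>])
    qed
  qed
  ultimately have FF: "z \<in> FF" for z using gen hull_minimal[of _ FF subfield_set] by blast
  have rep: "\<exists>P Q. in_variables n P \<and> in_variables n Q \<and> ev Q \<noteq> 0 \<and> to_fract f * ev Q = ev P" for f :: 'a
    using FF[of "to_fract f"] by (simp add: FF_def)
  then obtain PP QQ where rep: "\<And>f. in_variables n (PP f)" "\<And>f. in_variables n (QQ f)" "\<And>f. ev (QQ f) \<noteq> 0"
    "\<And>f. to_fract f * ev (QQ f) = ev (PP f)" by metis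
  have PP0: "PP f \<noteq> 0" "QQ f \<noteq> 0" if "f \<noteq> 0" for f using rep(3,4)[of f] that evD(4) by auto
  have QQ0: "QQ f \<noteq> 0" for f using rep(3)[of f] evD(4) by auto
  \<comment> \<open>A point is suitable if no numerator of a generator or of \<open>b\<close>, and no denominator of a generator, of \<open>a\<close>
    or of \<open>b\<close>, vanishes there. The point \<open>p1\<close> also has to avoid the zeros of \<open>W\<close>, the locus where \<open>a / b\<close>
    takes the value \<open>\<gamma>\<close> that it has at \<open>p0\<close>.\<close>
  define bad where "bad = (\<Prod>h\<in>insert b H. PP h) * (\<Prod>h\<in>insert a (insert b H). QQ h)"
  have PPH: "PP h \<noteq> 0" if "h \<in> insert b H" for h using that H(2) b by (intro PP0(1)) auto
  have bad: "bad \<noteq> 0" unfolding bad_def using H(1) PPH QQ0 by (simp add: prod_zero_iff del: prod.insert)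
  let ?at = "\<lambda>c. evaluate (\<lambda>c. c) c :: 'k mpol \<Rightarrow> 'k"
  have at: "ring_hom_map (?at c)" for c by (rule evaluate_ring_hom[OF ring_hom_id])
  note atD = ring_hom_mapD[OF at]
  obtain p0 where p0: "?at p0 bad \<noteq> 0" using nonzero_mpoly_nonvanishing[OF bad(1)] by blast
  have bad_factors: "?at p (PP h) \<noteq> 0" "?at p (QQ h') \<noteq> 0"
    if "?at p bad \<noteq> 0" "h \<in> insert b H" "h' \<in> insert a (insert b H)" for p h h'
    using that H(1) unfolding bad_def by (auto simp: atD prod_zero_iff)
  define N where "N = PP a * QQ b"
  define M where "M = QQ a * PP b"
  have M: "?at p0 M \<noteq> 0" using bad_factors[OF p0, of b a] bad_factors[OF p0, of b b] by (simp add: M_def atD)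
  define \<gamma> where "\<gamma> = ?at p0 N / ?at p0 M"
  define W where "W = N - Poly_Mapping.single 0 \<gamma> * M"
  have iv: "in_variables n W" unfolding W_def N_def M_def using rep
    by (intro in_variables_diff in_variables_mult in_variables_const) auto
  have "W \<noteq> 0"
  proof
    assume "W = 0"
    then have "ev N = to_fract (\<iota> \<gamma>) * ev M" unfolding W_def
      using evD(3)[of "Poly_Mapping.single 0 \<gamma>" M] by (simp add: ev_def evaluate_const[OF \<iota>F])
    moreover have "ev N = to_fract a * ev (QQ a) * ev (QQ b)" "ev M = ev (QQ a) * (to_fract b * ev (QQ b))"
      by (simp_all add: N_def M_def evD rep(4))
    ultimately have "to_fract a = to_fract (\<iota> \<gamma>) * to_fract b" using rep(3)[of a] rep(3)[of b] by simp
    then have "a = \<iota> \<gamma> * b" by (simp flip: to_fract_mult)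
    then show False using ab by blast
  qed
  then have "bad * W \<noteq> 0" using bad by simp
  then obtain p1 where "?at p1 (bad * W) \<noteq> 0" using nonzero_mpoly_nonvanishing by blast
  then have p1: "?at p1 bad \<noteq> 0" "?at p1 W \<noteq> 0" by (auto simp: atD)
  \<comment> \<open>Denominators are allowed if they do not vanish at \<open>p0\<close> and \<open>p1\<close>. Such fractions are closed under the
    ring operations and include the generators, hence include everything.\<close>
  define Dn where "Dn Q \<longleftrightarrow> in_variables n Q \<and> ?at p0 Q \<noteq> 0 \<and> ?at p1 Q \<noteq> 0" for Q
  define fr where "fr f P Q \<longleftrightarrow> in_variables n P \<and> Dn Q \<and> to_fract f * ev Q = ev P" for f :: 'a and P Q
  have evDn: "ev Q \<noteq> 0" if "Dn Q" for Q using that ev0[of Q] by (auto simp: Dn_def)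
  have fr_gen: "fr h (PP h) (QQ h)" if "h \<in> insert a (insert b H)" for h
    using rep bad_factors(2)[OF p0 _ that, of b] bad_factors(2)[OF p1(1) _ that, of b] by (auto simp: fr_def Dn_def)
  have fr_add: "fr (f + g) (P * S + R * Q) (Q * S)" "fr (f - g) (P * S - R * Q) (Q * S)" "fr (f * g) (P * R) (Q * S)"
    if "fr f P Q" "fr g R S" for f g P Q R S
  proof -
    have *: "ev P = to_fract f * ev Q" "ev R = to_fract g * ev S" using that by (simp_all add: fr_def)
    show "fr (f + g) (P * S + R * Q) (Q * S)" "fr (f - g) (P * S - R * Q) (Q * S)" "fr (f * g) (P * R) (Q * S)"
      using that * by (auto simp: fr_def Dn_def in_variables_add in_variables_mult in_variables_diff evD atD algebra_simps)
  qed
  have fr_const: "fr (\<iota> c) (Poly_Mapping.single 0 c) 1" for c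
    by (simp add: fr_def Dn_def in_variables_const in_variables_1 evD(1) atD(1))
       (simp add: ev_def evaluate_const[OF \<iota>F])
  have "\<exists>P Q. fr f P Q" for f
  proof (rule subring_hull_induct[OF H(3)])
    show "\<exists>P Q. fr g P Q" if "g \<in> range \<iota> \<union> H" for g using that fr_const fr_gen by blast
    show "\<exists>P Q. fr 0 P Q" using fr_const[of 0] ring_hom_mapD[OF \<iota>] by auto
    show "\<exists>P Q. fr 1 P Q" using fr_const[of 1] ring_hom_mapD[OF \<iota>] by auto
  qed (use fr_add in blast)+
  then obtain pn qn where fr: "\<And>f. fr f (pn f) (qn f)" by metis
  have fr_unique: "P * S = R * Q" if "fr f P Q" "fr f R S" for f P Q R S
  proof -
    have "ev (P * S - R * Q) = 0" using that by (simp add: fr_def evD flip: )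
         (metis mult.assoc mult.commute)
    moreover have "in_variables n (P * S - R * Q)"
      using that by (auto simp: fr_def Dn_def intro!: in_variables_diff in_variables_mult)
    ultimately show ?thesis using ev0 by fastforce
  qed
  \<comment> \<open>A homomorphism on polynomials that kills no allowed denominator extends to the algebra; this is applied to
    both evaluations and to the restriction to the line.\<close>
  have ext_hom: "ring_hom_map (\<lambda>f. E (pn f) / E (qn f))"
    and ext_const: "\<And>c. E (pn (\<iota> c)) / E (qn (\<iota> c)) = E (Poly_Mapping.single 0 c)"
    and ext_rep: "\<And>f P Q. fr f P Q \<Longrightarrow> E (pn f) / E (qn f) = E P / E Q"
    if E: "ring_hom_map E" and nz: "\<And>Q. Dn Q \<Longrightarrow> E Q \<noteq> 0" for E :: "'k mpol \<Rightarrow> 'f::field"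
  proof -
    note D = ring_hom_mapD[OF E]
    have q0: "E Q \<noteq> 0" if "fr f P Q" for f P Q using that nz by (simp add: fr_def)
    show rep: "E (pn f) / E (qn f) = E P / E Q" if "fr f P Q" for f P Q
    proof -
      have "E (pn f) * E Q = E P * E (qn f)" using fr_unique[OF fr that] by (simp flip: D(3))
      then show ?thesis using q0[OF that] q0[OF fr] by (simp add: field_simps)
    qed
    show c: "E (pn (\<iota> c)) / E (qn (\<iota> c)) = E (Poly_Mapping.single 0 c)" for c
      using rep[OF fr_const] D(1) by simp
    have "E (pn 1) / E (qn 1) = 1"
      using c[of 1] ring_hom_mapD(1)[OF \<iota>] D(1) by simp
    moreover have "E (pn (f + g)) / E (qn (f + g)) = E (pn f) / E (qn f) + E (pn g) / E (qn g)" for f g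
      using rep[OF fr_add(1)[OF fr fr]] q0[OF fr] by (simp add: D field_simps)
    moreover have "E (pn (f * g)) / E (qn (f * g)) = E (pn f) / E (qn f) * (E (pn g) / E (qn g))" for f g
      using rep[OF fr_add(3)[OF fr fr]] by (simp add: D)
    ultimately show "ring_hom_map (\<lambda>f. E (pn f) / E (qn f))" by (simp add: ring_hom_map_def)
  qed
  define line where "line = evaluate (\<lambda>c. [:c:]) (\<lambda>j. [:p0 j, p1 j - p0 j:])"
  have c_hom: "ring_hom_map (\<lambda>c::'k. [:c:])" by (simp add: ring_hom_map_def one_pCons)
  have line: "ring_hom_map line" unfolding line_def by (rule evaluate_ring_hom[OF c_hom])
  have pt: "ring_hom_map (\<lambda>p. poly p c)" for c :: 'k by (simp add: ring_hom_map_def)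
  have line01: "poly (line P) 0 = ?at p0 P" "poly (line P) 1 = ?at p1 P" for P
    unfolding line_def hom_evaluate[OF pt] by simp_all
  define E where "E P = to_fract (line P)" for P
  have E: "ring_hom_map E" using ring_hom_mapD[OF line] by (simp add: ring_hom_map_def E_def)
  have Enz: "E Q \<noteq> 0" if "Dn Q" for Q using that line01(1)[of Q] by (auto simp: E_def Dn_def)
  have nz0: "?at p0 Q \<noteq> 0" "?at p1 Q \<noteq> 0" if "Dn Q" for Q using that by (auto simp: Dn_def)
  define \<theta> where "\<theta> f = E (pn f) / E (qn f)" for f
  define \<theta>0 where "\<theta>0 f = ?at p0 (pn f) / ?at p0 (qn f)" for f
  define \<theta>1 where "\<theta>1 f = ?at p1 (pn f) / ?at p1 (qn f)" for f
  have homs: "ring_hom_map \<theta>" "ring_hom_map \<theta>0" "ring_hom_map \<theta>1"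
    unfolding \<theta>_def \<theta>0_def \<theta>1_def by (rule ext_hom[OF E Enz] ext_hom[OF at nz0(1)] ext_hom[OF at nz0(2)]; assumption)+
  have cs: "\<theta> (\<iota> c) = to_fract [:c:]" "\<theta>0 (\<iota> c) = c" "\<theta>1 (\<iota> c) = c" for c
  proof -
    have "\<theta> (\<iota> c) = E (Poly_Mapping.single 0 c)" unfolding \<theta>_def by (rule ext_const[OF E Enz])
    then show "\<theta> (\<iota> c) = to_fract [:c:]" by (simp add: E_def line_def evaluate_const[OF c_hom])
    have "\<theta>0 (\<iota> c) = ?at p0 (Poly_Mapping.single 0 c)" unfolding \<theta>0_def by (rule ext_const[OF at nz0(1)])
    then show "\<theta>0 (\<iota> c) = c" by (simp add: evaluate_const[OF ring_hom_id])
    have "\<theta>1 (\<iota> c) = ?at p1 (Poly_Mapping.single 0 c)" unfolding \<theta>1_def by (rule ext_const[OF at nz0(2)])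
    then show "\<theta>1 (\<iota> c) = c" by (simp add: evaluate_const[OF ring_hom_id])
  qed
  have vanish: "\<theta>0 f = 0 \<and> \<theta>1 f = 0" if "\<theta> f = 0" for f
  proof -
    have "Dn (qn f)" using fr by (simp add: fr_def)
    then have "line (pn f) = 0" using that Enz unfolding \<theta>_def by (simp add: E_def)
    then show ?thesis using line01[of "pn f"] by (simp add: \<theta>0_def \<theta>1_def)
  qed
  have val: "\<theta>0 h = ?at p0 (PP h) / ?at p0 (QQ h)" "\<theta>1 h = ?at p1 (PP h) / ?at p1 (QQ h)" if "h \<in> insert a (insert b H)" for h
    unfolding \<theta>0_def \<theta>1_def using ext_rep[OF at nz0(1) fr_gen[OF that]] ext_rep[OF at nz0(2) fr_gen[OF that]] by auto
  have nzH: "\<theta>0 h \<noteq> 0" if "h \<in> insert b H" for h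
    using val(1)[of h] that bad_factors[OF p0 that, of h] by auto
  have "\<theta>0 a * \<theta>1 b \<noteq> \<theta>1 a * \<theta>0 b"
  proof
    assume eq: "\<theta>0 a * \<theta>1 b = \<theta>1 a * \<theta>0 b"
    have q: "?at p (QQ a) \<noteq> 0" "?at p (QQ b) \<noteq> 0" "?at p (PP b) \<noteq> 0" if "?at p bad \<noteq> 0" for p
      using bad_factors[OF that, of b a] bad_factors[OF that, of b b] by simp_all
    have "?at p0 N * ?at p1 M = ?at p1 N * ?at p0 M"
      using eq q[OF p0] q[OF p1(1)] unfolding val[of a, simplified] val[of b, simplified] N_def M_def atD
      by (simp add: field_simps)
    then have "?at p1 N = \<gamma> * ?at p1 M" using M by (simp add: \<gamma>_def field_simps)
    then have "?at p1 W = 0" by (simp add: W_def atD evaluate_const[OF ring_hom_id])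
    then show False using p1(2) by simp
  qed
  then show ?thesis using homs cs vanish nzH by blast
qed

section \<open>Graded algebras\<close>

locale graded_algebra =
  fixes \<iota> :: "'k::field \<Rightarrow> 'a::idom" and A :: "'m::ab_group_add \<Rightarrow> 'a set"
  assumes alg: "k_algebra \<iota>" and grading: "algebra_grading \<iota> A"
begin

lemma iota_hom: "ring_hom_map \<iota>" using alg by (simp add: k_algebra_ring_hom)

lemmas iotaD = ring_hom_mapD[OF iota_hom]

lemma iota_eq_0_iff [simp]: "\<iota> c = 0 \<longleftrightarrow> c = 0"
proof
  assume "\<iota> c = 0"
  show "c = 0"
  proof (rule ccontr)
    assume "c \<noteq> 0"
    then have "\<iota> c * \<iota> (inverse c) = 1" by (simp flip: iotaD(1,3))
    then show False using \<open>\<iota> c = 0\<close> by simp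
  qed
qed (simp add: iotaD)

lemma A_0: "0 \<in> A u" and A_add: "x \<in> A u \<Longrightarrow> y \<in> A u \<Longrightarrow> x + y \<in> A u"
  and A_scale: "x \<in> A u \<Longrightarrow> \<iota> c * x \<in> A u"
  and A_mult: "x \<in> A u \<Longrightarrow> y \<in> A w \<Longrightarrow> x * y \<in> A (u + w)"
  using grading unfolding algebra_grading_def by blast+

lemma A_uminus: "x \<in> A u \<Longrightarrow> - x \<in> A u"
  using A_scale[of x u "-1"] by (simp add: iotaD)

lemma A_diff: "x \<in> A u \<Longrightarrow> y \<in> A u \<Longrightarrow> x - y \<in> A u"
  using A_add[of x u "- y"] A_uminus[of y u] by simp

lemma A_sum: "(\<And>i. i \<in> I \<Longrightarrow> f i \<in> A u) \<Longrightarrow> (\<Sum>i\<in>I. f i) \<in> A u"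
  by (induction I rule: infinite_finite_induct) (auto simp: A_0 A_add)

definition part :: "'a \<Rightarrow> 'm \<Rightarrow> 'a" where
  "part f u = Poly_Mapping.lookup (homogeneous_parts A f) u"

definition support :: "'a \<Rightarrow> 'm set" where
  "support f = Poly_Mapping.keys (homogeneous_parts A f)"

lemma unique_decomposition: "\<exists>!c. homogeneous_decomposition A f c"
  using grading by (simp add: algebra_grading_def)

lemma decomposition: "homogeneous_decomposition A f (homogeneous_parts A f)"
  unfolding homogeneous_parts_def by (rule theI'[OF unique_decomposition])

lemma part_in: "part f u \<in> A u"
  using decomposition[of f] by (simp add: homogeneous_decomposition_def part_def)

lemma finite_support [simp]: "finite (support f)"
  by (simp add: support_def)

lemma support_iff: "u \<in> support f \<longleftrightarrow> part f u \<noteq> 0"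
  by (simp add: support_def part_def in_keys_iff)

lemma sum_parts: "(\<Sum>u\<in>support f. part f u) = f"
  using decomposition[of f] by (simp add: homogeneous_decomposition_def part_def support_def)

lemma sum_parts_superset: "finite U \<Longrightarrow> support f \<subseteq> U \<Longrightarrow> (\<Sum>u\<in>U. part f u) = f"
  by (subst (2) sum_parts[of f, symmetric], rule sum.mono_neutral_right) (auto simp: support_iff)

lemma part_eqI:
  assumes "finite U" "\<And>u. u \<in> U \<Longrightarrow> g u \<in> A u" "f = (\<Sum>u\<in>U. g u)"
  shows "part f u = (if u \<in> U then g u else 0)"
proof -
  define c where "c = (\<Sum>u\<in>U. Poly_Mapping.single u (g u))"
  have c: "Poly_Mapping.lookup c u = (if u \<in> U then g u else 0)" for u
  proof -
    have "Poly_Mapping.lookup c u = (\<Sum>w\<in>U. if w = u then g w else 0)"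
      unfolding c_def lookup_sum by (intro sum.cong) (auto simp: lookup_single)
    then show ?thesis using assms(1) by simp
  qed
  have "homogeneous_decomposition A f c"
    unfolding homogeneous_decomposition_def
  proof
    show "\<forall>u. Poly_Mapping.lookup c u \<in> A u" using assms(2) A_0 by (simp add: c)
    have "Poly_Mapping.keys c \<subseteq> U" by (auto simp: in_keys_iff c split: if_splits)
    then have "(\<Sum>u\<in>Poly_Mapping.keys c. Poly_Mapping.lookup c u) = (\<Sum>u\<in>U. Poly_Mapping.lookup c u)"
      by (intro sum.mono_neutral_left assms(1)) (auto simp: in_keys_iff)
    then show "f = (\<Sum>u\<in>Poly_Mapping.keys c. Poly_Mapping.lookup c u)"
      using assms(3) by (simp add: c)
  qed
  then have "homogeneous_parts A f = c"
    using unique_decomposition[of f] decomposition[of f] by blast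
  then show ?thesis using c by (simp add: part_def)
qed

lemma part_homogeneous: "f \<in> A u \<Longrightarrow> part f w = (if w = u then f else 0)"
  using part_eqI[of "{u}" "\<lambda>_. f" f w] by simp

lemma part_add: "part (f + g) u = part f u + part g u"
proof -
  let ?U = "support f \<union> support g"
  have "part (f + g) u = (if u \<in> ?U then part f u + part g u else 0)"
    by (rule part_eqI) (simp_all add: A_add part_in sum.distrib sum_parts_superset)
  then show ?thesis by (auto simp: support_iff)
qed

lemma part_0 [simp]: "part 0 u = 0"
  using part_homogeneous[OF A_0] by simp

lemma part_uminus: "part (- f) u = - part f u"
  using part_add[of "- f" f u] by (simp add: eq_neg_iff_add_eq_0)

lemma part_diff: "part (f - g) u = part f u - part g u"
  using part_add[of f "- g" u] by (simp add: part_uminus)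

lemma part_sum: "part (\<Sum>i\<in>I. f i) u = (\<Sum>i\<in>I. part (f i) u)"
  by (induction I rule: infinite_finite_induct) (auto simp: part_add)

lemma eq_0_iff_parts: "f = 0 \<longleftrightarrow> (\<forall>u. part f u = 0)"
  by (metis part_0 sum.neutral sum_parts)

lemma part_mult_homogeneous:
  assumes "b \<in> A w" shows "part (f * b) (u + w) = part f u * b"
proof -
  have "part (f * b) (u + w) = (if u + w \<in> (\<lambda>u. u + w) ` support f then part f (u + w - w) * b else 0)"
  proof (rule part_eqI)
    show "f * b = (\<Sum>v\<in>(\<lambda>u. u + w) ` support f. part f (v - w) * b)"
      by (subst sum.reindex) (auto simp: inj_on_def sum_parts simp flip: sum_distrib_right)
  qed (use A_mult[OF part_in assms] in auto)
  then show ?thesis by (auto simp: support_iff)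
qed

lemma part_mult:
  assumes "finite U" "support f \<subseteq> U" "finite W" "support g \<subseteq> W"
  shows "part (f * g) x = (\<Sum>(u, w)\<in>U \<times> W. if u + w = x then part f u * part g w else 0)"
proof -
  have "f * g = (\<Sum>u\<in>U. part f u) * (\<Sum>w\<in>W. part g w)" using assms by (simp add: sum_parts_superset)
  then have "f * g = (\<Sum>(u, w)\<in>U \<times> W. part f u * part g w)" by (simp add: sum_product sum.cartesian_product)
  then have "part (f * g) x = (\<Sum>(u, w)\<in>U \<times> W. part (part f u * part g w) x)" by (simp add: part_sum split_beta)
  also have "\<dots> = (\<Sum>(u, w)\<in>U \<times> W. if u + w = x then part f u * part g w else 0)"
    by (intro sum.cong) (auto simp: part_homogeneous[OF A_mult[OF part_in part_in]])
  finally show ?thesis .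
qed

text \<open>
  The part of weight 0 of the unit acts as a unit on homogeneous elements, hence on everything.
\<close>

lemma one_in_A: "1 \<in> A 0"
proof -
  define e where "e = part 1 0"
  have "x * e = x" if "x \<in> A w" for x w
  proof -
    have "part (1 * x) (0 + w) = e * x" unfolding e_def by (rule part_mult_homogeneous[OF that])
    then show ?thesis using part_homogeneous[OF that, of w] by (simp add: mult.commute)
  qed
  then have pe: "part f u * e = part f u" for f u using part_in by blast
  have "f * e = f" for f
  proof -
    have "f * e = (\<Sum>u\<in>support f. part f u) * e" by (simp only: sum_parts)
    also have "\<dots> = (\<Sum>u\<in>support f. part f u)" by (simp only: sum_distrib_right pe)
    finally show ?thesis by (simp only: sum_parts)
  qed
  then have "e = 1" by (metis mult_1)
  then show ?thesis using part_in[of 1 0] by (simp add: e_def)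
qed

lemma iota_in_A: "\<iota> c \<in> A 0"
  using A_scale[OF one_in_A, of c] by simp

lemma A_power: "f \<in> A u \<Longrightarrow> f ^ n \<in> A (zscale (int n) u)"
proof (induction n)
  case (Suc n)
  have "zscale (int (Suc n)) u = u + zscale (int n) u"
    using zscale_plus_one[of "int n" u] by (simp add: add.commute)
  then show ?case using A_mult[OF Suc.prems Suc.IH[OF Suc.prems]] by simp
qed (simp add: one_in_A)

lemma A_prod_powers:
  assumes "finite K" "\<And>k. k \<in> K \<Longrightarrow> f k \<in> A (u k)"
  shows "(\<Prod>k\<in>K. f k ^ c k) \<in> A (\<Sum>k\<in>K. zscale (int (c k)) (u k))"
  using assms
proof (induction K rule: finite_induct)
  case (insert k K)
  then show ?case using A_mult[OF A_power[of "f k" "u k" "c k"]] by simp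
qed (simp add: one_in_A)

lemma homogeneous_generators:
  assumes "finitely_generated_algebra \<iota>"
  shows "\<exists>H. finite H \<and> 0 \<notin> H \<and> (\<forall>h\<in>H. \<exists>u. h \<in> A u) \<and> subring_set hull (range \<iota> \<union> H) = UNIV"
proof -
  obtain G where G: "finite G" "subring_set hull (range \<iota> \<union> G) = UNIV"
    using assms by (auto simp: finitely_generated_algebra_def)
  define H where "H = (\<Union>g\<in>G. part g ` support g)"
  let ?S = "subring_set hull (range \<iota> \<union> H)"
  have S: "subring_set ?S"
    by (rule hull_in) (auto simp: subring_set_def)
  have sub: "range \<iota> \<union> H \<subseteq> ?S" by (rule hull_subset)
  have "g \<in> ?S" if "g \<in> G" for g
  proof -
    have "(\<Sum>u\<in>U. part g u) \<in> ?S" if "U \<subseteq> support g" "finite U" for U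
      using that(2,1)
    proof (induction U rule: finite_induct)
      case (insert u U)
      then have "part g u \<in> H" using \<open>g \<in> G\<close> by (auto simp: H_def)
      then have "part g u \<in> ?S" using sub by blast
      then show ?case using insert by (auto intro: subring_setD(5)[OF S])
    qed (simp add: subring_setD(1)[OF S])
    then show ?thesis using sum_parts[of g] by (metis finite_support order_refl)
  qed
  then have "subring_set hull (range \<iota> \<union> G) \<subseteq> ?S"
    using sub by (intro hull_minimal S) auto
  then have "?S = UNIV" using G(2) by blast
  moreover have "finite H" "0 \<notin> H" using G(1) by (auto simp: H_def support_iff)
  moreover have "\<forall>h\<in>H. \<exists>u. h \<in> A u" using part_in by (auto simp: H_def)
  ultimately show ?thesis by blast
qed

end

section \<open>Nonvanishing of homogeneous elements by a chain of primes\<close>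

lemma span_submonoid:
  fixes S :: "'m::ab_group_add set"
  assumes "0 \<in> S" "\<And>x y. x \<in> S \<Longrightarrow> y \<in> S \<Longrightarrow> x + y \<in> S" "m \<in> zmod.span S"
  shows "\<exists>u\<in>S. \<exists>w\<in>S. m = u - w"
proof -
  define D where "D = {u - w | u w. u \<in> S \<and> w \<in> S}"
  have DI: "u - w \<in> D" if "u \<in> S" "w \<in> S" for u w using that by (auto simp: D_def)
  have add: "x + y \<in> D" if xy: "x \<in> D" "y \<in> D" for x y
  proof -
    obtain u w u' w' where *: "u \<in> S" "w \<in> S" "u' \<in> S" "w' \<in> S" "x = u - w" "y = u' - w'"
      using xy unfolding D_def by blast
    then have "x + y = (u + u') - (w + w')" by simp
    then show ?thesis using DI[of "u + u'" "w + w'"] assms(2) * by metis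
  qed
  have neg: "- x \<in> D" if x: "x \<in> D" for x
  proof -
    obtain u w where "u \<in> S" "w \<in> S" "x = u - w" using x by (auto simp: D_def)
    then show ?thesis using DI[of w u] by simp
  qed
  have zero: "0 \<in> D" using DI[OF assms(1) assms(1)] by simp
  have "zscale n x \<in> D" if "x \<in> D" for n x
  proof (induction n rule: int_induct[where k = 0])
    case (step1 i)
    then show ?case using add[OF that step1(2)] by (simp add: zscale_plus_one)
  next
    case (step2 i)
    then show ?case using add[OF step2(2) neg[OF that]] by (simp add: zscale_minus_one)
  qed (simp add: zero)
  then have "zmod.subspace D" using zero add by (auto simp: zmod.subspace_def)
  moreover have "S \<subseteq> D" using DI[OF _ assms(1)] by fastforce
  ultimately have "zmod.span S \<subseteq> D" by (intro zmod.span_minimal)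
  then show ?thesis using assms(3) unfolding D_def by blast
qed

lemma kernel_prime_ideal:
  fixes g :: "'a::comm_ring_1 \<Rightarrow> 'b::idom"
  assumes "ring_hom_map g"
  shows "prime_ideal {f. g f = 0}"
  using ring_hom_mapD[OF assms] by (auto simp: prime_ideal_def)

context graded_algebra
begin

text \<open>
  If \<open>\<pi>\<close> is additive and \<open>\<eta>\<close> a homomorphism to a field \<open>F\<close>, this is the homomorphism to the group
  algebra of a free abelian group over \<open>F\<close> that sends \<open>f\<close> of weight \<open>u\<close> to \<open>\<eta> f\<close> times the
  monomial with exponent \<open>\<pi> u\<close>. As the group algebra is a domain, its kernel is prime; a coarser
  \<open>\<pi>\<close> has a bigger kernel.
\<close>

definition twist :: "('a \<Rightarrow> 'f::field) \<Rightarrow> ('m \<Rightarrow> (nat \<Rightarrow>\<^sub>0 int)) \<Rightarrow> 'a \<Rightarrow> ((nat \<Rightarrow>\<^sub>0 int) \<Rightarrow>\<^sub>0 'f)" where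
  "twist \<eta> \<pi> f = (\<Sum>u\<in>support f. Poly_Mapping.single (\<pi> u) (\<eta> (part f u)))"

lemma twist_superset:
  assumes "ring_hom_map \<eta>" "finite U" "support f \<subseteq> U"
  shows "twist \<eta> \<pi> f = (\<Sum>u\<in>U. Poly_Mapping.single (\<pi> u) (\<eta> (part f u)))"
  unfolding twist_def
  by (rule sum.mono_neutral_left[OF assms(2,3)]) (auto simp: support_iff ring_hom_mapD(4)[OF assms(1)])

lemma twist_add:
  assumes "ring_hom_map \<eta>" shows "twist \<eta> \<pi> (f + g) = twist \<eta> \<pi> f + twist \<eta> \<pi> g"
proof -
  let ?U = "support f \<union> support g"
  have "twist \<eta> \<pi> (f + g) = (\<Sum>u\<in>?U. Poly_Mapping.single (\<pi> u) (\<eta> (part (f + g) u)))"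
    by (rule twist_superset[OF assms]) (auto simp: support_iff part_add)
  also have "\<dots> = twist \<eta> \<pi> f + twist \<eta> \<pi> g"
    by (simp add: part_add ring_hom_mapD[OF assms] single_add sum.distrib twist_superset[OF assms, of ?U])
  finally show ?thesis .
qed

lemma twist_homogeneous:
  assumes "ring_hom_map \<eta>" "f \<in> A u"
  shows "twist \<eta> \<pi> f = Poly_Mapping.single (\<pi> u) (\<eta> f)"
proof -
  have "support f \<subseteq> {u}" using part_homogeneous[OF assms(2)] by (auto simp: support_iff split: if_splits)
  then show ?thesis using twist_superset[OF assms(1), of "{u}" f \<pi>] part_homogeneous[OF assms(2), of u] by simp
qed

lemma twist_0: "ring_hom_map \<eta> \<Longrightarrow> twist \<eta> \<pi> 0 = 0"
  using twist_homogeneous[of \<eta> 0 0 \<pi>] by (simp add: A_0 ring_hom_mapD)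

lemma twist_sum:
  assumes "ring_hom_map \<eta>" shows "twist \<eta> \<pi> (\<Sum>i\<in>I. f i) = (\<Sum>i\<in>I. twist \<eta> \<pi> (f i))"
  by (induction I rule: infinite_finite_induct) (auto simp: twist_add[OF assms] twist_0[OF assms])

lemma twist_hom:
  assumes \<eta>: "ring_hom_map \<eta>" and \<pi>: "additive \<pi>"
  shows "ring_hom_map (twist \<eta> \<pi>)"
proof -
  have "twist \<eta> \<pi> (f * g) = twist \<eta> \<pi> f * twist \<eta> \<pi> g" for f g
  proof -
    have "f * g = (\<Sum>u\<in>support f. part f u) * (\<Sum>w\<in>support g. part g w)" by (simp add: sum_parts)
    then have "f * g = (\<Sum>u\<in>support f. \<Sum>w\<in>support g. part f u * part g w)" by (simp add: sum_product)
    then have "twist \<eta> \<pi> (f * g) = (\<Sum>u\<in>support f. \<Sum>w\<in>support g. twist \<eta> \<pi> (part f u * part g w))"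
      by (simp only: twist_sum[OF \<eta>])
    also have "\<dots> = (\<Sum>u\<in>support f. \<Sum>w\<in>support g.
        Poly_Mapping.single (\<pi> u) (\<eta> (part f u)) * Poly_Mapping.single (\<pi> w) (\<eta> (part g w)))"
      by (intro sum.cong refl)
         (simp add: twist_homogeneous[OF \<eta> A_mult[OF part_in part_in]] mult_single additive.add[OF \<pi>] ring_hom_mapD[OF \<eta>])
    also have "\<dots> = twist \<eta> \<pi> f * twist \<eta> \<pi> g" by (simp add: twist_def sum_product)
    finally show ?thesis .
  qed
  moreover have "twist \<eta> \<pi> 1 = 1"
    using twist_homogeneous[OF \<eta> one_in_A, of \<pi>] additive.zero[OF \<pi>] by (simp add: ring_hom_mapD(1)[OF \<eta>])
  ultimately show ?thesis using twist_add[OF \<eta>] by (simp add: ring_hom_map_def)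
qed

lemma lookup_twist: "Poly_Mapping.lookup (twist \<eta> \<pi> f) \<gamma> = (\<Sum>u\<in>{u\<in>support f. \<pi> u = \<gamma>}. \<eta> (part f u))"
proof -
  have "Poly_Mapping.lookup (twist \<eta> \<pi> f) \<gamma> = (\<Sum>u\<in>support f. if \<pi> u = \<gamma> then \<eta> (part f u) else 0)"
    unfolding twist_def lookup_sum by (intro sum.cong) (auto simp: lookup_single)
  then show ?thesis by (simp add: sum.inter_filter)
qed

lemma twist_coarsen:
  assumes "\<And>u w. \<pi> u = \<pi> w \<Longrightarrow> \<pi>' u = \<pi>' w" "twist \<eta> \<pi> f = 0"
  shows "twist \<eta> \<pi>' f = 0"
proof (rule poly_mapping_eqI)
  fix \<delta>
  let ?S = "{u\<in>support f. \<pi>' u = \<delta>}"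
  have "(\<Sum>u\<in>?S. \<eta> (part f u)) = (\<Sum>\<gamma>\<in>\<pi> ` ?S. \<Sum>u\<in>{u\<in>?S. \<pi> u = \<gamma>}. \<eta> (part f u))"
    by (rule sum.group[symmetric]) auto
  also have "\<dots> = 0"
  proof (rule sum.neutral, rule ballI)
    fix \<gamma> assume "\<gamma> \<in> \<pi> ` ?S"
    then obtain u0 where "\<pi>' u0 = \<delta>" "\<gamma> = \<pi> u0" by auto
    then have "{u\<in>?S. \<pi> u = \<gamma>} = {u\<in>support f. \<pi> u = \<gamma>}" using assms(1) by blast
    then show "(\<Sum>u\<in>{u\<in>?S. \<pi> u = \<gamma>}. \<eta> (part f u)) = 0"
      using lookup_twist[of \<eta> \<pi> f \<gamma>] assms(2) by simp
  qed
  finally show "Poly_Mapping.lookup (twist \<eta> \<pi>' f) \<delta> = Poly_Mapping.lookup 0 \<delta>"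
    by (simp add: lookup_twist)
qed

lemma support_in_submonoid:
  assumes "subring_set hull (range \<iota> \<union> H) = UNIV" "0 \<in> S" "\<And>x y. x \<in> S \<Longrightarrow> y \<in> S \<Longrightarrow> x + y \<in> S"
    and H: "\<And>h. h \<in> H \<Longrightarrow> \<exists>u\<in>S. h \<in> A u"
  shows "support f \<subseteq> S"
proof (rule subring_hull_induct[OF assms(1), where P = "\<lambda>f. support f \<subseteq> S"])
  have hom: "support g \<subseteq> S" if "g \<in> A u" "u \<in> S" for g u
    using part_homogeneous[OF that(1)] that(2) by (auto simp: support_iff split: if_splits)
  show "support g \<subseteq> S" if "g \<in> range \<iota> \<union> H" for g
    using that H hom iota_in_A assms(2) by blast
  show "support 0 \<subseteq> S" "support 1 \<subseteq> S" using hom[OF A_0 assms(2)] hom[OF one_in_A assms(2)] by auto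
  show "support (x - y) \<subseteq> S" if "support x \<subseteq> S" "support y \<subseteq> S" for x y
    using that by (fastforce simp: support_iff part_diff)
  show "support (x * y) \<subseteq> S" if "support x \<subseteq> S" "support y \<subseteq> S" for x y
  proof
    fix w assume "w \<in> support (x * y)"
    then have "(\<Sum>(u, w')\<in>support x \<times> support y. if u + w' = w then part x u * part y w' else 0) \<noteq> 0"
      using part_mult[of "support x" x "support y" y w] by (simp add: support_iff)
    then obtain p where "p \<in> support x \<times> support y" "(case p of (u, w') \<Rightarrow> if u + w' = w then part x u * part y w' else 0) \<noteq> 0"
      by (rule sum.not_neutral_contains_not_neutral)
    then obtain u w' where "u \<in> support x" "w' \<in> support y" "u + w' = w" by (auto split: if_splits)
    then show "w \<in> S" using that assms(3) by blast
  qed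
qed

lemma weights_from_effective:
  assumes "effective_grading A"
  shows "\<exists>u w a b. a \<in> A u \<and> b \<in> A w \<and> a \<noteq> 0 \<and> b \<noteq> 0 \<and> m = u - w"
proof -
  define S where "S = {u. \<exists>a\<in>A u. a \<noteq> 0}"
  have "{u. A u \<noteq> {0}} \<subseteq> S" using A_0 by (auto simp: S_def)
  then have span: "m \<in> zmod.span S" using assms zmod.span_mono unfolding effective_grading_def by blast
  have "\<exists>u\<in>S. \<exists>w\<in>S. m = u - w"
  proof (rule span_submonoid[OF _ _ span])
    show "0 \<in> S" using one_in_A unfolding S_def by (intro CollectI bexI[of _ 1]) auto
    fix x y assume "x \<in> S" "y \<in> S"
    then obtain a b where "a \<in> A x" "b \<in> A y" "a \<noteq> 0" "b \<noteq> 0" by (auto simp: S_def)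
    then show "x + y \<in> S" using A_mult[of a x b y] unfolding S_def by (intro CollectI bexI[of _ "a * b"]) auto
  qed
  then show ?thesis unfolding S_def by blast
qed

text \<open>
  Products of generators on which \<open>\<eta>\<close> does not vanish provide, in every weight that occurs, an
  element on which \<open>\<eta>\<close> does not vanish.
\<close>

lemma weights_as_differences:
  assumes eff: "effective_grading A" and gens: "subring_set hull (range \<iota> \<union> H) = UNIV"
    and \<eta>: "ring_hom_map (\<eta> :: 'a \<Rightarrow> 'f::field)"
    and H: "\<And>h. h \<in> H \<Longrightarrow> (\<exists>u. h \<in> A u) \<and> \<eta> h \<noteq> 0"
  shows "\<exists>u w a b. a \<in> A u \<and> b \<in> A w \<and> \<eta> a \<noteq> 0 \<and> \<eta> b \<noteq> 0 \<and> m = u - w"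
proof -
  define S where "S = {u. \<exists>a\<in>A u. \<eta> a \<noteq> 0}"
  have 0: "0 \<in> S" using one_in_A ring_hom_mapD(1)[OF \<eta>] by (auto simp: S_def intro!: bexI[of _ 1])
  have add: "x + y \<in> S" if "x \<in> S" "y \<in> S" for x y
  proof -
    obtain a b where "a \<in> A x" "b \<in> A y" "\<eta> a \<noteq> 0" "\<eta> b \<noteq> 0" using \<open>x \<in> S\<close> \<open>y \<in> S\<close> by (auto simp: S_def)
    then show ?thesis using A_mult[of a x b y] ring_hom_mapD(3)[OF \<eta>] by (auto simp: S_def intro!: bexI[of _ "a * b"])
  qed
  have HS: "\<exists>u\<in>S. h \<in> A u" if "h \<in> H" for h using H[OF that] by (auto simp: S_def)
  have supp: "support f \<subseteq> S" for f by (rule support_in_submonoid[OF gens 0 add HS])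
  have "{u. A u \<noteq> {0}} \<subseteq> S"
  proof
    fix u assume "u \<in> {u. A u \<noteq> {0}}"
    then obtain f where "f \<in> A u" "f \<noteq> 0" using A_0 by blast
    then have "u \<in> support f" using part_homogeneous[of f u u] by (simp add: support_iff)
    then show "u \<in> S" using supp by blast
  qed
  then have "zmod.span S = UNIV" using eff zmod.span_mono unfolding effective_grading_def by blast
  then obtain u w where "u \<in> S" "w \<in> S" "m = u - w" using span_submonoid[OF 0 add, of m] by blast
  then show ?thesis unfolding S_def by blast
qed

text \<open>
  Let \<open>\<pi> i\<close> forget the first \<open>i\<close> of the \<open>r\<close> coordinates of a weight. If \<open>\<theta> f = 0\<close> for some nonzero
  homogeneous \<open>f\<close>, the kernels of the identity, of \<open>\<theta>\<close> twisted by the full weight, and of \<open>\<theta>0\<close>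
  twisted by \<open>\<pi> 0, \<dots>, \<pi> r\<close> form a chain of \<open>r + 3\<close> primes: \<open>f\<close>, then \<open>e\<close>, then suitable
  combinations of two homogeneous elements show that the inclusions are proper.
\<close>

theorem homogeneous_nonvanishing:
  fixes B :: "'m set" and \<theta> :: "'a \<Rightarrow> 'f::field" and \<theta>0 :: "'a \<Rightarrow> 'k"
  assumes B: "lattice_basis B" "card B = r" and dim: "krull_dim TYPE('a) = enat (r + 1)"
    and eff: "effective_grading A" and gens: "subring_set hull (range \<iota> \<union> H) = UNIV"
    and H: "\<And>h. h \<in> H \<Longrightarrow> (\<exists>u. h \<in> A u) \<and> \<theta>0 h \<noteq> 0"
    and \<theta>: "ring_hom_map \<theta>" and \<theta>0: "ring_hom_map \<theta>0" "\<And>c. \<theta>0 (\<iota> c) = c"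
    and le: "\<And>f. \<theta> f = 0 \<Longrightarrow> \<theta>0 f = 0"
    and e: "e \<in> A w" "\<theta> e \<noteq> 0" "\<theta>0 e = 0"
    and f: "f \<in> A u" "f \<noteq> 0"
  shows "\<theta> f \<noteq> 0"
proof
  assume f0: "\<theta> f = 0"
  have finB: "finite B" using B by (simp add: lattice_basis_def)
  obtain \<beta> where \<beta>: "bij_betw \<beta> {..<r} B"
    using ex_bij_betw_nat_finite[OF finB] B(2) by (auto simp: atLeast0LessThan)
  define \<pi> where "\<pi> i u = (\<Sum>j\<in>{i..<r}. Poly_Mapping.single j (coords B u (\<beta> j)))" for i and u :: 'm
  have lookup_\<pi>: "Poly_Mapping.lookup (\<pi> i u) j = (if i \<le> j \<and> j < r then coords B u (\<beta> j) else 0)" for i u j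
  proof -
    have "Poly_Mapping.lookup (\<pi> i u) j = (\<Sum>l\<in>{i..<r}. if l = j then coords B u (\<beta> l) else 0)"
      unfolding \<pi>_def lookup_sum by (intro sum.cong) (auto simp: lookup_single)
    then show ?thesis by simp
  qed
  have \<pi>: "additive (\<pi> i)" for i
    by standard (rule poly_mapping_eqI, simp add: lookup_\<pi> lookup_add coords_add[OF B(1)])
  have \<pi>_inj: "u = w" if "\<pi> 0 u = \<pi> 0 w" for u w
  proof (rule coords_eqI[OF B(1)])
    fix b assume "b \<in> B"
    then obtain j where "j < r" "b = \<beta> j" using \<beta> by (auto simp: bij_betw_def)
    then show "coords B u b = coords B w b" using lookup_\<pi>[of 0 u j] lookup_\<pi>[of 0 w j] that by simp
  qed
  have \<pi>_coarse: "\<pi> (Suc i) u = \<pi> (Suc i) w" if eq: "\<pi> i u = \<pi> i w" for i u w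
  proof (rule poly_mapping_eqI)
    fix j
    have "Poly_Mapping.lookup (\<pi> i u) j = Poly_Mapping.lookup (\<pi> i w) j" using eq by simp
    then show "Poly_Mapping.lookup (\<pi> (Suc i) u) j = Poly_Mapping.lookup (\<pi> (Suc i) w) j"
      unfolding lookup_\<pi> by (auto split: if_splits)
  qed
  define J where "J i = {g. twist \<theta>0 (\<pi> i) g = 0}" for i
  define I where "I n = (if n = 0 then {0} else if n = 1 then {g. twist \<theta> (\<pi> 0) g = 0} else J (n - 2))" for n :: nat
  have prime: "prime_ideal (I n)" for n
    unfolding I_def J_def
    using kernel_prime_ideal[OF twist_hom[OF \<theta> \<pi>]] kernel_prime_ideal[OF twist_hom[OF \<theta>0(1) \<pi>]]
    by (simp add: prime_ideal_def)
  have s0: "I 0 \<subset> I 1"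
  proof -
    have "f \<in> I 1" using twist_homogeneous[OF \<theta> f(1), of "\<pi> 0"] f0 by (simp add: I_def)
    moreover have "0 \<in> I 1" by (simp add: I_def twist_0[OF \<theta>])
    ultimately show ?thesis using f(2) by (auto simp: I_def)
  qed
  have s1: "I 1 \<subset> I 2"
  proof
    have "twist \<theta>0 (\<pi> 0) g = 0" if g: "twist \<theta> (\<pi> 0) g = 0" for g
    proof -
      have "\<theta> (part g u) = 0" if u: "u \<in> support g" for u
      proof -
        have "{w\<in>support g. \<pi> 0 w = \<pi> 0 u} = {u}" using u \<pi>_inj by auto
        then show ?thesis using lookup_twist[of \<theta> "\<pi> 0" g "\<pi> 0 u"] g by simp
      qed
      then show ?thesis using le by (simp add: twist_def)
    qed
    then show "I 1 \<subseteq> I 2" by (auto simp: I_def J_def)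
    have "e \<in> I 2" "e \<notin> I 1"
      using twist_homogeneous[OF \<theta> e(1), of "\<pi> 0"] twist_homogeneous[OF \<theta>0(1) e(1), of "\<pi> 0"] e(2,3)
      by (auto simp: I_def J_def dest: arg_cong[of _ _ "\<lambda>p. Poly_Mapping.lookup p (\<pi> 0 w)"])
    then show "I 1 \<noteq> I 2" by blast
  qed
  \<comment> \<open>The combination \<open>g\<close> of \<open>a\<close> and \<open>b\<close>, whose weights differ only in the coordinate \<open>i\<close>, dies
    once this coordinate is forgotten.\<close>
  have s2: "J i \<subset> J (Suc i)" if i: "i < r" for i
  proof
    show "J i \<subseteq> J (Suc i)" unfolding J_def
      using twist_coarsen[of "\<pi> i" "\<pi> (Suc i)" \<theta>0, OF \<pi>_coarse] by blast
    obtain u w a b where ab: "a \<in> A u" "b \<in> A w" "\<theta>0 a \<noteq> 0" "\<theta>0 b \<noteq> 0" "\<beta> i = u - w"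
      using weights_as_differences[OF eff gens \<theta>0(1) H, of "\<beta> i"] by blast
    define g where "g = \<iota> (\<theta>0 b) * a - \<iota> (\<theta>0 a) * b"
    have tw: "twist \<theta>0 (\<pi> j) g = Poly_Mapping.single (\<pi> j u) (\<theta>0 b * \<theta>0 a) - Poly_Mapping.single (\<pi> j w) (\<theta>0 a * \<theta>0 b)" for j
      unfolding g_def ring_hom_mapD(6)[OF twist_hom[OF \<theta>0(1) \<pi>]]
      by (simp add: twist_homogeneous[OF \<theta>0(1) A_scale[OF ab(1)]] twist_homogeneous[OF \<theta>0(1) A_scale[OF ab(2)]]
          ring_hom_mapD(3)[OF \<theta>0(1)] \<theta>0(2))
    have "\<beta> i \<in> B" using \<beta> i by (auto simp: bij_betw_def)
    have \<beta>_inj: "\<beta> j = \<beta> i \<longleftrightarrow> j = i" if "j < r" for j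
      using \<beta> i that by (auto simp: bij_betw_def inj_on_def)
    have co: "coords B u (\<beta> j) - coords B w (\<beta> j) = (if j = i then 1 else 0)" if "j < r" for j
    proof -
      have "u = \<beta> i + w" using ab(5) by simp
      then show ?thesis using coords_add[OF B(1), of "\<beta> i" w] coords_basis[OF B(1) \<open>\<beta> i \<in> B\<close>] \<beta>_inj[OF that] by simp
    qed
    have "\<pi> (Suc i) u = \<pi> (Suc i) w"
    proof (rule poly_mapping_eqI)
      fix j
      show "Poly_Mapping.lookup (\<pi> (Suc i) u) j = Poly_Mapping.lookup (\<pi> (Suc i) w) j"
        using co[of j] by (auto simp: lookup_\<pi> split: if_splits)
    qed
    then have "g \<in> J (Suc i)" by (simp add: J_def tw mult.commute)
    moreover have "\<pi> i u \<noteq> \<pi> i w"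
    proof
      assume "\<pi> i u = \<pi> i w"
      then have "coords B u (\<beta> i) = coords B w (\<beta> i)" using lookup_\<pi>[of i u i] lookup_\<pi>[of i w i] i by simp
      then show False using co[OF i] by simp
    qed
    then have "Poly_Mapping.lookup (twist \<theta>0 (\<pi> i) g) (\<pi> i u) = \<theta>0 b * \<theta>0 a"
      by (simp add: tw lookup_minus lookup_single)
    then have "g \<notin> J i" using ab by (auto simp: J_def)
    ultimately show "J i \<noteq> J (Suc i)" by blast
  qed
  have "I n \<subset> I (Suc n)" if n: "n < r + 2" for n
  proof -
    consider "n = 0" | "n = 1" | i where "n = Suc (Suc i)" "i < r"
      using n by (cases n; cases "n - 1") auto
    then show ?thesis
    proof cases
      case 1 then show ?thesis using s0 by simp
    next
      case 2 then show ?thesis using s1 by (simp add: numeral_2_eq_2)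
    next
      case 3 then show ?thesis using s2[of i] by (simp add: I_def)
    qed
  qed
  then have "enat (r + 2) \<in> {enat n | n. \<exists>I :: nat \<Rightarrow> 'a set. (\<forall>i\<le>n. prime_ideal (I i)) \<and> (\<forall>i<n. I i \<subset> I (Suc i))}"
    using prime by blast
  then have "enat (r + 2) \<le> krull_dim TYPE('a)" unfolding krull_dim_def by (rule Sup_upper)
  then show False using dim by simp
qed

end

section \<open>Embedding into the group algebra over the function field\<close>

text \<open>
  Fraction-free Gaussian elimination: the coordinate \<open>b\<close> is cleared with the pivot \<open>c t0 b\<close>.
\<close>

lemma integer_dependence:
  fixes c :: "'t \<Rightarrow> 'b \<Rightarrow> int"
  assumes "finite B" "finite T" "card B < card T"
  shows "\<exists>n. (\<exists>t\<in>T. n t \<noteq> 0) \<and> (\<forall>b\<in>B. (\<Sum>t\<in>T. n t * c t b) = 0)"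
  using assms
proof (induction B arbitrary: T c rule: finite_induct)
  case empty
  then obtain t where "t \<in> T" by fastforce
  then show ?case by (intro exI[of _ "\<lambda>_. 1"]) auto
next
  case (insert b B)
  show ?case
  proof (cases "\<forall>t\<in>T. c t b = 0")
    case True
    have "card B < card T" using insert by simp
    then obtain n where "\<exists>t\<in>T. n t \<noteq> 0" "\<forall>b\<in>B. (\<Sum>t\<in>T. n t * c t b) = 0"
      using insert.IH[OF insert.prems(1), of c] by blast
    then show ?thesis using True by (intro exI[of _ n]) auto
  next
    case False
    then obtain t0 where t0: "t0 \<in> T" "c t0 b \<noteq> 0" by blast
    define T' where "T' = T - {t0}"
    define c' where "c' t b' = c t0 b * c t b' - c t b * c t0 b'" for t b'
    have "finite T'" "card B < card T'" using insert t0 by (simp_all add: T'_def)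
    then obtain n where n: "\<exists>t\<in>T'. n t \<noteq> 0" "\<And>b'. b' \<in> B \<Longrightarrow> (\<Sum>t\<in>T'. n t * c' t b') = 0"
      using insert.IH[of T' c'] by blast
    define n' where "n' t = (if t = t0 then - (\<Sum>t\<in>T'. n t * c t b) else n t * c t0 b)" for t
    have sum: "(\<Sum>t\<in>T. n' t * c t b') = (\<Sum>t\<in>T'. n t * c' t b')" for b'
    proof -
      have "(\<Sum>t\<in>T. n' t * c t b') = n' t0 * c t0 b' + (\<Sum>t\<in>T'. n' t * c t b')"
        unfolding T'_def using t0 insert.prems by (intro sum.remove)
      also have "(\<Sum>t\<in>T'. n' t * c t b') = (\<Sum>t\<in>T'. n t * c t0 b * c t b')"
        by (intro sum.cong) (auto simp: n'_def T'_def)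
      finally show ?thesis
        by (simp add: n'_def c'_def algebra_simps sum_subtractf sum_distrib_left sum_distrib_right)
    qed
    have "(\<Sum>t\<in>T'. n t * c' t b) = 0" by (simp add: c'_def mult.commute)
    then have "\<forall>b'\<in>insert b B. (\<Sum>t\<in>T. n' t * c t b') = 0" using n(2) sum by auto
    moreover have "\<exists>t\<in>T. n' t \<noteq> 0" using n(1) t0 by (auto simp: n'_def T'_def)
    ultimately show ?thesis by blast
  qed
qed

context graded_algebra
begin

lemma valuationD:
  assumes "valuation \<iota> v"
  shows "c \<noteq> 0 \<Longrightarrow> v (\<iota> c) = 0" "f \<noteq> 0 \<Longrightarrow> g \<noteq> 0 \<Longrightarrow> v (f * g) = v f + v g"
    "f \<noteq> 0 \<Longrightarrow> g \<noteq> 0 \<Longrightarrow> f + g \<noteq> 0 \<Longrightarrow> min (v f) (v g) \<le> v (f + g)"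
  using assms unfolding valuation_def by blast+

lemma value_of_homogeneous_part:
  assumes "homogeneous_valuation A v" "f \<noteq> 0"
  shows "\<exists>u\<in>support f. v f = v (part f u)"
proof -
  have ne: "support f \<noteq> {}" using sum_parts[of f] assms(2) by auto
  have "v f = Min ((\<lambda>u. v (part f u)) ` support f)"
    using assms unfolding homogeneous_valuation_def part_def support_def by blast
  moreover have "Min ((\<lambda>u. v (part f u)) ` support f) \<in> (\<lambda>u. v (part f u)) ` support f"
    using ne by (intro Min_in) auto
  ultimately show ?thesis by auto
qed

text \<open>
  Suppose that quotients of homogeneous elements of equal weight are constant. Then the value of a
  homogeneous quotient is a function of its weight: the graph \<open>Rel\<close> is a subgroup that meets
  \<open>0 \<times> \<Gamma>\<close> only in 0. By homogeneity of \<open>v\<close> the second projection of \<open>Rel\<close> contains the whole value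
  group, so \<open>d\<close> independent values have weights that satisfy no linear relation, which is
  impossible in rank less than \<open>d\<close>.
\<close>

theorem nonconstant_homogeneous_quotient:
  fixes v :: "'a \<Rightarrow> 'g::linordered_ab_group_add" and B :: "'m set"
  assumes B: "lattice_basis B"
    and v: "valuation \<iota> v" and rank: "free_of_rank (zmod.span (value_semigroup v)) d" "card B < d"
    and hv: "homogeneous_valuation A v"
  shows "\<exists>u a b. a \<in> A u \<and> b \<in> A u \<and> b \<noteq> 0 \<and> (\<forall>c. a \<noteq> \<iota> c * b)"
proof (rule ccontr)
  assume "\<not> ?thesis"
  then have all: "\<exists>c. a = \<iota> c * b" if "a \<in> A u" "b \<in> A u" "b \<noteq> 0" for a b u using that by blast
  note vD = valuationD[OF v]
  have const: "v a = v b" if ab: "a \<in> A u" "b \<in> A u" "a \<noteq> 0" "b \<noteq> 0" for a b u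
  proof -
    obtain c where c: "a = \<iota> c * b" using all ab by blast
    then have "c \<noteq> 0" using ab by auto
    then show ?thesis using c vD(1)[of c] vD(2)[of "\<iota> c" b] ab by simp
  qed
  define Rel where "Rel m \<gamma> \<longleftrightarrow> (\<exists>u w a b. a \<in> A u \<and> b \<in> A w \<and> a \<noteq> 0 \<and> b \<noteq> 0 \<and> m = u - w \<and> \<gamma> = v a - v b)" for m \<gamma>
  have RelI: "Rel (u - w) (v a - v b)" if "a \<in> A u" "b \<in> A w" "a \<noteq> 0" "b \<noteq> 0" for u w a b
    using that by (auto simp: Rel_def)
  have Rel_add: "Rel (m + m') (\<gamma> + \<gamma>')" if R: "Rel m \<gamma>" "Rel m' \<gamma>'" for m m' \<gamma> \<gamma>'
  proof -
    obtain u w a b where 1: "a \<in> A u" "b \<in> A w" "a \<noteq> 0" "b \<noteq> 0" "m = u - w" "\<gamma> = v a - v b" using R(1) unfolding Rel_def by blast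
    obtain u' w' a' b' where 2: "a' \<in> A u'" "b' \<in> A w'" "a' \<noteq> 0" "b' \<noteq> 0" "m' = u' - w'" "\<gamma>' = v a' - v b'" using R(2) unfolding Rel_def by blast
    have "Rel ((u + u') - (w + w')) (v (a * a') - v (b * b'))" using 1 2 by (intro RelI A_mult) auto
    moreover have "(u + u') - (w + w') = m + m'" "v (a * a') - v (b * b') = \<gamma> + \<gamma>'"
      using 1 2 vD(2)[of a a'] vD(2)[of b b'] by simp_all
    ultimately show ?thesis by simp
  qed
  have Rel_neg: "Rel (- m) (- \<gamma>)" if R: "Rel m \<gamma>" for m \<gamma>
  proof -
    obtain u w a b where 1: "a \<in> A u" "b \<in> A w" "a \<noteq> 0" "b \<noteq> 0" "m = u - w" "\<gamma> = v a - v b" using R unfolding Rel_def by blast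
    then show ?thesis using RelI[of b w a u] by simp
  qed
  have Rel_0: "Rel 0 0" using RelI[OF one_in_A one_in_A] by simp
  have Rel_scale: "Rel (zscale n m) (zscale n \<gamma>)" if "Rel m \<gamma>" for n m \<gamma>
  proof (induction n rule: int_induct[where k = 0])
    case (step1 i)
    then show ?case using Rel_add[OF that step1(2)] by (simp add: zscale_plus_one)
  next
    case (step2 i)
    then show ?case using Rel_add[OF step2(2) Rel_neg[OF that]] by (simp add: zscale_minus_one)
  qed (simp add: Rel_0)
  have Rel_sum: "Rel (\<Sum>i\<in>I. f i) (\<Sum>i\<in>I. g i)" if "\<And>i. i \<in> I \<Longrightarrow> Rel (f i) (g i)" for I :: "'g set" and f g
    using that by (induction I rule: infinite_finite_induct) (auto simp: Rel_0 Rel_add)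
  have Rel_zero: "\<gamma> = 0" if R: "Rel 0 \<gamma>" for \<gamma>
  proof -
    obtain u w a b where 1: "a \<in> A u" "b \<in> A w" "a \<noteq> 0" "b \<noteq> 0" "0 = u - w" "\<gamma> = v a - v b" using R unfolding Rel_def by blast
    then show ?thesis using const[of a u b] by simp
  qed
  have Rel_ex: "\<exists>m. Rel m \<gamma>" if "\<gamma> \<in> zmod.span (value_semigroup v)" for \<gamma>
  proof -
    have "\<exists>x\<in>value_semigroup v. \<exists>y\<in>value_semigroup v. \<gamma> = x - y"
    proof (rule span_submonoid[OF _ _ that])
      show "0 \<in> value_semigroup v" using vD(1)[of 1] iotaD(1) by (auto simp: value_semigroup_def image_iff intro!: bexI[of _ 1])
      fix x y assume "x \<in> value_semigroup v" "y \<in> value_semigroup v"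
      then obtain f g where "f \<noteq> 0" "g \<noteq> 0" "x = v f" "y = v g" by (auto simp: value_semigroup_def)
      then show "x + y \<in> value_semigroup v"
        using vD(2)[of f g] by (auto simp: value_semigroup_def image_iff intro!: bexI[of _ "f * g"])
    qed
    then obtain f g where fg: "f \<noteq> 0" "g \<noteq> 0" "\<gamma> = v f - v g" by (auto simp: value_semigroup_def)
    obtain u where u: "u \<in> support f" "v f = v (part f u)" using value_of_homogeneous_part[OF hv fg(1)] by blast
    obtain w where w: "w \<in> support g" "v g = v (part g w)" using value_of_homogeneous_part[OF hv fg(2)] by blast
    show ?thesis using RelI[OF part_in part_in, of f u g w] u w fg(3) by (auto simp: support_iff)
  qed
  obtain B' where B': "finite B'" "card B' = d" "zmod.independent B'" "zmod.span B' = zmod.span (value_semigroup v)"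
    using rank(1) unfolding free_of_rank_def by blast
  have "\<forall>\<gamma>\<in>B'. \<exists>m. Rel m \<gamma>" using Rel_ex B'(4) zmod.span_base by blast
  then obtain m where m: "\<And>\<gamma>. \<gamma> \<in> B' \<Longrightarrow> Rel (m \<gamma>) \<gamma>" using bchoice[of B' "\<lambda>\<gamma> m. Rel m \<gamma>"] by blast
  have finB: "finite B" using B by (simp add: lattice_basis_def)
  obtain n where n: "\<exists>\<gamma>\<in>B'. n \<gamma> \<noteq> 0" "\<And>b. b \<in> B \<Longrightarrow> (\<Sum>\<gamma>\<in>B'. n \<gamma> * coords B (m \<gamma>) b) = 0"
    using integer_dependence[OF finB B'(1), of "\<lambda>\<gamma> b. coords B (m \<gamma>) b"] rank(2) B'(2) by blast
  have "(\<Sum>\<gamma>\<in>B'. zscale (n \<gamma>) (m \<gamma>)) = 0"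
    by (rule coords_eqI[OF B]) (simp add: coords_setsum[OF B] coords_zscale[OF B] coords_0 n(2))
  then have "Rel 0 (\<Sum>\<gamma>\<in>B'. zscale (n \<gamma>) \<gamma>)"
    using Rel_sum[of B' "\<lambda>\<gamma>. zscale (n \<gamma>) (m \<gamma>)" "\<lambda>\<gamma>. zscale (n \<gamma>) \<gamma>"] Rel_scale m by simp
  then have "(\<Sum>\<gamma>\<in>B'. zscale (n \<gamma>) \<gamma>) = 0" by (rule Rel_zero)
  then have "n \<gamma> = 0" if "\<gamma> \<in> B'" for \<gamma>
    using zmod.independentD[OF B'(3) B'(1) order_refl] that by blast
  then show False using n(1) by blast
qed

text \<open>
  The map \<open>f \<mapsto> \<Phi> u f \<cdot> \<chi>\<^sup>u\<close> for \<open>f\<close> of weight \<open>u\<close> is an injective graded homomorphism to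
  \<open>K(t)[M]\<close>. The last clause says that every element of \<open>K(t)\<close> is a quotient of two homogeneous
  elements of equal weight, so that \<open>K(t)\<close> is not chosen too big. Values of \<open>\<Phi> u\<close> outside \<open>A u\<close>
  are arbitrary.
\<close>

definition homogeneous_embedding :: "('m \<Rightarrow> 'a \<Rightarrow> 'k poly fract) \<Rightarrow> bool" where
  "homogeneous_embedding \<Phi> \<longleftrightarrow>
     (\<forall>u f g. f \<in> A u \<longrightarrow> g \<in> A u \<longrightarrow> \<Phi> u (f + g) = \<Phi> u f + \<Phi> u g) \<and>
     (\<forall>u w f g. f \<in> A u \<longrightarrow> g \<in> A w \<longrightarrow> \<Phi> (u + w) (f * g) = \<Phi> u f * \<Phi> w g) \<and>
     (\<forall>u f. f \<in> A u \<longrightarrow> \<Phi> u f = 0 \<longrightarrow> f = 0) \<and>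
     (\<forall>c. \<Phi> 0 (\<iota> c) = const_fract c) \<and>
     (\<forall>z. \<exists>u a b. a \<in> A u \<and> b \<in> A u \<and> b \<noteq> 0 \<and> \<Phi> u a = z * \<Phi> u b)"

end

context
  fixes \<iota> :: "'k::alg_closed_field \<Rightarrow> 'a::idom" and A :: "'m::ab_group_add \<Rightarrow> 'a set"
  assumes graded: "graded_algebra \<iota> A"
begin

interpretation graded_algebra \<iota> A by (rule graded)

text \<open>
  The quotients \<open>\<theta> a / \<theta> b\<close> of equal weight form a subfield \<open>L\<close> of \<open>K(s)\<close>, which is \<open>K(y)\<close> by
  Lueroth's theorem. A homomorphism \<open>\<kappa>\<close> from \<open>M\<close> to the nonzero elements of \<open>K(s)\<close> for which
  \<open>\<theta> f / \<kappa> u \<in> L\<close> whenever \<open>f\<close> has weight \<open>u\<close> moves all weight spaces into \<open>L\<close>; expressing the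
  result in \<open>y\<close> gives \<open>\<Phi>\<close>.
\<close>

theorem embedding_from_specialization:
  fixes B :: "'m set" and \<theta> :: "'a \<Rightarrow> 'k poly fract"
  assumes B: "lattice_basis B"
    and \<theta>: "ring_hom_map \<theta>" "\<And>c. \<theta> (\<iota> c) = const_fract c"
    and nz: "\<And>f u. f \<in> A u \<Longrightarrow> f \<noteq> 0 \<Longrightarrow> \<theta> f \<noteq> 0"
    and weights: "\<And>m. \<exists>u w a b. a \<in> A u \<and> b \<in> A w \<and> a \<noteq> 0 \<and> b \<noteq> 0 \<and> m = u - w"
    and ab: "a0 \<in> A u0" "b0 \<in> A u0" "b0 \<noteq> 0" "\<And>c. a0 \<noteq> \<iota> c * b0"
  shows "\<exists>\<Phi>. homogeneous_embedding \<Phi>"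
proof -
  note D = ring_hom_mapD[OF \<theta>(1)]
  define L where "L = {\<theta> a / \<theta> b | a b u. a \<in> A u \<and> b \<in> A u \<and> b \<noteq> 0}"
  have LI: "\<theta> a / \<theta> b \<in> L" if "a \<in> A u" "b \<in> A u" "b \<noteq> 0" for a b u using that by (auto simp: L_def)
  have cst: "const_fract c \<in> L" for c
    using LI[OF iota_in_A one_in_A, of c] by (simp add: D \<theta>(2))
  have L: "subfield_set L"
    unfolding subfield_set_def subring_set_def
  proof (intro conjI ballI)
    show "0 \<in> L" using cst[of 0] by simp
    show "1 \<in> L" using cst[of 1] by (simp add: const_fract_1)
  next
    fix x y assume "x \<in> L" "y \<in> L"
    then obtain a b u c d w where *: "a \<in> A u" "b \<in> A u" "b \<noteq> 0" "x = \<theta> a / \<theta> b"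
      "c \<in> A w" "d \<in> A w" "d \<noteq> 0" "y = \<theta> c / \<theta> d" unfolding L_def by blast
    have n: "\<theta> b \<noteq> 0" "\<theta> d \<noteq> 0" using * nz by blast+
    have bd: "b * d \<in> A (u + w)" using * by (intro A_mult)
    have "a * d - b * c \<in> A (u + w)" "a * c \<in> A (u + w)" using * by (auto intro!: A_diff A_mult)
    then have "\<theta> (a * d - b * c) / \<theta> (b * d) \<in> L" "\<theta> (a * c) / \<theta> (b * d) \<in> L"
      using bd * by (auto intro!: LI)
    moreover have "\<theta> (a * d - b * c) / \<theta> (b * d) = x - y" "\<theta> (a * c) / \<theta> (b * d) = x * y"
      unfolding *(4,8) using n by (simp_all add: D field_simps)
    ultimately show "x - y \<in> L" "x * y \<in> L" by simp_all
  next
    fix x assume "x \<in> L"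
    then obtain a b u where *: "a \<in> A u" "b \<in> A u" "b \<noteq> 0" "x = \<theta> a / \<theta> b" unfolding L_def by blast
    show "inverse x \<in> L"
    proof (cases "a = 0")
      case True
      then show ?thesis using * cst[of 0] by (simp add: D)
    next
      case False
      then show ?thesis using LI[OF *(2,1)] *(4) by simp
    qed
  qed
  have nc: "nonconstant (\<theta> a0 / \<theta> b0)"
    unfolding nonconstant_def
  proof
    assume "\<theta> a0 / \<theta> b0 \<in> range const_fract"
    then obtain c where "\<theta> a0 / \<theta> b0 = const_fract c" by auto
    then have "\<theta> (a0 - \<iota> c * b0) = 0" using nz[OF ab(2,3)] by (simp add: D \<theta>(2) field_simps)
    moreover have "a0 - \<iota> c * b0 \<in> A u0" using ab by (intro A_diff A_scale)
    ultimately have "a0 - \<iota> c * b0 = 0" using nz by blast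
    then show False using ab(4)[of c] by simp
  qed
  obtain y where y: "nonconstant y" "L = range (compose_fract y)"
    using lueroth[OF L _ LI[OF ab(1-3)] nc] cst by blast
  note hom = compose_fract_hom[OF y(1)]
  have hom_diff: "compose_fract y (f - g) = compose_fract y f - compose_fract y g" for f g
    using hom(1)[of "f - g" g] by simp
  have inj: "f = g" if "compose_fract y f = compose_fract y g" for f g
    using hom(4)[of "f - g"] hom_diff[of f g] that by auto
  \<comment> \<open>\<open>Rep u k\<close> says that \<open>k\<close> is a quotient of homogeneous elements whose weights differ by \<open>u\<close>. Choosing such a
    \<open>k\<close> for every element of a basis of \<open>M\<close> and extending multiplicatively defines \<open>\<kappa>\<close>.\<close>
  define Rep where "Rep u k \<longleftrightarrow> (\<exists>a b w. a \<in> A (w + u) \<and> b \<in> A w \<and> a \<noteq> 0 \<and> b \<noteq> 0 \<and> k = \<theta> a / \<theta> b)" for u k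
  have RepI: "Rep (u - w) (\<theta> a / \<theta> b)" if "a \<in> A u" "b \<in> A w" "a \<noteq> 0" "b \<noteq> 0" for a b u w
    unfolding Rep_def using that by (intro exI[of _ a] exI[of _ b] exI[of _ w]) simp
  have Rep_nz: "k \<noteq> 0" if "Rep u k" for u k using that nz unfolding Rep_def by fastforce
  have Rep_mult: "Rep (u + u') (k * k')" if R: "Rep u k" "Rep u' k'" for u u' k k'
  proof -
    obtain a b w where 1: "a \<in> A (w + u)" "b \<in> A w" "a \<noteq> 0" "b \<noteq> 0" "k = \<theta> a / \<theta> b" using R(1) unfolding Rep_def by blast
    obtain a' b' w' where 2: "a' \<in> A (w' + u')" "b' \<in> A w'" "a' \<noteq> 0" "b' \<noteq> 0" "k' = \<theta> a' / \<theta> b'" using R(2) unfolding Rep_def by blast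
    have "Rep ((w + u + (w' + u')) - (w + w')) (\<theta> (a * a') / \<theta> (b * b'))" using 1 2 by (intro RepI A_mult) auto
    then show ?thesis using 1 2 by (simp add: D algebra_simps)
  qed
  have Rep_inv: "Rep (- u) (inverse k)" if R: "Rep u k" for u k
  proof -
    obtain a b w where 1: "a \<in> A (w + u)" "b \<in> A w" "a \<noteq> 0" "b \<noteq> 0" "k = \<theta> a / \<theta> b" using R unfolding Rep_def by blast
    then show ?thesis using RepI[of b w a "w + u"] by simp
  qed
  have Rep_1: "Rep 0 1" using RepI[OF one_in_A one_in_A] by (simp add: D)
  have Rep_scale: "Rep (zscale n u) (k powi n)" if R: "Rep u k" for n u k
  proof (induction n rule: int_induct[where k = 0])
    case (step1 i)
    then show ?case using Rep_mult[OF R step1(2)] Rep_nz[OF R]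
      by (simp add: zscale_plus_one power_int_add mult.commute)
  next
    case (step2 i)
    then show ?case using Rep_mult[OF step2(2) Rep_inv[OF R]] Rep_nz[OF R]
      by (simp add: zscale_minus_one power_int_diff divide_inverse)
  qed (simp add: Rep_1)
  have Rep_sum: "Rep (\<Sum>i\<in>I. f i) (\<Prod>i\<in>I. g i)" if "\<And>i. i \<in> I \<Longrightarrow> Rep (f i) (g i)" for I :: "'m set" and f g
    using that by (induction I rule: infinite_finite_induct) (auto simp: Rep_1 Rep_mult)
  have "\<exists>k. Rep b k" for b using weights[of b] RepI by blast
  then obtain kb where kb: "\<And>b. Rep b (kb b)" by metis
  define \<kappa> where "\<kappa> u = (\<Prod>b\<in>B. kb b powi coords B u b)" for u
  have \<kappa>: "Rep u (\<kappa> u)" for u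
    using Rep_sum[of B "\<lambda>b. zscale (coords B u b) b" "\<lambda>b. kb b powi coords B u b"] Rep_scale[OF kb]
    unfolding \<kappa>_def coords_sum[OF B] by blast
  have \<kappa>_nz: "\<kappa> u \<noteq> 0" for u using Rep_nz[OF \<kappa>] .
  have \<kappa>_add: "\<kappa> (u + w) = \<kappa> u * \<kappa> w" for u w
    unfolding \<kappa>_def using Rep_nz[OF kb]
    by (simp add: coords_add[OF B] power_int_add prod.distrib)
  have \<kappa>_0: "\<kappa> 0 = 1" by (simp add: \<kappa>_def coords_0)
  have inL: "\<theta> f / \<kappa> u \<in> L" if f: "f \<in> A u" for f u
  proof -
    obtain a b w where 1: "a \<in> A (w + u)" "b \<in> A w" "a \<noteq> 0" "b \<noteq> 0" "\<kappa> u = \<theta> a / \<theta> b" using \<kappa>[of u] unfolding Rep_def by blast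
    have "b * f \<in> A (w + u)" using 1 f by (intro A_mult)
    then have "\<theta> (b * f) / \<theta> a \<in> L" using 1 by (intro LI)
    then show ?thesis using 1 by (simp add: D mult.commute)
  qed
  define \<Phi> where "\<Phi> u f = (SOME g. compose_fract y g = \<theta> f / \<kappa> u)" for u f
  have \<Phi>: "compose_fract y (\<Phi> u f) = \<theta> f / \<kappa> u" if f: "f \<in> A u" for u f
  proof -
    have "\<exists>g. compose_fract y g = \<theta> f / \<kappa> u" using inL[OF f] y(2) by (auto simp: image_iff)
    then show ?thesis unfolding \<Phi>_def by (rule someI_ex)
  qed
  have "homogeneous_embedding \<Phi>"
    unfolding homogeneous_embedding_def
  proof (intro conjI allI impI)
    show "\<Phi> u (f + g) = \<Phi> u f + \<Phi> u g" if "f \<in> A u" "g \<in> A u" for u f g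
      by (rule inj) (use that in \<open>simp add: hom \<Phi> A_add D add_divide_distrib\<close>)
    show "\<Phi> (u + w) (f * g) = \<Phi> u f * \<Phi> w g" if "f \<in> A u" "g \<in> A w" for u w f g
      by (rule inj) (use that in \<open>simp add: hom \<Phi> A_mult D \<kappa>_add\<close>)
    show "f = 0" if "f \<in> A u" "\<Phi> u f = 0" for u f
    proof (rule ccontr)
      assume "f \<noteq> 0"
      then have "\<theta> f / \<kappa> u \<noteq> 0" using nz[OF that(1)] \<kappa>_nz by simp
      then show False using \<Phi>[OF that(1)] that(2) hom(3)[of 0] by simp
    qed
    show "\<Phi> 0 (\<iota> c) = const_fract c" for c
      by (rule inj) (simp add: \<Phi> iota_in_A hom \<kappa>_0 \<theta>(2))
    show "\<exists>u a b. a \<in> A u \<and> b \<in> A u \<and> b \<noteq> 0 \<and> \<Phi> u a = z * \<Phi> u b" for z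
    proof -
      have "compose_fract y z \<in> L" using y(2) by blast
      then obtain a b u where *: "a \<in> A u" "b \<in> A u" "b \<noteq> 0" "compose_fract y z = \<theta> a / \<theta> b" unfolding L_def by blast
      have "\<Phi> u a = z * \<Phi> u b"
        by (rule inj) (use * nz[OF *(2,3)] in \<open>simp add: hom(2) \<Phi>\<close>)
      then show ?thesis using * by blast
    qed
  qed
  then show ?thesis by blast
qed

end

text \<open>
  The element \<open>e\<close> needed to separate the kernels of \<open>\<theta>\<close> and \<open>\<theta>0\<close> is \<open>a - c b\<close>, where \<open>c\<close> is the
  value of \<open>a / b\<close> at the first point: it does not vanish at the second point.
\<close>

theorem homogeneous_embedding_exists:
  fixes \<iota> :: "'k::alg_closed_field \<Rightarrow> 'a::idom"
    and A :: "'m::ab_group_add \<Rightarrow> 'a set"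
    and v :: "'a \<Rightarrow> 'g::linordered_ab_group_add"
  assumes var: "affine_T_variety \<iota> A" and rat: "rational_variety \<iota>"
    and c1: "complexity_one A" and v: "valuation \<iota> v" and rank: "full_rank v"
    and hv: "homogeneous_valuation A v"
  shows "\<exists>\<Phi>. graded_algebra.homogeneous_embedding \<iota> A \<Phi>"
proof -
  have graded: "graded_algebra \<iota> A" using var by (simp add: affine_T_variety_def graded_algebra_def)
  interpret graded_algebra \<iota> A by (rule graded)
  obtain r where r: "free_of_rank (UNIV :: 'm set) r" "krull_dim TYPE('a) = enat (r + 1)"
    using c1 by (auto simp: complexity_one_def)
  obtain B :: "'m set" where B: "lattice_basis B" "card B = r"
    using r(1) by (auto simp: free_of_rank_def lattice_basis_def)
  have rk: "free_of_rank (zmod.span (value_semigroup v)) (r + 1)" using rank r(2) by (auto simp: full_rank_def)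
  obtain u0 a b where ab: "a \<in> A u0" "b \<in> A u0" "b \<noteq> 0" "\<And>c. a \<noteq> \<iota> c * b"
    using nonconstant_homogeneous_quotient[OF B(1) v rk _ hv] B(2) by auto
  have eff: "effective_grading A" and fg: "finitely_generated_algebra \<iota>" using var by (simp_all add: affine_T_variety_def)
  obtain H where H: "finite H" "0 \<notin> H" "\<forall>h\<in>H. \<exists>u. h \<in> A u" "subring_set hull (range \<iota> \<union> H) = UNIV"
    using homogeneous_generators[OF fg] by blast
  obtain \<theta> :: "'a \<Rightarrow> 'k poly fract" and \<theta>0 \<theta>1 :: "'a \<Rightarrow> 'k" where
    hom: "ring_hom_map \<theta>" "ring_hom_map \<theta>0" "ring_hom_map \<theta>1"
    and cs: "\<And>c. \<theta> (\<iota> c) = to_fract [:c:]" "\<And>c. \<theta>0 (\<iota> c) = c" "\<And>c. \<theta>1 (\<iota> c) = c"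
    and le: "\<And>f. \<theta> f = 0 \<Longrightarrow> \<theta>0 f = 0 \<and> \<theta>1 f = 0"
    and nz: "\<And>h. h \<in> H \<Longrightarrow> \<theta>0 h \<noteq> 0" "\<theta>0 b \<noteq> 0" and sep: "\<theta>0 a * \<theta>1 b \<noteq> \<theta>1 a * \<theta>0 b"
    using rational_specialization[OF alg rat H(1,2,4) ab(3,4)] by blast
  define e where "e = a - \<iota> (\<theta>0 a / \<theta>0 b) * b"
  have e0: "\<theta>0 e = 0" unfolding e_def using nz(2) by (simp add: ring_hom_mapD[OF hom(2)] cs)
  have e: "e \<in> A u0" unfolding e_def using ab by (intro A_diff A_scale)
  have e1: "\<theta> e \<noteq> 0"
  proof
    assume "\<theta> e = 0"
    then have "\<theta>1 e = 0" using le by blast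
    then have "\<theta>1 a = \<theta>0 a / \<theta>0 b * \<theta>1 b" by (simp add: e_def ring_hom_mapD[OF hom(3)] cs)
    then show False using sep nz(2) by (simp add: field_simps)
  qed
  have nonvanish: "\<theta> f \<noteq> 0" if "f \<in> A u" "f \<noteq> 0" for f u
    by (rule homogeneous_nonvanishing[OF B r(2) eff H(4) _ hom(1,2) cs(2) _ e e1 e0 that])
       (use H(3) nz(1) le in blast)+
  show ?thesis
    by (rule embedding_from_specialization[OF graded B(1) hom(1) cs(1) nonvanish weights_from_effective[OF eff] ab])
qed

section \<open>Integral homogeneous elements\<close>

lemma common_denominator_fract:
  fixes f :: "'j \<Rightarrow> 'a::idom fract"
  assumes "finite J"
  shows "\<exists>h. h \<noteq> 0 \<and> (\<forall>j\<in>J. \<exists>p. to_fract h * f j = to_fract p)"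
  using assms
proof (induction J rule: finite_induct)
  case empty
  show ?case by (intro exI[of _ 1]) auto
next
  case (insert j J)
  then obtain h where h: "h \<noteq> 0" "\<And>j. j \<in> J \<Longrightarrow> \<exists>p. to_fract h * f j = to_fract p" by blast
  obtain r s where rs: "f j = Fract r s" "s \<noteq> 0" by (cases "f j")
  have "\<exists>p. to_fract (h * s) * f i = to_fract p" if ii: "i \<in> insert j J" for i
  proof (cases "i = j")
    case True
    have "to_fract (h * s) * f j = to_fract (h * r)" using rs by (simp add: Fract_conv_to_fract)
    then show ?thesis using True by blast
  next
    case False
    then obtain p where "to_fract h * f i = to_fract p" using h(2)[of i] ii by blast
    then have "to_fract (h * s) * f i = to_fract (p * s)" by (simp add: algebra_simps)
    then show ?thesis by blast
  qed
  then show ?case using h(1) rs(2) by (intro exI[of _ "h * s"]) auto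
qed

text \<open>
  All coefficients of a Bezout relation for \<open>q\<close> except the one of \<open>p j0\<close> are reduced modulo
  \<open>p j0\<close>. The degree of the remaining one is then controlled because \<open>q\<close> and all other terms have
  degree at most \<open>2 e\<close>.
\<close>

lemma bounded_degree_combination:
  fixes p :: "'j \<Rightarrow> 'k::field poly"
  assumes J: "finite J" "j0 \<in> J" and one: "(\<Sum>j\<in>J. r j * p j) = 1"
    and deg: "\<And>j. j \<in> J \<Longrightarrow> degree (p j) \<le> e" "degree (p j0) = e" "p j0 \<noteq> 0"
    and q: "degree q \<le> 2 * e"
  shows "\<exists>w. q = (\<Sum>j\<in>J. w j * p j) \<and> (\<forall>j\<in>J. degree (w j) \<le> e)"
proof -
  define D where "D j = (q * r j) div p j0" for j
  define R where "R j = (q * r j) mod p j0" for j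
  have DR: "D j * p j0 + R j = q * r j" for j unfolding D_def R_def by (rule div_mult_mod_eq)
  define w where "w j = (if j = j0 then q * r j0 + (\<Sum>j\<in>J - {j0}. D j * p j) else R j)" for j
  have split: "(\<Sum>j\<in>J. f j) = f j0 + (\<Sum>j\<in>J - {j0}. f j)" for f :: "'j \<Rightarrow> 'k poly"
    using sum.remove[OF J, of f] .
  have "(\<Sum>j\<in>J. w j * p j) = (q * r j0 + (\<Sum>j\<in>J - {j0}. D j * p j)) * p j0 + (\<Sum>j\<in>J - {j0}. R j * p j)"
    unfolding split by (simp add: w_def)
  also have "\<dots> = q * r j0 * p j0 + (\<Sum>j\<in>J - {j0}. (D j * p j0 + R j) * p j)"
    by (simp add: ring_distribs sum.distrib sum_distrib_left sum_distrib_right ac_simps)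
  also have "\<dots> = q * (\<Sum>j\<in>J. r j * p j)"
    unfolding split DR by (simp add: distrib_left sum_distrib_left mult.assoc)
  finally have eq: "q = (\<Sum>j\<in>J. w j * p j)" using one by simp
  have small: "degree (w j) \<le> e" if "j \<in> J - {j0}" for j
    using degree_mod_less[OF deg(3), of "q * r j"] that deg(2) by (auto simp: w_def R_def)
  have "w j0 * p j0 = q - (\<Sum>j\<in>J - {j0}. w j * p j)" using eq unfolding split by (simp add: algebra_simps)
  moreover have "degree (\<Sum>j\<in>J - {j0}. w j * p j) \<le> 2 * e"
    using J small deg(1) by (intro degree_sum_le order_trans[OF degree_mult_le]) (auto simp: mult_2 intro!: add_mono)
  ultimately have le: "degree (w j0 * p j0) \<le> 2 * e" using q by (metis degree_diff_le)
  have "degree (w j0) \<le> e"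
  proof (cases "w j0 = 0")
    case False
    then have "degree (w j0 * p j0) = degree (w j0) + e" using deg by (simp add: degree_mult_eq)
    then show ?thesis using le by simp
  qed simp
  then show ?thesis using eq small by (intro exI[of _ w]) auto
qed

lemma poly_as_const_combination:
  fixes w :: "'k::field poly"
  assumes "degree w \<le> e"
  shows "to_fract w = (\<Sum>l\<le>e. const_fract (coeff w l) * to_fract [:0, 1:] ^ l)"
proof -
  have "w = (\<Sum>l\<le>e. monom (coeff w l) l)" using poly_as_sum_of_monoms'[OF assms] by simp
  then have "to_fract w = (\<Sum>l\<le>e. to_fract (monom (coeff w l) l))" by (metis to_fract_sum)
  moreover have "to_fract (monom c l) = const_fract c * to_fract [:0, 1:] ^ l" for c :: 'k and l
  proof (induction l)
    case (Suc l)
    have "monom c (Suc l) = [:0, 1:] * monom c l" by (simp add: monom_Suc)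
    then show ?case using Suc by (simp only: to_fract_mult power_Suc) (simp add: ac_simps)
  qed (simp add: monom_0)
  ultimately show ?thesis by simp
qed

text \<open>
  Multiplication by \<open>F\<close> maps the polynomials of degree at most \<open>e\<close> into the combinations of the
  \<open>G j\<close> whose coefficients are again such polynomials. After clearing denominators and removing
  the greatest common divisor \<open>d\<close>, the hypothesis at finite points says that \<open>d\<close> divides the
  numerator of \<open>F\<close>, and at infinity that the quotient \<open>q\<close> has degree at most \<open>e\<close>; so \<open>t\<^sup>i q\<close> has
  degree at most \<open>2 e\<close>.
\<close>

theorem finite_module_relation:
  fixes F :: "'k::alg_closed_field poly fract" and G :: "'j \<Rightarrow> 'k poly fract"
  assumes J: "finite J" "J \<noteq> {}" and F: "F \<noteq> 0" and G: "\<And>j. j \<in> J \<Longrightarrow> G j \<noteq> 0"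
    and dom: "\<And>x. \<exists>j\<in>J. ord_at x (G j) \<le> ord_at x F"
  shows "\<exists>e W. \<forall>i\<le>e. to_fract [:0, 1:] ^ i * F =
    (\<Sum>j\<in>J. \<Sum>l\<le>e. const_fract (W j i l) * to_fract [:0, 1:] ^ l * G j)"
proof -
  obtain h where h: "h \<noteq> 0" "\<forall>j\<in>insert None (Some ` J). \<exists>p. to_fract h * (case j of None \<Rightarrow> F | Some j \<Rightarrow> G j) = to_fract p"
    using common_denominator_fract[of "insert None (Some ` J)" "\<lambda>j. case j of None \<Rightarrow> F | Some j \<Rightarrow> G j"] J by auto
  then obtain p where p: "to_fract h * F = to_fract p" by auto
  have "\<forall>j\<in>J. \<exists>p. to_fract h * G j = to_fract p" using h(2) by auto
  from bchoice[OF this] obtain P where P: "\<And>j. j \<in> J \<Longrightarrow> to_fract h * G j = to_fract (P j)" by blast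
  have hF0: "to_fract h * F \<noteq> 0" using h(1) F by simp
  then have p0: "p \<noteq> 0" unfolding p by simp
  have P0: "P j \<noteq> 0" if "j \<in> J" for j
  proof -
    have "to_fract h * G j \<noteq> 0" using h(1) G[OF that] by simp
    then show ?thesis using P[OF that] by simp
  qed
  have ordp: "ord_at x (to_fract h) + ord_at x F = poly_ord x p" for x
    using ord_at_mult[of "to_fract h" F x] h(1) F p ord_at_to_fract[OF p0, of x] by simp
  have ordP: "ord_at x (to_fract h) + ord_at x (G j) = poly_ord x (P j)" if "j \<in> J" for x j
    using ord_at_mult[of "to_fract h" "G j" x] h(1) G[OF that] P[OF that] ord_at_to_fract[OF P0[OF that], of x] by simp
  have dom': "\<exists>j\<in>J. poly_ord x (P j) \<le> poly_ord x p" for x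
  proof -
    obtain j where j: "j \<in> J" "ord_at x (G j) \<le> ord_at x F" using dom[of x] by blast
    then show ?thesis using ordp[of x] ordP[OF j(1), of x] by (intro bexI[of _ j]) auto
  qed
  obtain j1 where "j1 \<in> J" using J by blast
  obtain d r where d: "d \<noteq> 0" "d = (\<Sum>j\<in>J. r j * P j)" "\<forall>j\<in>J. d dvd P j"
    using polynomial_bezout[of J j1 P, OF J(1) \<open>j1 \<in> J\<close> P0[OF \<open>j1 \<in> J\<close>]] by blast
  from d(3) have "\<forall>j\<in>J. \<exists>q. P j = d * q" by (auto elim: dvdE)
  from bchoice[OF this] obtain Q where Q: "\<And>j. j \<in> J \<Longrightarrow> P j = d * Q j" by blast
  have "order a d \<le> order a p" for a
  proof -
    obtain j where j: "j \<in> J" "poly_ord (Some a) (P j) \<le> poly_ord (Some a) p" using dom' by blast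
    have "order a d \<le> order a (P j)" using d(3) j(1) P0 by (intro dvd_imp_order_le) auto
    then show ?thesis using j(2) by simp
  qed
  then have "d dvd p" by (intro dvd_of_orders d(1) p0)
  then obtain q where q: "p = d * q" by (rule dvdE)
  have Q0: "Q j \<noteq> 0" if "j \<in> J" for j using P0[OF that] Q[OF that] by auto
  have q0: "q \<noteq> 0" using p0 q by auto
  have "d * (\<Sum>j\<in>J. r j * Q j) = (\<Sum>j\<in>J. r j * P j)"
    by (simp add: sum_distrib_left Q algebra_simps)
  then have "d * (\<Sum>j\<in>J. r j * Q j) = d * 1" using d(2) by simp
  then have one: "(\<Sum>j\<in>J. r j * Q j) = 1" using d(1) mult_left_cancel by blast
  define e where "e = Max ((\<lambda>j. degree (Q j)) ` J)"
  have e: "degree (Q j) \<le> e" if "j \<in> J" for j using that J by (simp add: e_def)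
  have "e \<in> (\<lambda>j. degree (Q j)) ` J" unfolding e_def using J by (intro Max_in) auto
  then obtain j0 where j0: "j0 \<in> J" "degree (Q j0) = e" by auto
  have "degree q \<le> e"
  proof -
    obtain j where j: "j \<in> J" "poly_ord None (P j) \<le> poly_ord None p" using dom' by blast
    then have "degree d + degree q \<le> degree d + degree (Q j)"
      using d(1) q0 Q0[OF j(1)] by (simp add: q Q degree_mult_eq)
    then show ?thesis using e[OF j(1)] by simp
  qed
  have "\<exists>w. [:0, 1:] ^ i * q = (\<Sum>j\<in>J. w j * Q j) \<and> (\<forall>j\<in>J. degree (w j) \<le> e)" if "i \<le> e" for i
  proof (rule bounded_degree_combination[OF J(1) j0(1) one e j0(2) Q0[OF j0(1)]])
    have "degree ([:0, 1:] ^ i :: 'k poly) \<le> i" by (rule order_trans[OF degree_power_le]) simp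
    then show "degree ([:0, 1:] ^ i * q) \<le> 2 * e"
      using degree_mult_le[of "[:0, 1:] ^ i" q] \<open>degree q \<le> e\<close> that by linarith
  qed
  then have "\<forall>i\<in>{..e}. \<exists>w. [:0, 1:] ^ i * q = (\<Sum>j\<in>J. w j * Q j) \<and> (\<forall>j\<in>J. degree (w j) \<le> e)" by simp
  from bchoice[OF this] obtain w where w: "\<And>i. i \<le> e \<Longrightarrow> [:0, 1:] ^ i * q = (\<Sum>j\<in>J. w i j * Q j)"
    "\<And>i j. i \<le> e \<Longrightarrow> j \<in> J \<Longrightarrow> degree (w i j) \<le> e" by auto
  have "to_fract [:0, 1:] ^ i * F = (\<Sum>j\<in>J. \<Sum>l\<le>e. const_fract (coeff (w i j) l) * to_fract [:0, 1:] ^ l * G j)"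
    if i: "i \<le> e" for i
  proof -
    have pw: "to_fract ([:0, 1:] ^ i :: 'k poly) = to_fract [:0, 1:] ^ i" by (induction i) (simp_all only: power_0 power_Suc to_fract_1 to_fract_mult)
    have "to_fract h * (to_fract [:0, 1:] ^ i * F) = to_fract d * to_fract ([:0, 1:] ^ i * q)"
      using p q pw by (simp only: to_fract_mult) (simp add: ac_simps)
    also have "\<dots> = (\<Sum>j\<in>J. to_fract (w i j) * to_fract (d * Q j))"
      unfolding w(1)[OF i] by (simp add: sum_distrib_left ac_simps)
    also have "\<dots> = (\<Sum>j\<in>J. to_fract (w i j) * (to_fract h * G j))"
      using P Q by (intro sum.cong) auto
    also have "\<dots> = to_fract h * (\<Sum>j\<in>J. to_fract (w i j) * G j)"
      by (simp add: sum_distrib_left ac_simps)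
    finally have "to_fract [:0, 1:] ^ i * F = (\<Sum>j\<in>J. to_fract (w i j) * G j)" using h(1) by simp
    also have "\<dots> = (\<Sum>j\<in>J. \<Sum>l\<le>e. const_fract (coeff (w i j) l) * to_fract [:0, 1:] ^ l * G j)"
      using w(2)[OF i] by (intro sum.cong refl) (subst poly_as_const_combination[of _ e]; simp add: sum_distrib_right)
    finally show ?thesis .
  qed
  then show ?thesis by (intro exI[of _ e] exI[of _ "\<lambda>j i l. coeff (w i j) l"]) auto
qed

lemma comm_ring_hom_to_fract: "comm_ring_hom (to_fract :: 'a::idom \<Rightarrow> 'a fract)"
  by standard auto

lemma poly_map_pcompose:
  assumes "ring_hom_map h"
  shows "poly (map_poly h (pcompose p q)) x = poly (map_poly h p) (poly (map_poly h q) x)"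
proof -
  note D = ring_hom_mapD[OF assms]
  have add: "map_poly h (a + b) = map_poly h a + map_poly h b" for a b
    by (intro poly_eqI) (simp add: coeff_map_poly D)
  have mult: "map_poly h (a * b) = map_poly h a * map_poly h b" for a b
    by (intro poly_eqI) (simp add: coeff_map_poly coeff_mult D)
  have c: "map_poly h (pCons a p) = pCons (h a) (map_poly h p)" for a p
    by (intro poly_eqI) (simp add: coeff_map_poly D coeff_pCons split: nat.splits)
  show ?thesis by (induction p) (simp_all add: pcompose_pCons add mult c D)
qed

text \<open>
  The relations say that \<open>X\<^sup>N\<close> is an eigenvalue of \<open>M\<close> with eigenvector \<open>c\<close>. The characteristic
  polynomial of \<open>M\<close> is monic over the ring, and substituting \<open>X\<^sup>N\<close> for its variable keeps it
  monic.
\<close>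

lemma integral_of_matrix_relation:
  fixes c :: "nat \<Rightarrow> 'a::idom" and M :: "nat \<Rightarrow> nat \<Rightarrow> 'a" and X :: "'a fract"
  assumes ic: "integrally_closed TYPE('a)" and N: "N \<ge> 1"
    and rel: "\<And>i. i \<le> e \<Longrightarrow> X ^ N * to_fract (c i) = (\<Sum>l\<le>e. to_fract (M i l) * to_fract (c l))"
    and nz: "\<exists>i\<le>e. c i \<noteq> 0"
  shows "X \<in> range to_fract"
proof -
  define B where "B = mat (Suc e) (Suc e) (\<lambda>(i, l). M i l)"
  define B' where "B' = map_mat to_fract B"
  define V where "V = vec (Suc e) (\<lambda>i. to_fract (c i))"
  have B: "B \<in> carrier_mat (Suc e) (Suc e)" "B' \<in> carrier_mat (Suc e) (Suc e)" by (auto simp: B_def B'_def)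
  have V: "V \<in> carrier_vec (Suc e)" by (simp add: V_def)
  have "B' *\<^sub>v V = X ^ N \<cdot>\<^sub>v V"
  proof (rule eq_vecI)
    show "dim_vec (B' *\<^sub>v V) = dim_vec (X ^ N \<cdot>\<^sub>v V)" using B V by simp
    fix i assume "i < dim_vec (X ^ N \<cdot>\<^sub>v V)"
    then have i: "i < Suc e" using V by simp
    have "(B' *\<^sub>v V) $ i = (\<Sum>l\<in>{0..<Suc e}. to_fract (M i l) * to_fract (c l))"
      using i by (simp add: B'_def B_def V_def scalar_prod_def)
    also have "{0..<Suc e} = {..e}" by auto
    also have "(\<Sum>l\<in>{..e}. to_fract (M i l) * to_fract (c l)) = X ^ N * to_fract (c i)" using rel[of i] i by simp
    finally show "(B' *\<^sub>v V) $ i = (X ^ N \<cdot>\<^sub>v V) $ i" using i by (simp add: V_def)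
  qed
  moreover have "V \<noteq> 0\<^sub>v (Suc e)"
  proof
    assume "V = 0\<^sub>v (Suc e)"
    then have "V $ i = 0" if "i \<le> e" for i using that by simp
    then have "c i = 0" if "i \<le> e" for i using that by (fastforce simp: V_def)
    then show False using nz by blast
  qed
  ultimately have "eigenvector B' V (X ^ N)" using B V by (simp add: eigenvector_def B'_def B_def)
  then have "eigenvalue B' (X ^ N)" by (auto simp: eigenvalue_def)
  then have root: "poly (char_poly B') (X ^ N) = 0" using eigenvalue_root_char_poly[OF B(2)] by blast
  define p where "p = pcompose (char_poly B) (monom 1 N)"
  have h: "ring_hom_map (to_fract :: 'a \<Rightarrow> 'a fract)" by (simp add: ring_hom_map_def)
  have cp: "char_poly B' = map_poly to_fract (char_poly B)"
    unfolding B'_def by (rule comm_ring_hom.char_poly_hom[OF comm_ring_hom_to_fract B(1)])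
  have "map_poly to_fract (monom 1 N :: 'a poly) = monom 1 N"
    by (intro poly_eqI) (simp add: coeff_map_poly)
  then have "poly (map_poly to_fract p) X = 0"
    unfolding p_def poly_map_pcompose[OF h] using root by (simp add: cp poly_monom)
  moreover have "lead_coeff p = 1"
  proof -
    have "degree (monom (1::'a) N) > 0" using N by (simp add: degree_monom_eq)
    then have "lead_coeff p = lead_coeff (char_poly B) * lead_coeff (monom (1::'a) N) ^ degree (char_poly B)"
      unfolding p_def by (rule lead_coeff_comp)
    then show ?thesis using degree_monic_char_poly[OF B(1)] by (simp add: degree_monom_eq)
  qed
  ultimately show ?thesis using ic unfolding integrally_closed_def by blast
qed

locale embedded_algebra = graded_algebra \<iota> A
  for \<iota> :: "'k::alg_closed_field \<Rightarrow> 'a::idom" and A :: "'m::ab_group_add \<Rightarrow> 'a set" +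
  fixes \<Phi> :: "'m \<Rightarrow> 'a \<Rightarrow> 'k poly fract"
  assumes embedding: "homogeneous_embedding \<Phi>"
    and weights: "\<exists>u w a b. a \<in> A u \<and> b \<in> A w \<and> a \<noteq> 0 \<and> b \<noteq> 0 \<and> m = u - w"
begin

lemma Phi_add: "f \<in> A u \<Longrightarrow> g \<in> A u \<Longrightarrow> \<Phi> u (f + g) = \<Phi> u f + \<Phi> u g"
  and Phi_mult: "f \<in> A u \<Longrightarrow> g \<in> A w \<Longrightarrow> \<Phi> (u + w) (f * g) = \<Phi> u f * \<Phi> w g"
  and Phi_eq_0: "f \<in> A u \<Longrightarrow> \<Phi> u f = 0 \<Longrightarrow> f = 0"
  and Phi_iota: "\<Phi> 0 (\<iota> c) = const_fract c"
  and Phi_quotient: "\<exists>u a b. a \<in> A u \<and> b \<in> A u \<and> b \<noteq> 0 \<and> \<Phi> u a = z * \<Phi> u b"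
  using embedding unfolding homogeneous_embedding_def by blast+

lemma Phi_0 [simp]: "\<Phi> u 0 = 0"
proof -
  have "\<Phi> u 0 + 0 = \<Phi> u 0 + \<Phi> u 0" using Phi_add[OF A_0 A_0, of u] by simp
  then show ?thesis by (simp only: add_left_cancel)
qed

lemma Phi_nz: "f \<in> A u \<Longrightarrow> f \<noteq> 0 \<Longrightarrow> \<Phi> u f \<noteq> 0"
  using Phi_eq_0 by blast

lemma Phi_1: "\<Phi> 0 1 = 1"
  using Phi_iota[of 1] by (simp add: iotaD const_fract_1)

lemma Phi_scale: "f \<in> A u \<Longrightarrow> \<Phi> u (\<iota> c * f) = const_fract c * \<Phi> u f"
  using Phi_mult[OF iota_in_A, of f u c] by (simp add: Phi_iota)

lemma Phi_uminus: "f \<in> A u \<Longrightarrow> \<Phi> u (- f) = - \<Phi> u f"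
  using Phi_add[of f u "- f"] A_uminus[of f u] by (simp add: eq_neg_iff_add_eq_0 add.commute)

lemma Phi_diff: "f \<in> A u \<Longrightarrow> g \<in> A u \<Longrightarrow> \<Phi> u (f - g) = \<Phi> u f - \<Phi> u g"
  using Phi_add[of f u "- g"] Phi_uminus[of g u] A_uminus[of g u] by simp

lemma Phi_inj: "f \<in> A u \<Longrightarrow> g \<in> A u \<Longrightarrow> \<Phi> u f = \<Phi> u g \<Longrightarrow> f = g"
  using Phi_diff[of f u g] Phi_eq_0[of "f - g" u] A_diff[of f u g] by simp

lemma Phi_sum: "(\<And>i. i \<in> I \<Longrightarrow> f i \<in> A u) \<Longrightarrow> \<Phi> u (\<Sum>i\<in>I. f i) = (\<Sum>i\<in>I. \<Phi> u (f i))"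
  by (induction I rule: infinite_finite_induct) (auto simp: Phi_add A_sum)

lemma Phi_power: "f \<in> A u \<Longrightarrow> \<Phi> (zscale (int n) u) (f ^ n) = \<Phi> u f ^ n"
proof (induction n)
  case (Suc n)
  have "zscale (int (Suc n)) u = u + zscale (int n) u"
    using zscale_plus_one[of "int n" u] by (simp add: add.commute)
  then show ?case using Phi_mult[OF Suc.prems A_power[OF Suc.prems, of n]] Suc.IH[OF Suc.prems] by simp
qed (simp add: Phi_1)

lemma Phi_prod_powers:
  assumes "finite K" "\<And>k. k \<in> K \<Longrightarrow> f k \<in> A (u k)"
  shows "\<Phi> (\<Sum>k\<in>K. zscale (int (c k)) (u k)) (\<Prod>k\<in>K. f k ^ c k) = (\<Prod>k\<in>K. \<Phi> (u k) (f k) ^ c k)"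
  using assms
proof (induction K rule: finite_induct)
  case (insert k K)
  then show ?case
    using Phi_mult[OF A_power[of "f k" "u k" "c k"] A_prod_powers[of K f u c]] Phi_power[of "f k" "u k" "c k"] by simp
qed (simp add: Phi_1)

text \<open>
  Every element of \<open>K(t)\<close> occurs as a quotient in every prescribed difference of weights.
\<close>

lemma homogeneous_fraction:
  "\<exists>w a b. a \<in> A (w + u) \<and> b \<in> A w \<and> b \<noteq> 0 \<and> \<Phi> (w + u) a = z * \<Phi> w b"
proof -
  obtain u1 u2 b1 b2 where b: "b1 \<in> A u1" "b2 \<in> A u2" "b1 \<noteq> 0" "b2 \<noteq> 0" "u = u1 - u2" using weights[of u] by blast
  obtain w c d where cd: "c \<in> A w" "d \<in> A w" "d \<noteq> 0" "\<Phi> w c = (z * \<Phi> u2 b2 / \<Phi> u1 b1) * \<Phi> w d"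
    using Phi_quotient[of "z * \<Phi> u2 b2 / \<Phi> u1 b1"] by blast
  have eq: "w + u2 + u = w + u1" using b(5) by simp
  have "\<Phi> (w + u2 + u) (c * b1) = z * \<Phi> (w + u2) (d * b2)"
    unfolding eq using Phi_mult[OF cd(1) b(1)] Phi_mult[OF cd(2) b(2)] cd(4) Phi_nz[OF b(1,3)] by simp
  moreover have "c * b1 \<in> A (w + u2 + u)" unfolding eq using A_mult[OF cd(1) b(1)] .
  moreover have "d * b2 \<in> A (w + u2)" using A_mult[OF cd(2) b(2)] .
  moreover have "d * b2 \<noteq> 0" using cd(3) b(4) by simp
  ultimately show ?thesis by blast
qed

text \<open>
  By \<open>finite_module_relation\<close> the products of \<open>z\<^sup>N\<close> with \<open>1, t, \<dots>, t\<^sup>e\<close> are combinations of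
  \<open>1, t, \<dots>, t\<^sup>e\<close> with coefficients that come from \<open>R\<close>, so \<open>z\<close> is integral over \<open>R\<close> once it is
  written as a quotient of homogeneous elements. Normality produces an element \<open>f\<close> of \<open>R\<close>;
  comparing weights shows that it is homogeneous of weight \<open>u\<close>.
\<close>

theorem integral_homogeneous_element:
  assumes ic: "integrally_closed TYPE('a)" and N: "N \<ge> 1" and z: "z \<noteq> 0"
    and J: "finite J" "J \<noteq> {}"
    and g: "\<And>j. j \<in> J \<Longrightarrow> g j \<in> A (zscale (int N) u)" "\<And>j. j \<in> J \<Longrightarrow> g j \<noteq> 0"
    and dom: "\<And>x. \<exists>j\<in>J. ord_at x (\<Phi> (zscale (int N) u) (g j)) \<le> int N * ord_at x z"
  shows "\<exists>f\<in>A u. \<Phi> u f = z"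
proof -
  let ?t = "to_fract [:0, 1:] :: 'k poly fract"
  let ?Nu = "zscale (int N) u"
  define G where "G j = \<Phi> ?Nu (g j)" for j
  obtain e W where W: "\<And>i. i \<le> e \<Longrightarrow> ?t ^ i * z ^ N = (\<Sum>j\<in>J. \<Sum>l\<le>e. const_fract (W j i l) * ?t ^ l * G j)"
    using finite_module_relation[OF J, of "z ^ N" G] z g dom Phi_nz by (auto simp: G_def ord_at_power)
  \<comment> \<open>The powers of \<open>t\<close> need not come from \<open>R\<close>; with \<open>t = a / b\<close> the elements
    \<open>c i = a\<^sup>i b\<^sup>e\<^sup>-\<^sup>i\<close> of \<open>R\<close>, all of the same weight, replace them.\<close>
  obtain w' a b where ab: "a \<in> A w'" "b \<in> A w'" "b \<noteq> 0" "\<Phi> w' a = ?t * \<Phi> w' b" using Phi_quotient by blast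
  define we where "we = zscale (int e) w'"
  define c where "c i = a ^ i * b ^ (e - i)" for i
  have c: "c i \<in> A we" "\<Phi> we (c i) = ?t ^ i * \<Phi> w' b ^ e" if "i \<le> e" for i
  proof -
    have eq: "zscale (int i) w' + zscale (int (e - i)) w' = we"
      using that by (simp add: we_def flip: zscale_add_left)
    show "c i \<in> A we" using A_mult[OF A_power[OF ab(1)] A_power[OF ab(2)], of i "e - i"] unfolding eq c_def .
    have "\<Phi> we (c i) = \<Phi> w' a ^ i * \<Phi> w' b ^ (e - i)"
      using Phi_mult[OF A_power[OF ab(1)] A_power[OF ab(2)], of i "e - i"] unfolding eq c_def
      by (simp add: Phi_power ab)
    also have "\<dots> = ?t ^ i * (\<Phi> w' b ^ i * \<Phi> w' b ^ (e - i))" by (simp add: ab(4) power_mult_distrib)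
    also have "\<Phi> w' b ^ i * \<Phi> w' b ^ (e - i) = \<Phi> w' b ^ e" using that by (simp flip: power_add)
    finally show "\<Phi> we (c i) = ?t ^ i * \<Phi> w' b ^ e" .
  qed
  obtain w p q where pq: "p \<in> A (w + u)" "q \<in> A w" "q \<noteq> 0" "\<Phi> (w + u) p = z * \<Phi> w q"
    using homogeneous_fraction by blast
  define M where "M i l = (\<Sum>j\<in>J. \<iota> (W j i l) * g j)" for i l
  have M: "M i l \<in> A ?Nu" for i l unfolding M_def by (intro A_sum A_scale g)
  have PhiM: "\<Phi> ?Nu (M i l) = (\<Sum>j\<in>J. const_fract (W j i l) * G j)" for i l
    unfolding M_def G_def by (simp add: Phi_sum A_scale g Phi_scale)
  have key: "p ^ N * c i = q ^ N * (\<Sum>l\<le>e. M i l * c l)" if i: "i \<le> e" for i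
  proof -
    have deg: "zscale (int N) (w + u) + we = zscale (int N) w + (?Nu + we)"
      by (simp add: zscale_add_right ac_simps)
    have L: "p ^ N * c i \<in> A (zscale (int N) (w + u) + we)"
      using A_mult[OF A_power[OF pq(1)] c(1)[OF i]] .
    have Mc: "M i l * c l \<in> A (?Nu + we)" if "l \<le> e" for l using A_mult[OF M c(1)[OF that]] .
    have S: "(\<Sum>l\<le>e. M i l * c l) \<in> A (?Nu + we)" using Mc by (intro A_sum) auto
    have R: "q ^ N * (\<Sum>l\<le>e. M i l * c l) \<in> A (zscale (int N) (w + u) + we)"
      unfolding deg using A_mult[OF A_power[OF pq(2)] S] .
    have "\<Phi> (zscale (int N) (w + u) + we) (p ^ N * c i) = (z * \<Phi> w q) ^ N * (?t ^ i * \<Phi> w' b ^ e)"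
      using Phi_mult[OF A_power[OF pq(1)] c(1)[OF i], of N] by (simp add: Phi_power pq c(2)[OF i])
    also have "\<dots> = \<Phi> w q ^ N * ((?t ^ i * z ^ N) * \<Phi> w' b ^ e)" by (simp add: power_mult_distrib)
    also have "(?t ^ i * z ^ N) * \<Phi> w' b ^ e = (\<Sum>l\<le>e. (\<Sum>j\<in>J. const_fract (W j i l) * G j) * (?t ^ l * \<Phi> w' b ^ e))"
      unfolding W[OF i] by (subst sum.swap) (simp add: sum_distrib_right sum_distrib_left ac_simps)
    also have "\<dots> = (\<Sum>l\<le>e. \<Phi> (?Nu + we) (M i l * c l))"
      by (intro sum.cong refl) (simp add: Phi_mult[OF M c(1)] PhiM c(2))
    also have "\<dots> = \<Phi> (?Nu + we) (\<Sum>l\<le>e. M i l * c l)" 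
      using Phi_sum[of "{..e}" "\<lambda>l. M i l * c l" "?Nu + we"] Mc by simp
    also have "\<Phi> w q ^ N * \<dots> = \<Phi> (zscale (int N) (w + u) + we) (q ^ N * (\<Sum>l\<le>e. M i l * c l))"
      unfolding deg using Phi_mult[OF A_power[OF pq(2)] S, of N] by (simp add: Phi_power pq)
    finally show ?thesis by (rule Phi_inj[OF L R])
  qed
  define X where "X = to_fract p / to_fract q"
  have pw: "to_fract (x ^ n) = to_fract x ^ n" for x :: 'a and n by (induction n) auto
  have "X \<in> range to_fract"
  proof (rule integral_of_matrix_relation[OF ic N])
    fix i assume "i \<le> e"
    then have "to_fract (p ^ N * c i) = to_fract (q ^ N * (\<Sum>l\<le>e. M i l * c l))" using key by simp
    then show "X ^ N * to_fract (c i) = (\<Sum>l\<le>e. to_fract (M i l) * to_fract (c l))"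
      using pq(3) by (simp add: X_def power_divide pw field_simps)
  next
    show "\<exists>i\<le>e. c i \<noteq> 0" using ab(3) by (intro exI[of _ 0]) (simp add: c_def)
  qed
  then obtain f where "X = to_fract f" by auto
  then have "to_fract (f * q) = to_fract p" using pq(3) by (simp add: X_def field_simps)
  then have fq: "f * q = p" by (simp only: to_fract_eq_iff)
  have "part f v = 0" if "v \<noteq> u" for v
  proof -
    have "part f v * q = 0"
      using part_mult_homogeneous[OF pq(2), of f v] part_homogeneous[OF pq(1), of "v + w"] that
      by (simp add: fq add.commute)
    then show ?thesis using pq(3) by simp
  qed
  then have "support f \<subseteq> {u}" using support_iff by blast
  then have "f = part f u" using sum_parts_superset[of "{u}" f] by simp
  then have f: "f \<in> A u" using part_in by metis
  have "\<Phi> (w + u) (f * q) = \<Phi> u f * \<Phi> w q" using Phi_mult[OF f pq(2)] by (simp add: add.commute)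
  then have "\<Phi> u f = z" using pq(4) Phi_nz[OF pq(2,3)] by (simp add: fq)
  then show ?thesis using f by blast
qed

end

section \<open>The polyhedral coefficients\<close>

text \<open>
  The condition on \<open>z\<close> to be a section of the divisor in weight \<open>u\<close>, without minima and floors; at
  a point with an empty coefficient it imposes nothing.
\<close>

definition divisor_bound :: "('k P1 \<Rightarrow> ('m \<Rightarrow> rat) set) \<Rightarrow> 'm \<Rightarrow> 'k::field poly fract \<Rightarrow> bool" where
  "divisor_bound \<Delta> u z \<longleftrightarrow> (\<forall>x. \<forall>v\<in>\<Delta> x. - of_int (ord_at x z) \<le> v u)"

locale generated_algebra = embedded_algebra \<iota> A \<Phi>
  for \<iota> :: "'k::alg_closed_field \<Rightarrow> 'a::idom" and A :: "'m::ab_group_add \<Rightarrow> 'a set" and \<Phi> +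
  fixes H :: "'a set" and deg :: "'a \<Rightarrow> 'm" and B :: "'m set"
  assumes finH: "finite H" and H0: "0 \<notin> H" and Hdeg: "h \<in> H \<Longrightarrow> h \<in> A (deg h)"
    and gens: "subring_set hull (range \<iota> \<union> H) = UNIV" and B: "lattice_basis B"
    and normal: "integrally_closed TYPE('a)"
begin

definition gen_ord :: "'k P1 \<Rightarrow> 'a \<Rightarrow> int" where
  "gen_ord x h = ord_at x (\<Phi> (deg h) h)"

definition weight_cone :: "('m \<Rightarrow> rat) set" where
  "weight_cone = lower_bound_polyhedron H deg (\<lambda>_. 0)"

definition coefficient :: "'k P1 \<Rightarrow> ('m \<Rightarrow> rat) set" where
  "coefficient x = lower_bound_polyhedron H deg (gen_ord x)"

lemma coefficientD: "v \<in> coefficient x \<Longrightarrow> additive v" "v \<in> coefficient x \<Longrightarrow> h \<in> H \<Longrightarrow> - of_int (gen_ord x h) \<le> v (deg h)"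
  by (simp_all add: coefficient_def lower_bound_polyhedron_def NQ_def)

lemma weight_coneD: "v \<in> weight_cone \<Longrightarrow> additive v" "v \<in> weight_cone \<Longrightarrow> h \<in> H \<Longrightarrow> 0 \<le> v (deg h)"
  by (simp_all add: weight_cone_def lower_bound_polyhedron_def NQ_def)

lemma weight_coneI: "additive v \<Longrightarrow> (\<And>h. h \<in> H \<Longrightarrow> 0 \<le> v (deg h)) \<Longrightarrow> v \<in> weight_cone"
  by (simp add: weight_cone_def lower_bound_polyhedron_def NQ_def)

lemma coefficientI: "additive v \<Longrightarrow> (\<And>h. h \<in> H \<Longrightarrow> - of_int (gen_ord x h) \<le> v (deg h)) \<Longrightarrow> v \<in> coefficient x"
  by (simp add: coefficient_def lower_bound_polyhedron_def NQ_def)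

lemma H_nz: "h \<in> H \<Longrightarrow> h \<noteq> 0" using H0 by blast

lemma Phi_gen_nz: "h \<in> H \<Longrightarrow> \<Phi> (deg h) h \<noteq> 0"
  using Phi_nz[OF Hdeg H_nz] by blast

lemma zero_in_cone: "(\<lambda>_. 0) \<in> weight_cone"
  by (rule weight_coneI) (auto simp: additive_def)

lemma homogeneous_in_support: "f \<in> A u \<Longrightarrow> f \<noteq> 0 \<Longrightarrow> u \<in> support f"
  using part_homogeneous[of f u u] by (simp add: support_iff)

lemma degree_in_submonoid:
  assumes "0 \<in> S" "\<And>x y. x \<in> S \<Longrightarrow> y \<in> S \<Longrightarrow> x + y \<in> S" "\<And>h. h \<in> H \<Longrightarrow> deg h \<in> S"
    and "f \<in> A u" "f \<noteq> 0"
  shows "u \<in> S"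
proof -
  have HS: "\<exists>u\<in>S. h \<in> A u" if "h \<in> H" for h using assms(3)[OF that] Hdeg[OF that] by blast
  have "support f \<subseteq> S" by (rule support_in_submonoid[OF gens assms(1,2) HS])
  then show ?thesis using homogeneous_in_support[OF assms(4,5)] by blast
qed

lemma degree_in_dual_cone:
  assumes "f \<in> A u" "f \<noteq> 0" shows "u \<in> dual_cone_lattice weight_cone"
proof (rule degree_in_submonoid[OF _ _ _ assms])
  show "0 \<in> dual_cone_lattice weight_cone"
    by (auto simp: dual_cone_lattice_def additive.zero[OF weight_coneD(1)])
  show "x + y \<in> dual_cone_lattice weight_cone"
    if "x \<in> dual_cone_lattice weight_cone" "y \<in> dual_cone_lattice weight_cone" for x y
    using that by (auto simp: dual_cone_lattice_def additive.add[OF weight_coneD(1)])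
  show "deg h \<in> dual_cone_lattice weight_cone" if "h \<in> H" for h
    using weight_coneD(2)[OF _ that] by (simp add: dual_cone_lattice_def)
qed

lemma neg_of_int_le_iff: "- of_int n \<le> (r::rat) \<longleftrightarrow> - \<lfloor>r\<rfloor> \<le> n"
proof -
  have "- of_int n \<le> r \<longleftrightarrow> of_int (- n) \<le> r" by simp
  also have "\<dots> \<longleftrightarrow> - n \<le> \<lfloor>r\<rfloor>" by (rule le_floor_iff[symmetric])
  finally show ?thesis by linarith
qed

text \<open>
  A point \<open>v\<close> of the coefficient at \<open>x\<close> bounds the orders of the generators, and the bound is
  inherited by homogeneous parts of sums and products: orders and \<open>v\<close> are additive, and the order
  of a sum is at least the minimum.
\<close>

lemma homogeneous_bound:
  assumes f: "f \<in> A u" "f \<noteq> 0" shows "divisor_bound coefficient u (\<Phi> u f)"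
  unfolding divisor_bound_def
proof (intro allI ballI)
  fix x v assume v: "v \<in> coefficient x"
  note va = coefficientD(1)[OF v]
  define P where "P g \<longleftrightarrow> (\<forall>w. part g w \<noteq> 0 \<longrightarrow> - \<lfloor>v w\<rfloor> \<le> ord_at x (\<Phi> w (part g w)))" for g
  have hom: "P g" if "g \<in> A w" "g \<noteq> 0 \<Longrightarrow> - \<lfloor>v w\<rfloor> \<le> ord_at x (\<Phi> w g)" for g w
    using that part_homogeneous[OF that(1)] by (auto simp: P_def split: if_splits)
  have c: "P (\<iota> c)" for c
  proof (rule hom[OF iota_in_A])
    assume "\<iota> c \<noteq> 0"
    then show "- \<lfloor>v 0\<rfloor> \<le> ord_at x (\<Phi> 0 (\<iota> c))" by (simp add: Phi_iota additive.zero[OF va])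
  qed
  have "P f"
  proof (rule subring_hull_induct[OF gens, of P])
    show "P g" if g: "g \<in> range \<iota> \<union> H" for g
    proof (cases "g \<in> H")
      case True
      show ?thesis
        using coefficientD(2)[OF v True] by (intro hom[OF Hdeg[OF True]]) (simp add: neg_of_int_le_iff gen_ord_def)
    next
      case False
      then show ?thesis using g c by blast
    qed
    show "P 0" using c[of 0] by (simp add: iotaD)
    show "P 1" using c[of 1] by (simp add: iotaD)
    show "P (g - k)" if gk: "P g" "P k" for g k
      unfolding P_def
    proof (intro allI impI)
      fix w assume "part (g - k) w \<noteq> 0"
      then have nz: "\<Phi> w (part (g - k) w) \<noteq> 0" by (rule Phi_nz[OF part_in])
      have eq: "\<Phi> w (part (g - k) w) = \<Phi> w (part g w) + - \<Phi> w (part k w)"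
        by (simp add: part_diff Phi_diff part_in)
      show "- \<lfloor>v w\<rfloor> \<le> ord_at x (\<Phi> w (part (g - k) w))"
        unfolding eq
      proof (rule ord_at_add_ge)
        show "\<Phi> w (part g w) + - \<Phi> w (part k w) \<noteq> 0" using nz unfolding eq .
        show "- \<lfloor>v w\<rfloor> \<le> ord_at x (\<Phi> w (part g w))" if nz: "\<Phi> w (part g w) \<noteq> 0"
        proof -
          have "part g w \<noteq> 0" using nz by (metis Phi_0)
          then show ?thesis using gk(1) by (simp add: P_def)
        qed
        show "- \<lfloor>v w\<rfloor> \<le> ord_at x (- \<Phi> w (part k w))" if nz: "- \<Phi> w (part k w) \<noteq> 0"
        proof -
          have "part k w \<noteq> 0" using nz by (metis Phi_0 neg_equal_0_iff_equal)
          then show ?thesis using gk(2) by (simp add: P_def ord_at_uminus)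
        qed
      qed
    qed
    show "P (g * k)" if gk: "P g" "P k" for g k
      unfolding P_def
    proof (intro allI impI)
      fix w assume ne: "part (g * k) w \<noteq> 0"
      define T where "T = (\<lambda>(a, b). if a + b = w then part g a * part k b else 0)"
      have T: "T p \<in> A w" for p
        using A_mult[OF part_in part_in, of g "fst p" k "snd p"] by (auto simp: T_def split_beta A_0)
      have eq: "part (g * k) w = (\<Sum>p\<in>support g \<times> support k. T p)"
        unfolding T_def by (rule part_mult) auto
      have eq': "\<Phi> w (part (g * k) w) = (\<Sum>p\<in>support g \<times> support k. \<Phi> w (T p))"
        unfolding eq using T by (intro Phi_sum)
      show "- \<lfloor>v w\<rfloor> \<le> ord_at x (\<Phi> w (part (g * k) w))"
        unfolding eq'
      proof (rule ord_at_sum_ge)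
        show "(\<Sum>p\<in>support g \<times> support k. \<Phi> w (T p)) \<noteq> 0" using Phi_nz[OF part_in ne] unfolding eq' .
        fix p assume "p \<in> support g \<times> support k" and nz: "\<Phi> w (T p) \<noteq> 0"
        obtain a b where p: "p = (a, b)" by fastforce
        have ab: "a + b = w" using nz by (auto simp: T_def p split: if_splits)
        then have Tp: "\<Phi> w (T p) = \<Phi> a (part g a) * \<Phi> b (part k b)"
          using Phi_mult[OF part_in[of g a] part_in[of k b]] by (simp add: T_def p)
        then have nz': "\<Phi> a (part g a) \<noteq> 0" "\<Phi> b (part k b) \<noteq> 0" using nz by auto
        then have "part g a \<noteq> 0" "part k b \<noteq> 0" by auto
        then have "- \<lfloor>v a\<rfloor> \<le> ord_at x (\<Phi> a (part g a))" "- \<lfloor>v b\<rfloor> \<le> ord_at x (\<Phi> b (part k b))"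
          using gk by (auto simp: P_def)
        moreover have "\<lfloor>v a\<rfloor> + \<lfloor>v b\<rfloor> \<le> \<lfloor>v w\<rfloor>"
          using le_floor_add[of "v a" "v b"] additive.add[OF va, of a b] ab by simp
        ultimately show "- \<lfloor>v w\<rfloor> \<le> ord_at x (\<Phi> w (T p))"
          unfolding Tp ord_at_mult[OF nz'] by linarith
      qed
    qed
  qed
  then have "- \<lfloor>v u\<rfloor> \<le> ord_at x (\<Phi> u f)"
    using part_homogeneous[OF f(1), of u] f(2) unfolding P_def by metis
  then show "- of_int (ord_at x (\<Phi> u f)) \<le> v u" by (simp add: neg_of_int_le_iff)
qed

subsection \<open>Sections are homogeneous elements\<close>

definition monom_elt :: "('a \<Rightarrow> nat) \<Rightarrow> 'a" where
  "monom_elt c = (\<Prod>h\<in>H. h ^ c h)"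

lemma monom_elt_nz: "monom_elt c \<noteq> 0"
  using finH H_nz by (simp add: monom_elt_def)

lemma monom_elt_in: "monom_elt c \<in> A (\<Sum>h\<in>H. zscale (int (c h)) (deg h))"
  unfolding monom_elt_def by (rule A_prod_powers[OF finH Hdeg])

lemma ord_monom_elt:
  "ord_at x (\<Phi> (\<Sum>h\<in>H. zscale (int (c h)) (deg h)) (monom_elt c)) = (\<Sum>h\<in>H. int (c h) * gen_ord x h)"
proof -
  have "\<Phi> (\<Sum>h\<in>H. zscale (int (c h)) (deg h)) (monom_elt c) = (\<Prod>h\<in>H. \<Phi> (deg h) h ^ c h)"
    unfolding monom_elt_def by (rule Phi_prod_powers[OF finH Hdeg])
  then show ?thesis using Phi_gen_nz by (simp add: ord_at_prod ord_at_power gen_ord_def)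
qed

text \<open>
  If the coefficient has points and \<open>a\<close> is the minimum of \<open>v u\<close> over them, duality supplies a
  monomial of weight \<open>N u\<close> and order at most \<open>- N a\<close>. If the polyhedron is empty, there is a
  monomial of weight 0 and negative order, and its powers make the order as small as desired.
\<close>

lemma monomial_with_small_order:
  assumes u: "u \<in> dual_cone_lattice weight_cone" and bd: "\<And>v. v \<in> coefficient x \<Longrightarrow> - of_int n \<le> v u"
  shows "\<exists>N\<ge>1. \<exists>c. zscale (int N) u = (\<Sum>h\<in>H. zscale (int (c h)) (deg h)) \<and>
    (\<Sum>h\<in>H. int (c h) * gen_ord x h) \<le> int N * n"
proof (cases "coefficient x = {}")
  case False
  then obtain a N c where a: "\<exists>v\<in>coefficient x. v u = a" and N: "N \<ge> 1"
    "zscale (int N) u = (\<Sum>h\<in>H. zscale (int (c h)) (deg h))"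
    "of_int (\<Sum>h\<in>H. int (c h) * gen_ord x h) \<le> - of_nat N * a"
    using polyhedron_minimum[OF B finH, of deg "gen_ord x" u] u unfolding coefficient_def weight_cone_def by blast
  have "- of_int n \<le> a" using a bd by blast
  then have "of_nat N * (- of_int n) \<le> of_nat N * a" by (rule mult_left_mono) simp
  then have "of_int (\<Sum>h\<in>H. int (c h) * gen_ord x h) \<le> rat_of_int (int N * n)" using N(3) by simp
  then have "(\<Sum>h\<in>H. int (c h) * gen_ord x h) \<le> int N * n" by (simp only: of_int_le_iff)
  then show ?thesis using N by blast
next
  case True
  obtain c0 where c0: "(\<Sum>h\<in>H. zscale (int (c0 h)) (deg h)) = 0" "(\<Sum>h\<in>H. int (c0 h) * gen_ord x h) < 0"
    using empty_polyhedron_certificate[OF B finH, of deg "gen_ord x"] True unfolding coefficient_def by blast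
  obtain N c where N: "N \<ge> 1" "zscale (int N) u = (\<Sum>h\<in>H. zscale (int (c h)) (deg h))"
    using combination_in_dual_cone[OF B finH, of u deg] u unfolding weight_cone_def by blast
  define s where "s = (\<Sum>h\<in>H. int (c h) * gen_ord x h)"
  define s0 where "s0 = (\<Sum>h\<in>H. int (c0 h) * gen_ord x h)"
  define k where "k = nat (s - int N * n)"
  define c' where "c' h = c h + k * c0 h" for h
  have "(\<Sum>h\<in>H. zscale (int (c' h)) (deg h)) = zscale (int N) u + zscale (int k) (\<Sum>h\<in>H. zscale (int (c0 h)) (deg h))"
    unfolding N(2) zmod.scale_sum_right by (simp add: c'_def zscale_add_left sum.distrib zscale_zscale)
  then have 1: "zscale (int N) u = (\<Sum>h\<in>H. zscale (int (c' h)) (deg h))" using c0(1) by simp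
  have "(\<Sum>h\<in>H. int (c' h) * gen_ord x h) = s + int k * s0"
    by (simp add: c'_def s_def s0_def algebra_simps sum.distrib sum_distrib_left)
  moreover have "int k * s0 \<le> int k * (- 1)" using c0(2) unfolding s0_def by (intro mult_left_mono) auto
  moreover have "s - int k \<le> int N * n" by (simp add: k_def)
  ultimately have "(\<Sum>h\<in>H. int (c' h) * gen_ord x h) \<le> int N * n" by linarith
  then show ?thesis using N(1) 1 by blast
qed

text \<open>
  For every \<open>x \<in> S\<close> take a monomial that satisfies the order bound at \<open>x\<close>. Their weights are
  multiples \<open>NN x \<cdot> u\<close> of \<open>u\<close>; suitable powers bring them to the common multiple \<open>N\<close>. Outside \<open>S\<close>
  all monomials have order 0 and \<open>z\<close> is regular, so \<open>integral_homogeneous_element\<close> applies.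
\<close>

theorem section_is_homogeneous_element:
  assumes u: "u \<in> dual_cone_lattice weight_cone" and z: "z \<noteq> 0" and bd: "divisor_bound coefficient u z"
    and S: "finite S" "S \<noteq> {}" "\<And>x h. x \<notin> S \<Longrightarrow> h \<in> H \<Longrightarrow> gen_ord x h = 0"
  shows "\<exists>f\<in>A u. \<Phi> u f = z"
proof -
  have "\<forall>x. \<exists>N c. N \<ge> 1 \<and> zscale (int N) u = (\<Sum>h\<in>H. zscale (int (c h)) (deg h)) \<and>
    (\<Sum>h\<in>H. int (c h) * gen_ord x h) \<le> int N * ord_at x z"
    using monomial_with_small_order[OF u] bd unfolding divisor_bound_def by blast
  from choice[OF this] obtain NN where "\<forall>x. \<exists>c. NN x \<ge> (1::nat) \<and> zscale (int (NN x)) u = (\<Sum>h\<in>H. zscale (int (c h)) (deg h)) \<and>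
    (\<Sum>h\<in>H. int (c h) * gen_ord x h) \<le> int (NN x) * ord_at x z" ..
  from choice[OF this] obtain cc where "\<forall>x. NN x \<ge> (1::nat) \<and> zscale (int (NN x)) u = (\<Sum>h\<in>H. zscale (int (cc x h)) (deg h)) \<and>
    (\<Sum>h\<in>H. int (cc x h) * gen_ord x h) \<le> int (NN x) * ord_at x z" ..
  then have NN: "\<And>x. NN x \<ge> 1" "\<And>x. zscale (int (NN x)) u = (\<Sum>h\<in>H. zscale (int (cc x h)) (deg h))"
    "\<And>x. (\<Sum>h\<in>H. int (cc x h) * gen_ord x h) \<le> int (NN x) * ord_at x z"
    by simp_all
  define N where "N = (\<Prod>x\<in>S. NN x)"
  define M where "M x = (\<Prod>y\<in>S - {x}. NN y)" for x
  have N1: "N \<ge> 1" unfolding N_def using NN(1) by (metis One_nat_def Suc_le_eq prod_pos)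
  have NM: "N = M x * NN x" if "x \<in> S" for x
    unfolding N_def M_def using prod.remove[OF S(1) that, of NN] by (simp add: mult.commute)
  define g where "g x = monom_elt (\<lambda>h. M x * cc x h)" for x
  have deg: "zscale (int N) u = (\<Sum>h\<in>H. zscale (int (M x * cc x h)) (deg h))" if "x \<in> S" for x
  proof -
    have "zscale (int N) u = zscale (int (M x)) (zscale (int (NN x)) u)" using NM[OF that] by (simp add: zscale_zscale)
    also have "\<dots> = (\<Sum>h\<in>H. zscale (int (M x * cc x h)) (deg h))"
      unfolding NN(2) zmod.scale_sum_right by (simp add: zscale_zscale)
    finally show ?thesis .
  qed
  have ord: "ord_at y (\<Phi> (zscale (int N) u) (g x)) = int (M x) * (\<Sum>h\<in>H. int (cc x h) * gen_ord y h)" if "x \<in> S" for x y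
    unfolding deg[OF that] g_def ord_monom_elt by (simp add: sum_distrib_left mult.assoc)
  show ?thesis
  proof (rule integral_homogeneous_element[OF normal N1 z S(1,2)])
    show "g x \<in> A (zscale (int N) u)" if "x \<in> S" for x unfolding deg[OF that] g_def by (rule monom_elt_in)
    show "g x \<noteq> 0" for x unfolding g_def by (rule monom_elt_nz)
    fix y show "\<exists>x\<in>S. ord_at y (\<Phi> (zscale (int N) u) (g x)) \<le> int N * ord_at y z"
    proof (cases "y \<in> S")
      case True
      have "int (M y) * (\<Sum>h\<in>H. int (cc y h) * gen_ord y h) \<le> int (M y) * (int (NN y) * ord_at y z)"
        by (rule mult_left_mono[OF NN(3)]) simp
      then show ?thesis using ord[OF True] NM[OF True] True by (intro bexI[of _ y]) (simp_all add: mult.assoc)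
    next
      case False
      obtain x where x: "x \<in> S" using S(2) by blast
      have "(\<lambda>_. 0) \<in> coefficient y"
        by (rule coefficientI) (auto simp: additive_def S(3)[OF False])
      then have "0 \<le> ord_at y z" using bd by (force simp: divisor_bound_def)
      then show ?thesis using x ord[OF x, of y] S(3)[OF False] by (intro bexI[of _ x]) simp_all
    qed
  qed
qed

end

section \<open>The coordinate ring of the polyhedral divisor\<close>

lemma floor_coeff_eq:
  assumes "v0 \<in> \<Delta>" "v0 u = a" "\<And>v. v \<in> \<Delta> \<Longrightarrow> a \<le> v u"
  shows "floor_coeff \<Delta> u = Fin \<lfloor>a\<rfloor>"
proof -
  have "(LEAST a. a \<in> (\<lambda>v. v u) ` \<Delta>) = a"
    using assms by (intro Least_equality) auto
  then show ?thesis using assms(1) by (auto simp: floor_coeff_def)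
qed

lemma divisor_at_point:
  assumes "inj_on P {..m}" "j \<le> m"
  shows "divisor_at m P \<Delta> u (P j) = floor_coeff (\<Delta> j) u"
proof -
  have "divisor_at m P \<Delta> u (P j) = (\<Sum>i\<le>m. if i = j then floor_coeff (\<Delta> i) u else 0)"
    unfolding divisor_at_def using assms by (intro sum.cong) (auto simp: inj_on_def)
  then show ?thesis using assms(2) by simp
qed

lemma divisor_at_other:
  assumes "x \<notin> P ` {..m}" shows "divisor_at m P \<Delta> u x = 0"
  unfolding divisor_at_def by (intro sum.neutral) (use assms in auto)

context graded_algebra
begin

definition realize :: "('m \<Rightarrow> 'a \<Rightarrow> 'k poly fract) \<Rightarrow> 'a \<Rightarrow> ('m \<Rightarrow>\<^sub>0 'k poly fract)" where
  "realize \<Phi> f = (\<Sum>u\<in>support f. Poly_Mapping.single u (\<Phi> u (part f u)))"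

end

context embedded_algebra
begin

lemma lookup_realize: "Poly_Mapping.lookup (realize \<Phi> f) u = \<Phi> u (part f u)"
proof -
  have "Poly_Mapping.lookup (realize \<Phi> f) u = (\<Sum>w\<in>support f. if w = u then \<Phi> w (part f w) else 0)"
    unfolding realize_def lookup_sum by (intro sum.cong) (auto simp: lookup_single)
  then show ?thesis by (auto simp: support_iff)
qed

lemma realize_homogeneous: "f \<in> A u \<Longrightarrow> realize \<Phi> f = Poly_Mapping.single u (\<Phi> u f)"
  by (rule poly_mapping_eqI) (auto simp: lookup_realize part_homogeneous lookup_single)

lemma realize_add: "realize \<Phi> (f + g) = realize \<Phi> f + realize \<Phi> g"
  by (rule poly_mapping_eqI) (simp add: lookup_realize lookup_add part_add Phi_add part_in)

lemma realize_0: "realize \<Phi> 0 = 0"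
  by (rule poly_mapping_eqI) (simp add: lookup_realize)

lemma realize_sum: "realize \<Phi> (\<Sum>i\<in>I. f i) = (\<Sum>i\<in>I. realize \<Phi> (f i))"
  by (induction I rule: infinite_finite_induct) (auto simp: realize_add realize_0)

lemma realize_mult: "realize \<Phi> (f * g) = realize \<Phi> f * realize \<Phi> g"
proof -
  have "f * g = (\<Sum>u\<in>support f. part f u) * (\<Sum>w\<in>support g. part g w)" by (simp add: sum_parts)
  then have "f * g = (\<Sum>u\<in>support f. \<Sum>w\<in>support g. part f u * part g w)" by (simp add: sum_product)
  then have "realize \<Phi> (f * g) = (\<Sum>u\<in>support f. \<Sum>w\<in>support g. realize \<Phi> (part f u * part g w))"
    by (simp only: realize_sum)
  also have "\<dots> = (\<Sum>u\<in>support f. \<Sum>w\<in>support g.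
      Poly_Mapping.single u (\<Phi> u (part f u)) * Poly_Mapping.single w (\<Phi> w (part g w)))"
    by (intro sum.cong refl)
       (simp add: realize_homogeneous[OF A_mult[OF part_in part_in]] mult_single Phi_mult[OF part_in part_in])
  also have "\<dots> = realize \<Phi> f * realize \<Phi> g" by (simp add: realize_def sum_product)
  finally show ?thesis .
qed

lemma realize_inj: "realize \<Phi> f = realize \<Phi> g \<Longrightarrow> f = g"
proof -
  assume eq: "realize \<Phi> f = realize \<Phi> g"
  have "part f u = part g u" for u
    using eq lookup_realize[of f u] lookup_realize[of g u] by (intro Phi_inj[OF part_in part_in]) simp
  then have "part (f - g) u = 0" for u by (simp add: part_diff)
  then have "f - g = 0" using eq_0_iff_parts by blast
  then show ?thesis by simp
qed

lemma realize_iota: "realize \<Phi> (\<iota> c) = Poly_Mapping.single 0 (const_fract c)"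
  using realize_homogeneous[OF iota_in_A] by (simp add: Phi_iota)

end

text \<open>
  The marked points contain all points at which some generator has a zero or a pole; at the others
  the coefficient is the tailcone.
\<close>

locale divisor_model = generated_algebra \<iota> A \<Phi> H deg B
  for \<iota> :: "'k::alg_closed_field \<Rightarrow> 'a::idom" and A :: "'m::ab_group_add \<Rightarrow> 'a set" and \<Phi> and H deg B +
  fixes m :: nat and P :: "nat \<Rightarrow> 'k P1"
  assumes m1: "1 \<le> m" and P_inj: "inj_on P {..m}"
    and P_support: "x \<notin> P ` {..m} \<Longrightarrow> h \<in> H \<Longrightarrow> gen_ord x h = 0"
begin

abbreviation "\<Delta> i \<equiv> coefficient (P i)"

lemma coefficient_other: "x \<notin> P ` {..m} \<Longrightarrow> coefficient x = weight_cone"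
  unfolding coefficient_def weight_cone_def lower_bound_polyhedron_def using P_support by auto

text \<open>
  The weights that occur generate \<open>M\<close>; so \<open>weight_cone\<close> contains no line.
\<close>

lemma weight_cone_vanishing:
  assumes v: "additive v" "\<And>h. h \<in> H \<Longrightarrow> v (deg h) = (0::rat)" shows "v = (\<lambda>_. 0)"
proof
  fix x
  have z: "v u = 0" if "f \<in> A u" "f \<noteq> 0" for f u
    using degree_in_submonoid[of "{u. v u = 0}" f u] that additive.zero[OF v(1)] additive.add[OF v(1)] v(2) by simp
  obtain u w a b where "a \<in> A u" "b \<in> A w" "a \<noteq> 0" "b \<noteq> 0" "x = u - w" using weights by blast
  then show "v x = 0" using z additive.diff[OF v(1), of u w] by simp
qed

text \<open>
  For the harder inclusion, a direction that is negative on some \<open>deg h\<close> leaves the polyhedron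
  after finitely many steps.
\<close>

lemma tailcone_coefficient:
  assumes "coefficient x \<noteq> {}" shows "tailcone (coefficient x) = weight_cone"
proof
  show "weight_cone \<subseteq> tailcone (coefficient x)"
  proof
    fix v assume v: "v \<in> weight_cone"
    have "(\<lambda>u. w u + v u) \<in> coefficient x" if w: "w \<in> coefficient x" for w
    proof (rule coefficientI)
      show "additive (\<lambda>u. w u + v u)"
        using coefficientD(1)[OF w] weight_coneD(1)[OF v] by (simp add: additive_def)
      show "- of_int (gen_ord x h) \<le> w (deg h) + v (deg h)" if "h \<in> H" for h
        using coefficientD(2)[OF w that] weight_coneD(2)[OF v that] by linarith
    qed
    then show "v \<in> tailcone (coefficient x)" using weight_coneD(1)[OF v] by (simp add: tailcone_def NQ_def)
  qed
  show "tailcone (coefficient x) \<subseteq> weight_cone"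
  proof
    fix v assume v: "v \<in> tailcone (coefficient x)"
    obtain w where w: "w \<in> coefficient x" using assms by blast
    have step: "(\<lambda>u. w u + of_nat n * v u) \<in> coefficient x" for n
    proof (induction n)
      case (Suc n)
      then have "(\<lambda>u. (w u + of_nat n * v u) + v u) \<in> coefficient x" using v by (simp add: tailcone_def)
      then show ?case by (simp add: algebra_simps)
    qed (use w in simp)
    show "v \<in> weight_cone"
    proof (rule weight_coneI)
      show "additive v" using v by (simp add: tailcone_def NQ_def)
      show "0 \<le> v (deg h)" if h: "h \<in> H" for h
      proof (rule ccontr)
        assume "\<not> 0 \<le> v (deg h)"
        then have neg: "0 < - v (deg h)" by simp
        obtain n where n: "w (deg h) + of_int (gen_ord x h) < of_nat n * (- v (deg h))"
          using ex_less_of_nat_mult[OF neg] by blast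
        then show False using coefficientD(2)[OF step h, of n] by simp
      qed
    qed
  qed
qed

text \<open>
  The sum of the coefficients lies in \<open>weight_cone\<close> because the divisor of each generator has
  degree 0. It does not contain 0: if \<open>0 = \<Sum>i. w i\<close> with \<open>w i\<close> in the \<open>i\<close>-th coefficient, then in
  weight \<open>u\<close> the numbers \<open>w i u\<close> bounding the negated orders at the marked points add up to 0,
  while the negated orders themselves have a nonnegative sum; so the bounds are attained, and all
  nonzero elements of a weight space have the same divisor. But \<open>t\<close> is a quotient of two such
  elements.
\<close>

lemma polyhedral_divisor_model: "polyhedral_divisor weight_cone m P (\<lambda>i. \<Delta> i)"
  unfolding polyhedral_divisor_def
proof (intro conjI allI impI)
  show "1 \<le> m" "inj_on P {..m}" by (fact m1 P_inj)+
  show "polyhedral_cone weight_cone"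
    unfolding polyhedral_cone_def weight_cone_def lower_bound_polyhedron_def
    by (rule exI[of _ "deg ` H"]) (use finH in auto)
  show "pointed_cone weight_cone"
    unfolding pointed_cone_def
  proof
    show "{\<lambda>_. 0} \<subseteq> {v \<in> weight_cone. (\<lambda>u. - v u) \<in> weight_cone}" using zero_in_cone by simp
    show "{v \<in> weight_cone. (\<lambda>u. - v u) \<in> weight_cone} \<subseteq> {\<lambda>_. 0}"
    proof
      fix v assume "v \<in> {v \<in> weight_cone. (\<lambda>u. - v u) \<in> weight_cone}"
      then have v: "v \<in> weight_cone" "(\<lambda>u. - v u) \<in> weight_cone" by auto
      have "v = (\<lambda>_. 0)"
      proof (rule weight_cone_vanishing[OF weight_coneD(1)[OF v(1)]])
        fix h assume "h \<in> H"
        then show "v (deg h) = 0" using weight_coneD(2)[OF v(1)] weight_coneD(2)[OF v(2)] by fastforce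
      qed
      then show "v \<in> {\<lambda>_. 0}" by simp
    qed
  qed
  show "\<Delta> i = {} \<or> polyhedron (\<Delta> i) \<and> tailcone (\<Delta> i) = weight_cone" for i
  proof -
    have "polyhedron (\<Delta> i)"
      unfolding polyhedron_def coefficient_def lower_bound_polyhedron_def
      by (rule exI[of _ "(\<lambda>h. (deg h, - of_int (gen_ord (P i) h))) ` H"]) (use finH in auto)
    then show ?thesis using tailcone_coefficient[of "P i"] by blast
  qed
  show "minkowski_sum m (\<lambda>i. \<Delta> i) \<subset> weight_cone"
  proof
    have zero_sum: "(\<Sum>i\<le>m. gen_ord (P i) h) = 0" if h: "h \<in> H" for h
    proof -
      have "(\<Sum>i\<le>m. gen_ord (P i) h) = (\<Sum>x\<in>P ` {..m}. ord_at x (\<Phi> (deg h) h))"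
        using P_inj by (simp add: sum.reindex gen_ord_def)
      also have "\<dots> = 0"
        by (rule degree_principal_divisor[OF Phi_gen_nz[OF h]]) (use P_support[OF _ h] in \<open>auto simp: gen_ord_def\<close>)
      finally show ?thesis .
    qed
    show "minkowski_sum m (\<lambda>i. \<Delta> i) \<subseteq> weight_cone"
    proof
      fix v assume "v \<in> minkowski_sum m (\<lambda>i. \<Delta> i)"
      then obtain w where w: "v = (\<lambda>u. \<Sum>i\<le>m. w i u)" "\<And>i. i \<le> m \<Longrightarrow> w i \<in> \<Delta> i"
        unfolding minkowski_sum_def by blast
      show "v \<in> weight_cone"
      proof (rule weight_coneI)
        show "additive v" unfolding w(1) additive_def
          using additive.add[OF coefficientD(1)[OF w(2)]] by (simp add: sum.distrib)
        fix h assume h: "h \<in> H"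
        have "(\<Sum>i\<le>m. - rat_of_int (gen_ord (P i) h)) \<le> v (deg h)"
          unfolding w(1) using coefficientD(2)[OF w(2) h] by (intro sum_mono) auto
        moreover have "(\<Sum>i\<le>m. - rat_of_int (gen_ord (P i) h)) = - of_int (\<Sum>i\<le>m. gen_ord (P i) h)"
          by (simp add: sum_negf)
        ultimately show "0 \<le> v (deg h)" using zero_sum[OF h] by simp
      qed
    qed
    have "(\<lambda>_. 0) \<notin> minkowski_sum m (\<lambda>i. \<Delta> i)"
    proof
      assume "(\<lambda>_. 0) \<in> minkowski_sum m (\<lambda>i. \<Delta> i)"
      then obtain w where w: "(\<lambda>_. 0) = (\<lambda>u. \<Sum>i\<le>m. w i u)" "\<And>i. i \<le> m \<Longrightarrow> w i \<in> \<Delta> i"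
        unfolding minkowski_sum_def by blast
      obtain u a b where ab: "a \<in> A u" "b \<in> A u" "b \<noteq> 0" "\<Phi> u a = to_fract [:0, 1:] * \<Phi> u b" using Phi_quotient by blast
      have a0: "a \<noteq> 0" using ab(4) Phi_nz[OF ab(2,3)] by auto
      have exact: "rat_of_int (ord_at (P i) (\<Phi> u f)) = - w i u" if f: "f \<in> A u" "f \<noteq> 0" and i: "i \<le> m" for f i
      proof -
        have bd: "divisor_bound coefficient u (\<Phi> u f)" by (rule homogeneous_bound[OF f])
        have ge: "- rat_of_int (ord_at (P i) (\<Phi> u f)) \<le> w i u" if "i \<le> m" for i
          using bd w(2)[OF that] by (simp add: divisor_bound_def)
        have out: "0 \<le> ord_at x (\<Phi> u f)" if "x \<notin> P ` {..m}" for x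
          using bd zero_in_cone coefficient_other[OF that] by (force simp: divisor_bound_def)
        have "(\<Sum>i\<le>m. ord_at (P i) (\<Phi> u f)) = (\<Sum>x\<in>P ` {..m}. ord_at x (\<Phi> u f))"
          using P_inj by (simp add: sum.reindex)
        also have "\<dots> \<le> 0" by (rule sum_ord_le_0[OF Phi_nz[OF f]]) (use out in auto)
        finally have "rat_of_int (\<Sum>i\<le>m. ord_at (P i) (\<Phi> u f)) \<le> 0" by (simp only: of_int_le_0_iff)
        moreover have "(\<Sum>i\<le>m. w i u) = 0" using fun_cong[OF w(1), of u] by simp
        ultimately have s: "(\<Sum>i\<le>m. w i u + rat_of_int (ord_at (P i) (\<Phi> u f))) \<le> 0" by (simp add: sum.distrib)
        have nn: "0 \<le> w i u + rat_of_int (ord_at (P i) (\<Phi> u f))" if "i \<le> m" for i using ge[OF that] by linarith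
        have "(\<Sum>i\<le>m. w i u + rat_of_int (ord_at (P i) (\<Phi> u f))) = 0"
          using s nn by (intro antisym sum_nonneg) auto
        then have "w i u + rat_of_int (ord_at (P i) (\<Phi> u f)) = 0"
          using nn i by (subst (asm) sum_nonneg_eq_0_iff) auto
        then show ?thesis by linarith
      qed
      have out: "ord_at x (\<Phi> u f) = 0" if f: "f \<in> A u" "f \<noteq> 0" and x: "x \<notin> P ` {..m}" for f x
      proof -
        have bd: "divisor_bound coefficient u (\<Phi> u f)" by (rule homogeneous_bound[OF f])
        have nn: "0 \<le> ord_at y (\<Phi> u f)" if "y \<notin> P ` {..m}" for y
          using bd zero_in_cone coefficient_other[OF that] by (force simp: divisor_bound_def)
        have "rat_of_int (\<Sum>i\<le>m. ord_at (P i) (\<Phi> u f)) = - (\<Sum>i\<le>m. w i u)"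
          using exact[OF f] by (simp add: sum_negf)
        also have "\<dots> = 0" using fun_cong[OF w(1), of u] by simp
        finally have 0: "(\<Sum>i\<le>m. ord_at (P i) (\<Phi> u f)) = 0" by (simp only: of_int_eq_0_iff)
        have "(\<Sum>y\<in>insert x (P ` {..m}). ord_at y (\<Phi> u f)) \<le> 0"
          by (rule sum_ord_le_0[OF Phi_nz[OF f]]) (use nn in auto)
        then have "ord_at x (\<Phi> u f) + (\<Sum>i\<le>m. ord_at (P i) (\<Phi> u f)) \<le> 0"
          using x P_inj by (simp add: sum.reindex)
        then show ?thesis using 0 nn[OF x] by simp
      qed
      have eq: "ord_at x (\<Phi> u a) = ord_at x (\<Phi> u b)" for x
      proof (cases "x \<in> P ` {..m}")
        case True
        then obtain i where "i \<le> m" "x = P i" by auto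
        then have "rat_of_int (ord_at x (\<Phi> u a)) = of_int (ord_at x (\<Phi> u b))"
          using exact[OF ab(1) a0] exact[OF ab(2,3)] by simp
        then show ?thesis by (simp only: of_int_eq_iff)
      qed (simp add: out[OF ab(1) a0] out[OF ab(2,3)])
      have t0: "to_fract [:0, 1:] \<noteq> (0 :: 'k poly fract)" by simp
      have "ord_at (Some 0) (to_fract [:0, 1:] :: 'k poly fract) = 0"
        using eq[of "Some 0"] ord_at_mult[OF t0 Phi_nz[OF ab(2,3)], of "Some 0"] ab(4) by simp
      moreover have "ord_at (Some 0) (to_fract [:0, 1:] :: 'k poly fract) = 1"
        using poly_ord_linear[of "Some (0::'k)" 0] by (simp add: ord_at_to_fract)
      ultimately show False by simp
    qed
    then show "minkowski_sum m (\<lambda>i. \<Delta> i) \<noteq> weight_cone" using zero_in_cone by blast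
  qed
qed

text \<open>
  Since orders are integral, rounding down the minimum of \<open>v u\<close> over the coefficient loses
  nothing.
\<close>

lemma H0_iff:
  assumes u: "u \<in> dual_cone_lattice weight_cone" and z: "z \<noteq> 0"
  shows "z \<in> H0_P1 (divisor_at m P (\<lambda>i. \<Delta> i) u) \<longleftrightarrow> divisor_bound coefficient u z"
proof -
  have "0 \<le> Fin (ord_at x z) + divisor_at m P (\<lambda>i. \<Delta> i) u x \<longleftrightarrow> (\<forall>v\<in>coefficient x. - of_int (ord_at x z) \<le> v u)" for x
  proof (cases "x \<in> P ` {..m}")
    case True
    then obtain j where j: "j \<le> m" "x = P j" by auto
    have D: "divisor_at m P (\<lambda>i. \<Delta> i) u x = floor_coeff (coefficient x) u"
      using divisor_at_point[OF P_inj j(1)] j(2) by simp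
    show ?thesis
    proof (cases "coefficient x = {}")
      case True
      then show ?thesis unfolding D by (simp add: floor_coeff_def zero_extended_def)
    next
      case False
      then obtain a v0 where a: "v0 \<in> coefficient x" "v0 u = a" "\<forall>v\<in>coefficient x. a \<le> v u"
        using polyhedron_minimum[OF B finH, of deg "gen_ord x" u] u unfolding coefficient_def weight_cone_def by blast
      have "floor_coeff (coefficient x) u = Fin \<lfloor>a\<rfloor>" using a(3) by (intro floor_coeff_eq[OF a(1,2)]) blast
      then have "0 \<le> Fin (ord_at x z) + divisor_at m P (\<lambda>i. \<Delta> i) u x \<longleftrightarrow> - \<lfloor>a\<rfloor> \<le> ord_at x z"
        unfolding D by (auto simp: zero_extended_def)
      also have "\<dots> \<longleftrightarrow> - of_int (ord_at x z) \<le> a" by (simp only: neg_of_int_le_iff)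
      also have "\<dots> \<longleftrightarrow> (\<forall>v\<in>coefficient x. - of_int (ord_at x z) \<le> v u)" using a by force
      finally show ?thesis .
    qed
  next
    case False
    then have D: "divisor_at m P (\<lambda>i. \<Delta> i) u x = 0" by (rule divisor_at_other)
    have "(\<forall>v\<in>weight_cone. - of_int (ord_at x z) \<le> v u) \<longleftrightarrow> 0 \<le> ord_at x z"
    proof
      assume "\<forall>v\<in>weight_cone. - of_int (ord_at x z) \<le> v u"
      then show "0 \<le> ord_at x z" using zero_in_cone by force
    next
      assume *: "0 \<le> ord_at x z"
      show "\<forall>v\<in>weight_cone. - of_int (ord_at x z) \<le> v u"
      proof
        fix v assume "v \<in> weight_cone"
        then have "0 \<le> v u" using u by (auto simp: dual_cone_lattice_def)
        then show "- of_int (ord_at x z) \<le> v u" using * by (meson neg_le_0_iff_le of_int_0_le_iff order_trans)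
      qed
    qed
    then show ?thesis unfolding D coefficient_other[OF False] by (simp add: zero_extended_def)
  qed
  then show ?thesis using z by (simp add: H0_P1_def divisor_bound_def)
qed

lemma section_realized:
  assumes "u \<in> dual_cone_lattice weight_cone" "z \<noteq> 0" "divisor_bound coefficient u z"
  shows "\<exists>f\<in>A u. \<Phi> u f = z"
  by (rule section_is_homogeneous_element[OF assms, of "P ` {..m}"]) (use P_support in auto)

abbreviation "R_model \<equiv> coordinate_ring weight_cone m P (\<lambda>i. \<Delta> i)"

lemma realize_in_model: "realize \<Phi> f \<in> R_model"
  unfolding coordinate_ring_def
proof (intro CollectI ballI)
  fix u assume "u \<in> Poly_Mapping.keys (realize \<Phi> f)"
  then have nz: "\<Phi> u (part f u) \<noteq> 0" by (simp add: in_keys_iff lookup_realize)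
  then have p: "part f u \<noteq> 0" by (metis Phi_0)
  have u: "u \<in> dual_cone_lattice weight_cone" by (rule degree_in_dual_cone[OF part_in p])
  have "\<Phi> u (part f u) \<in> H0_P1 (divisor_at m P (\<lambda>i. \<Delta> i) u)"
    using H0_iff[OF u nz] homogeneous_bound[OF part_in p] by blast
  then show "u \<in> dual_cone_lattice weight_cone \<and> Poly_Mapping.lookup (realize \<Phi> f) u \<in> H0_P1 (divisor_at m P (\<lambda>i. \<Delta> i) u)"
    using u by (simp add: lookup_realize)
qed

lemma model_realized:
  assumes F: "F \<in> R_model" shows "\<exists>f. realize \<Phi> f = F"
proof -
  have "\<forall>u\<in>Poly_Mapping.keys F. \<exists>f. f \<in> A u \<and> \<Phi> u f = Poly_Mapping.lookup F u"
  proof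
    fix u assume k: "u \<in> Poly_Mapping.keys F"
    then have nz: "Poly_Mapping.lookup F u \<noteq> 0" by (simp add: in_keys_iff)
    have u: "u \<in> dual_cone_lattice weight_cone" "Poly_Mapping.lookup F u \<in> H0_P1 (divisor_at m P (\<lambda>i. \<Delta> i) u)"
      using F k unfolding coordinate_ring_def by blast+
    then show "\<exists>f. f \<in> A u \<and> \<Phi> u f = Poly_Mapping.lookup F u"
      using section_realized[OF u(1) nz] H0_iff[OF u(1) nz] by blast
  qed
  from bchoice[OF this] obtain g where g: "\<And>u. u \<in> Poly_Mapping.keys F \<Longrightarrow> g u \<in> A u \<and> \<Phi> u (g u) = Poly_Mapping.lookup F u" by blast
  have "realize \<Phi> (\<Sum>u\<in>Poly_Mapping.keys F. g u) = (\<Sum>u\<in>Poly_Mapping.keys F. Poly_Mapping.single u (Poly_Mapping.lookup F u))"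
    unfolding realize_sum
  proof (intro sum.cong refl)
    fix u assume "u \<in> Poly_Mapping.keys F"
    then show "realize \<Phi> (g u) = Poly_Mapping.single u (Poly_Mapping.lookup F u)"
      using g realize_homogeneous by metis
  qed
  then show ?thesis unfolding poly_mapping_sum_singles by blast
qed

lemma equivariant_iso_model: "equivariant_iso \<iota> A R_model (realize \<Phi>)"
  unfolding equivariant_iso_def
proof (intro conjI allI ballI)
  show "bij_betw (realize \<Phi>) UNIV R_model"
    unfolding bij_betw_def
  proof
    show "inj (realize \<Phi>)" by (rule injI) (rule realize_inj)
    show "range (realize \<Phi>) = R_model" using realize_in_model model_realized by blast
  qed
  show "Poly_Mapping.keys (realize \<Phi> f) \<subseteq> {u}" if "f \<in> A u" for u f
    using that by (simp add: realize_homogeneous)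
qed (fact realize_add realize_mult realize_iota)+

end

section \<open>Khovanskii bases\<close>

subsection \<open>The valuation and the order at a point\<close>

context embedded_algebra
begin

text \<open>
  Every element of \<open>K(t)\<close> is a quotient of homogeneous elements of equal weight, so \<open>v\<close> induces a
  valuation of \<open>K(t)\<close>, and \<open>valuation_of_function_field\<close> supplies the point \<open>x\<close>.
\<close>

theorem valuation_is_order_at_point:
  fixes v :: "'a \<Rightarrow> 'g::linordered_ab_group_add"
  assumes v: "valuation \<iota> v"
  shows "\<exists>x. \<forall>u f g. f \<in> A u \<longrightarrow> g \<in> A u \<longrightarrow> f \<noteq> 0 \<longrightarrow> g \<noteq> 0 \<longrightarrow>
    ord_at x (\<Phi> u f) = ord_at x (\<Phi> u g) \<longrightarrow> v f = v g"
proof -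
  note vD = valuationD[OF v]
  define Q where "Q z \<gamma> \<longleftrightarrow> (\<exists>u a b. a \<in> A u \<and> b \<in> A u \<and> a \<noteq> 0 \<and> b \<noteq> 0 \<and> \<Phi> u a = z * \<Phi> u b \<and> \<gamma> = v a - v b)" for z \<gamma>
  have QI: "Q z (v a - v b)" if "a \<in> A u" "b \<in> A u" "a \<noteq> 0" "b \<noteq> 0" "\<Phi> u a = z * \<Phi> u b" for z u a b
    using that unfolding Q_def by blast
  have ex: "\<exists>\<gamma>. Q z \<gamma>" if z: "z \<noteq> 0" for z
  proof -
    obtain u a b where ab: "a \<in> A u" "b \<in> A u" "b \<noteq> 0" "\<Phi> u a = z * \<Phi> u b" using Phi_quotient by blast
    then have "a \<noteq> 0" using Phi_nz[OF ab(2,3)] z by auto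
    then show ?thesis using QI ab by blast
  qed
  have unique: "\<gamma> = \<gamma>'" if q: "Q z \<gamma>" "Q z \<gamma>'" for z \<gamma> \<gamma>'
  proof -
    obtain u a b where 1: "a \<in> A u" "b \<in> A u" "a \<noteq> 0" "b \<noteq> 0" "\<Phi> u a = z * \<Phi> u b" "\<gamma> = v a - v b" using q(1) unfolding Q_def by blast
    obtain u' a' b' where 2: "a' \<in> A u'" "b' \<in> A u'" "a' \<noteq> 0" "b' \<noteq> 0" "\<Phi> u' a' = z * \<Phi> u' b'" "\<gamma>' = v a' - v b'" using q(2) unfolding Q_def by blast
    have "\<Phi> (u + u') (a * b') = \<Phi> (u + u') (b * a')"
      using 1 2 by (simp add: Phi_mult)
    then have "a * b' = b * a'" by (rule Phi_inj[OF A_mult[OF 1(1) 2(2)] A_mult[OF 1(2) 2(1)]])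
    then have "v a + v b' = v b + v a'" using vD(2)[OF 1(3) 2(4)] vD(2)[OF 1(4) 2(3)] by simp
    then show ?thesis unfolding 1(6) 2(6) by (simp add: algebra_simps)
  qed
  define \<nu> where "\<nu> z = (SOME \<gamma>. Q z \<gamma>)" for z
  have \<nu>: "Q z (\<nu> z)" if "z \<noteq> 0" for z unfolding \<nu>_def by (rule someI_ex[OF ex[OF that]])
  have \<nu>_eq: "\<nu> z = \<gamma>" if "z \<noteq> 0" "Q z \<gamma>" for z \<gamma> using unique[OF \<nu>[OF that(1)] that(2)] .
  have const: "\<nu> (to_fract [:c:]) = 0" if c: "c \<noteq> 0" for c
  proof (rule \<nu>_eq)
    have "Q (const_fract c) (v (\<iota> c) - v 1)"
      using c by (intro QI[OF iota_in_A one_in_A]) (simp_all add: Phi_iota Phi_1)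
    then show "Q (const_fract c) 0" using vD(1)[OF c] vD(1)[of 1] by (simp add: iotaD)
  qed (use c in simp)
  have mult: "\<nu> (y * z) = \<nu> y + \<nu> z" if yz: "y \<noteq> 0" "z \<noteq> 0" for y z
  proof (rule \<nu>_eq)
    obtain u a b where 1: "a \<in> A u" "b \<in> A u" "a \<noteq> 0" "b \<noteq> 0" "\<Phi> u a = y * \<Phi> u b" "\<nu> y = v a - v b" using \<nu>[OF yz(1)] unfolding Q_def by blast
    obtain u' a' b' where 2: "a' \<in> A u'" "b' \<in> A u'" "a' \<noteq> 0" "b' \<noteq> 0" "\<Phi> u' a' = z * \<Phi> u' b'" "\<nu> z = v a' - v b'" using \<nu>[OF yz(2)] unfolding Q_def by blast
    have "Q (y * z) (v (a * a') - v (b * b'))"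
      by (rule QI[OF A_mult[OF 1(1) 2(1)] A_mult[OF 1(2) 2(2)]]) (use 1 2 in \<open>simp_all add: Phi_mult\<close>)
    moreover have "v (a * a') - v (b * b') = \<nu> y + \<nu> z"
      using vD(2)[OF 1(3) 2(3)] vD(2)[OF 1(4) 2(4)] 1(6) 2(6) by simp
    ultimately show "Q (y * z) (\<nu> y + \<nu> z)" by simp
  qed (use yz in simp)
  have add: "min (\<nu> y) (\<nu> z) \<le> \<nu> (y + z)" if yz: "y \<noteq> 0" "z \<noteq> 0" "y + z \<noteq> 0" for y z
  proof -
    obtain u a b where 1: "a \<in> A u" "b \<in> A u" "a \<noteq> 0" "b \<noteq> 0" "\<Phi> u a = y * \<Phi> u b" "\<nu> y = v a - v b" using \<nu>[OF yz(1)] unfolding Q_def by blast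
    obtain u' a' b' where 2: "a' \<in> A u'" "b' \<in> A u'" "a' \<noteq> 0" "b' \<noteq> 0" "\<Phi> u' a' = z * \<Phi> u' b'" "\<nu> z = v a' - v b'" using \<nu>[OF yz(2)] unfolding Q_def by blast
    have in1: "a * b' \<in> A (u + u')" "b * a' \<in> A (u + u')" "b * b' \<in> A (u + u')"
      using 1 2 by (auto intro: A_mult)
    have e1: "\<Phi> (u + u') (a * b' + b * a') = (y + z) * \<Phi> (u + u') (b * b')"
    proof -
      have "\<Phi> (u + u') (a * b' + b * a') = \<Phi> u a * \<Phi> u' b' + \<Phi> u b * \<Phi> u' a'"
        unfolding Phi_add[OF in1(1,2)] Phi_mult[OF 1(1) 2(2)] Phi_mult[OF 1(2) 2(1)] ..
      also have "\<dots> = (y + z) * (\<Phi> u b * \<Phi> u' b')" unfolding 1(5) 2(5) by (simp add: algebra_simps)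
      finally show ?thesis unfolding Phi_mult[OF 1(2) 2(2)] .
    qed
    have bb: "b * b' \<noteq> 0" using 1 2 by simp
    have nz: "a * b' + b * a' \<noteq> 0"
    proof
      assume "a * b' + b * a' = 0"
      then have "(y + z) * \<Phi> (u + u') (b * b') = 0" using e1 by simp
      then show False using yz(3) Phi_nz[OF in1(3) bb] by simp
    qed
    have "Q (y + z) (v (a * b' + b * a') - v (b * b'))"
      by (rule QI[OF A_add[OF in1(1,2)] in1(3) nz bb e1])
    then have e2: "\<nu> (y + z) = v (a * b' + b * a') - v (b * b')" using \<nu>_eq yz(3) by blast
    have "min (v (a * b')) (v (b * a')) \<le> v (a * b' + b * a')" using 1 2 nz by (intro vD(3)) auto
    moreover have "v (a * b') = \<nu> y + v (b * b')" "v (b * a') = \<nu> z + v (b * b')"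
      using vD(2)[OF 1(3) 2(4)] vD(2)[OF 1(4) 2(3)] vD(2)[OF 1(4) 2(4)] 1(6) 2(6) by (simp_all add: algebra_simps)
    ultimately have "min (\<nu> y + v (b * b')) (\<nu> z + v (b * b')) \<le> v (a * b' + b * a')" by simp
    then have "min (\<nu> y) (\<nu> z) + v (b * b') \<le> v (a * b' + b * a')" by (simp add: min_add_distrib_left)
    then show ?thesis unfolding e2 by (simp add: le_diff_eq)
  qed
  obtain x c where xc: "\<And>z. z \<noteq> 0 \<Longrightarrow> \<nu> z = zscale (ord_at x z) c"
    using valuation_of_function_field[of \<nu>, OF const mult add] by blast
  have "v f = v g" if fg: "f \<in> A u" "g \<in> A u" "f \<noteq> 0" "g \<noteq> 0" "ord_at x (\<Phi> u f) = ord_at x (\<Phi> u g)" for u f g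
  proof -
    note nz = Phi_nz[OF fg(1,3)] Phi_nz[OF fg(2,4)]
    define z where "z = \<Phi> u f / \<Phi> u g"
    have z: "z \<noteq> 0" "\<Phi> u f = z * \<Phi> u g" using nz by (simp_all add: z_def)
    have "\<nu> z = v f - v g" using \<nu>_eq[OF z(1) QI[OF fg(1-4) z(2)]] .
    moreover have "ord_at x z = 0" unfolding z_def using nz fg(5) by (simp add: ord_at_divide)
    ultimately show ?thesis using xc[OF z(1)] by simp
  qed
  then show ?thesis by blast
qed

end

subsection \<open>Monomials on the embedded line\<close>

fun form_vanishing_at :: "'k::field P1 \<Rightarrow> 'k \<times> 'k" where
  "form_vanishing_at (Some a) = (1, - a)"
| "form_vanishing_at None = (0, 1)"

lemma linear_embedding_points:
  fixes P :: "nat \<Rightarrow> 'k::field P1"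
  assumes "1 \<le> m" "inj_on P {..m}"
  shows "linear_embedding m P (\<lambda>i. form_vanishing_at (P i))"
  unfolding linear_embedding_def
proof (intro conjI allI impI)
  fix s t :: 'k assume z: "\<forall>i\<le>m. linear_form (form_vanishing_at (P i)) (s, t) = 0"
  have ne: "P 0 \<noteq> P 1" using assms by (auto simp: inj_on_def)
  have 0: "linear_form (form_vanishing_at (P 0)) (s, t) = 0" and 1: "linear_form (form_vanishing_at (P 1)) (s, t) = 0"
    using z assms(1) by auto
  have "s = 0 \<and> t = 0"
  proof (cases "P 0")
    case None
    then obtain b where b: "P 1 = Some b" using ne by (cases "P 1") auto
    show ?thesis using 0 1 None b by simp
  next
    case (Some a)
    show ?thesis
    proof (cases "P 1")
      case None then show ?thesis using 0 1 Some by simp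
    next
      case Some': (Some b)
      have ab: "a - b \<noteq> 0" using ne Some Some' by auto
      have "s = a * t" "s = b * t" using 0 1 Some Some' by simp_all
      then have "a * t = b * t" by metis
      then have "a * t - b * t = 0" by (simp only: right_minus_eq)
      then have "(a - b) * t = 0" by (simp only: left_diff_distrib)
      with ab have "t = 0" by (metis mult_eq_0_iff)
      then show ?thesis using \<open>s = a * t\<close> by simp
    qed
  qed
  then show "s = 0" "t = 0" by auto
next
  fix i assume "i \<le> m"
  have "linear_form (form_vanishing_at p) (hom_coords x) = 0 \<longleftrightarrow> x = p" for p x :: "'k P1"
    by (cases p; cases x) auto
  then show "{x. linear_form (form_vanishing_at (P i)) (hom_coords x) = 0} = {P i}" by auto
qed

lemma affine_form_nz: "affine_form (form_vanishing_at p) \<noteq> 0"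
  by (cases p) (auto simp: affine_form_def)

lemma poly_ord_affine_form:
  "poly_ord x (affine_form (form_vanishing_at p)) = (if x = p then 1 else 0) - (if x = None then 1 else 0)"
proof (cases p)
  case (Some a)
  then show ?thesis using poly_ord_linear[of x a] by (simp add: affine_form_def)
next
  case None
  have "poly_ord x [:1:] = 0" by (cases x) (auto intro: order_0I)
  then show ?thesis using None by (auto simp: affine_form_def)
qed

lemma z_coord_nz: "z_coord (\<lambda>i. form_vanishing_at (P i)) j \<noteq> 0"
  unfolding z_coord_def by (simp add: Fract_conv_to_fract affine_form_nz)

lemma ord_z_coord:
  "ord_at x (z_coord (\<lambda>i. form_vanishing_at (P i)) j) = (if x = P j then 1 else 0) - (if x = P 0 then 1 else 0)"
  unfolding z_coord_def by (subst ord_at_Fract) (simp_all add: affine_form_nz poly_ord_affine_form)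

text \<open>
  The restriction of \<open>z\<^sup>a\<close> to the embedded line. Every divisor of degree 0 supported in the marked
  points is the divisor of exactly one such monomial; its multiplicities are the entries of
  \<open>full_exponent\<close>, where the one at \<open>P 0\<close> comes from the common denominator \<open>y\<^sub>0\<close> of the
  coordinates.
\<close>

definition line_monomial :: "nat \<Rightarrow> (nat \<Rightarrow> 'k::field P1) \<Rightarrow> (nat \<Rightarrow>\<^sub>0 int) \<Rightarrow> 'k poly fract" where
  "line_monomial m P a = (\<Prod>j=1..m. z_coord (\<lambda>i. form_vanishing_at (P i)) j powi Poly_Mapping.lookup a j)"

definition full_exponent :: "nat \<Rightarrow> (nat \<Rightarrow>\<^sub>0 int) \<Rightarrow> nat \<Rightarrow> int" where
  "full_exponent m a i = (if i = 0 then - (\<Sum>j=1..m. Poly_Mapping.lookup a j) else Poly_Mapping.lookup a i)"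

lemma line_monomial_nz: "line_monomial m P a \<noteq> 0"
  unfolding line_monomial_def by (simp add: z_coord_nz)

lemma line_monomial_add: "line_monomial m P (a + b) = line_monomial m P a * line_monomial m P b"
  unfolding line_monomial_def by (simp add: lookup_add power_int_add z_coord_nz prod.distrib)

lemma ord_line_monomial:
  "ord_at x (line_monomial m P a) = (\<Sum>j=1..m. Poly_Mapping.lookup a j * ((if x = P j then 1 else 0) - (if x = P 0 then 1 else 0)))"
  unfolding line_monomial_def
  by (subst ord_at_prod) (simp_all add: z_coord_nz ord_at_power_int ord_z_coord)

lemma ord_line_monomial_point:
  assumes "inj_on P {..m}" "i \<le> m"
  shows "ord_at (P i) (line_monomial m P a) = full_exponent m a i"
proof -
  have eq: "P i = P j \<longleftrightarrow> i = j" if "j \<le> m" for j using assms that by (auto simp: inj_on_def)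
  have "ord_at (P i) (line_monomial m P a) =
    (\<Sum>j=1..m. if i = j then Poly_Mapping.lookup a j else 0) - (\<Sum>j=1..m. if i = 0 then Poly_Mapping.lookup a j else 0)"
    unfolding ord_line_monomial sum_subtractf[symmetric] using eq by (intro sum.cong) auto
  also have "\<dots> = full_exponent m a i" using assms(2) by (auto simp: full_exponent_def)
  finally show ?thesis .
qed

lemma ord_line_monomial_other: "x \<notin> P ` {..m} \<Longrightarrow> ord_at x (line_monomial m P a) = 0"
  unfolding ord_line_monomial by (intro sum.neutral) auto

lemma restrict_character: "restrict_to_line m (\<lambda>i. form_vanishing_at (P i)) (character (u, a)) = Poly_Mapping.single u (line_monomial m P a)"
  by (simp add: restrict_to_line_def character_def line_monomial_def const_fract_1)

lemma cone_generated_base: "g \<in> G \<Longrightarrow> g \<in> cone_generated G"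
  unfolding cone_generated_def by (rule CollectI, rule exI[of _ "{g}"], rule exI[of _ "\<lambda>_. 1"]) auto

text \<open>
  It suffices to test the generators of the cone; pairing \<open>a\<close> with the \<open>i\<close>-th basis vector gives
  the order of \<open>z\<^sup>a\<close> at \<open>P i\<close>.
\<close>

lemma semigroup_C_iff:
  "(u, a) \<in> semigroup_C \<sigma> m \<Delta> \<longleftrightarrow> Poly_Mapping.keys a \<subseteq> {1..m} \<and> u \<in> dual_cone_lattice \<sigma> \<and>
     (\<forall>i\<le>m. \<forall>v\<in>\<Delta> i. 0 \<le> v u + of_int (full_exponent m a i))"
proof -
  define pr where "pr g = fst g u + (\<Sum>j=1..m. snd g j * of_int (Poly_Mapping.lookup a j))" for g :: "('a \<Rightarrow> rat) \<times> (nat \<Rightarrow> rat)"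
  define G where "G = \<sigma> \<times> {\<lambda>_. 0} \<union> (\<Union>i\<le>m. \<Delta> i \<times> {basis_vector m i})"
  have "(\<forall>g\<in>cone_generated G. 0 \<le> pr g) \<longleftrightarrow> (\<forall>g\<in>G. 0 \<le> pr g)"
  proof
    assume *: "\<forall>g\<in>G. 0 \<le> pr g"
    show "\<forall>g\<in>cone_generated G. 0 \<le> pr g"
    proof
      fix g assume "g \<in> cone_generated G"
      then obtain F c where F: "finite F" "F \<subseteq> G" "\<forall>g\<in>F. 0 \<le> c g"
        "g = ((\<lambda>u. \<Sum>g\<in>F. c g * fst g u), (\<lambda>j. \<Sum>g\<in>F. c g * snd g j))" unfolding cone_generated_def by blast
      have "(\<Sum>j=1..m. (\<Sum>g\<in>F. c g * snd g j) * of_int (Poly_Mapping.lookup a j)) =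
        (\<Sum>g\<in>F. \<Sum>j=1..m. c g * snd g j * of_int (Poly_Mapping.lookup a j))"
        by (subst sum.swap) (simp add: sum_distrib_right)
      then have "pr g = (\<Sum>g\<in>F. c g * pr g)"
        unfolding F(4) pr_def by (simp add: sum.distrib distrib_left sum_distrib_left mult.assoc)
      also have "\<dots> \<ge> 0" using F * by (intro sum_nonneg mult_nonneg_nonneg) auto
      finally show "0 \<le> pr g" .
    qed
  qed (use cone_generated_base in blast)
  moreover have "pr (v, \<lambda>_. 0) = v u" for v by (simp add: pr_def)
  moreover have "pr (v, basis_vector m i) = v u + of_int (full_exponent m a i)" if i: "i \<le> m" for v i
  proof (cases "i = 0")
    case True
    have "(\<Sum>j=1..m. basis_vector m i j * of_int (Poly_Mapping.lookup a j)) = (\<Sum>j=1..m. - rat_of_int (Poly_Mapping.lookup a j))"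
      using True by (intro sum.cong) (auto simp: basis_vector_def)
    then show ?thesis using True by (simp add: pr_def full_exponent_def sum_negf)
  next
    case False
    have "(\<Sum>j=1..m. basis_vector m i j * of_int (Poly_Mapping.lookup a j)) = (\<Sum>j=1..m. if j = i then rat_of_int (Poly_Mapping.lookup a j) else 0)"
      using False by (intro sum.cong) (auto simp: basis_vector_def)
    then show ?thesis using False i by (simp add: pr_def full_exponent_def)
  qed
  ultimately have "(\<forall>g\<in>cone_generated G. 0 \<le> pr g) \<longleftrightarrow> (\<forall>v\<in>\<sigma>. 0 \<le> v u) \<and> (\<forall>i\<le>m. \<forall>v\<in>\<Delta> i. 0 \<le> v u + of_int (full_exponent m a i))"
    unfolding G_def by (auto simp: ball_Un)
  then show ?thesis
    unfolding semigroup_C_def cone_C_def dual_cone_lattice_def G_def[symmetric]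
    by (simp add: pr_def split_beta)
qed

context divisor_model
begin

lemma semigroup_C_sections:
  "(u, a) \<in> semigroup_C weight_cone m (\<lambda>i. \<Delta> i) \<longleftrightarrow> Poly_Mapping.keys a \<subseteq> {1..m} \<and>
     u \<in> dual_cone_lattice weight_cone \<and> divisor_bound coefficient u (line_monomial m P a)"
proof -
  have "divisor_bound coefficient u (line_monomial m P a) \<longleftrightarrow> (\<forall>i\<le>m. \<forall>v\<in>\<Delta> i. 0 \<le> v u + of_int (full_exponent m a i))"
    if u: "u \<in> dual_cone_lattice weight_cone"
  proof
    assume *: "divisor_bound coefficient u (line_monomial m P a)"
    show "\<forall>i\<le>m. \<forall>v\<in>\<Delta> i. 0 \<le> v u + of_int (full_exponent m a i)"
    proof (intro allI impI ballI)
      fix i v assume "i \<le> m" "v \<in> \<Delta> i"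
      then have "- rat_of_int (full_exponent m a i) \<le> v u"
        using *[unfolded divisor_bound_def, rule_format, of v "P i"] ord_line_monomial_point[OF P_inj, of i a] by simp
      then show "0 \<le> v u + of_int (full_exponent m a i)" by linarith
    qed
  next
    assume *: "\<forall>i\<le>m. \<forall>v\<in>\<Delta> i. 0 \<le> v u + of_int (full_exponent m a i)"
    show "divisor_bound coefficient u (line_monomial m P a)"
      unfolding divisor_bound_def
    proof (intro allI ballI)
      fix x v assume v: "v \<in> coefficient x"
      show "- of_int (ord_at x (line_monomial m P a)) \<le> v u"
      proof (cases "x \<in> P ` {..m}")
        case True
        then obtain i where i: "i \<le> m" "x = P i" by auto
        then have "0 \<le> v u + of_int (full_exponent m a i)" using * v by blast
        then show ?thesis using ord_line_monomial_point[OF P_inj i(1), of a] i(2) by simp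
      next
        case False
        then have "v \<in> weight_cone" using v coefficient_other by simp
        then show ?thesis using u ord_line_monomial_other[OF False, of a] by (simp add: dual_cone_lattice_def)
      qed
    qed
  qed
  then show ?thesis unfolding semigroup_C_iff by blast
qed

text \<open>
  The dual descriptions turn the conditions of \<open>semigroup_C_iff\<close> into finitely many integral
  inequalities, to which Gordan's lemma applies. The coordinates on \<open>M \<times> \<int>\<^sup>m\<close> form the separating
  family \<open>C\<close>.
\<close>

lemma semigroup_C_finitely_generated:
  "\<exists>G. finite G \<and> semigroup_generated G = semigroup_C weight_cone m (\<lambda>i. \<Delta> i)"
proof -
  obtain L0 where L0: "dual_description H deg (\<lambda>_. 0) L0" using dual_description_of_cone[OF B finH] by blast
  have "\<forall>i. \<exists>L. dual_description H deg (gen_ord (P i)) L" using dual_description_of_cone[OF B finH] by blast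
  from choice[OF this] obtain L where L: "\<And>i. dual_description H deg (gen_ord (P i)) (L i)" by blast
  define fn where "fn i w = (\<lambda>(u, a). fst w u + snd w * full_exponent m a i)" for i and w :: "('m \<Rightarrow> int) \<times> int"
  define fn0 where "fn0 w = (\<lambda>(u, a::nat \<Rightarrow>\<^sub>0 int). fst w u)" for w :: "('m \<Rightarrow> int) \<times> int"
  define I where "I = {..m}"
  define LL where "LL = fn0 ` L0 \<union> (\<Union>i\<in>I. fn i ` L i)"
  define X :: "('m \<times> (nat \<Rightarrow>\<^sub>0 int)) set" where "X = {(u, a). Poly_Mapping.keys a \<subseteq> {1..m}}"
  define C where "C = (\<lambda>b (u, a::nat \<Rightarrow>\<^sub>0 int). coords B u b) ` B \<union> (\<lambda>j (u::'m, a). Poly_Mapping.lookup a j) ` {1..m}"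
  have full_add: "full_exponent m (a + b) i = full_exponent m a i + full_exponent m b i" for a b i
    by (simp add: full_exponent_def lookup_add sum.distrib)
  have dual: "x \<in> dual_cone_lattice weight_cone \<longleftrightarrow> (\<forall>w\<in>L0. 0 \<le> fst w x)" for x
    using dual_cone_iff[OF L0, of x] unfolding weight_cone_def by fastforce
  have bound: "(\<forall>v\<in>\<Delta> i. 0 \<le> v x + of_int n) \<longleftrightarrow> (\<forall>w\<in>L i. 0 \<le> fst w x + snd w * n)"
    if "x \<in> dual_cone_lattice weight_cone" for x n i
    using dual_description_bound[OF L, of x i n] that unfolding coefficient_def weight_cone_def by fastforce
  have "\<exists>G. finite G \<and> semigroup_generated G = {x\<in>X. \<forall>l\<in>LL. 0 \<le> l x}"
  proof (rule gordan)
    show "finite LL" using dual_descriptionD(1)[OF L0] dual_descriptionD(1)[OF L] by (auto simp: LL_def I_def)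
    show "additive l" if "l \<in> LL" for l
    proof -
      have a0: "additive (fn0 w)" if "w \<in> L0" for w
        using additive.add[OF dual_descriptionD(2)[OF L0, of "fst w" "snd w"]] that
        by (auto simp: additive_def fn0_def split_beta)
      have a1: "additive (fn i w)" if "w \<in> L i" for i w
        using additive.add[OF dual_descriptionD(2)[OF L, of "fst w" "snd w"]] that
        by (auto simp: additive_def fn_def split_beta full_add algebra_simps)
      show ?thesis using that a0 a1 by (auto simp: LL_def)
    qed
    show "finite C" using B by (simp add: C_def lattice_basis_def)
    show "additive l" if "l \<in> C" for l
      using that by (auto simp: C_def additive_def split_beta coords_add[OF B] lookup_add)
    show "0 \<in> X" by (simp add: X_def zero_prod_def)
    show "x - y \<in> X" if "x \<in> X" "y \<in> X" for x y
    proof -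
      have "Poly_Mapping.keys (snd x - snd y) \<subseteq> Poly_Mapping.keys (snd x) \<union> Poly_Mapping.keys (snd y)"
        by (auto simp: in_keys_iff lookup_minus)
      moreover have "Poly_Mapping.keys (snd x) \<subseteq> {1..m}" "Poly_Mapping.keys (snd y) \<subseteq> {1..m}"
        using that by (auto simp: X_def)
      ultimately have "Poly_Mapping.keys (snd (x - y)) \<subseteq> {1..m}" unfolding snd_diff by blast
      then show ?thesis by (simp add: X_def split_beta)
    qed
    show "x = 0" if x: "x \<in> X" "\<forall>l\<in>C. l x = 0" for x
    proof -
      obtain u a where ua: "x = (u, a)" by fastforce
      have "coords B u b = coords B 0 b" if "b \<in> B" for b
      proof -
        have "(\<lambda>(u, a::nat \<Rightarrow>\<^sub>0 int). coords B u b) \<in> C" using that by (simp add: C_def)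
        from bspec[OF x(2) this] show ?thesis by (simp add: ua coords_0)
      qed
      then have "u = 0" by (rule coords_eqI[OF B])
      moreover have "a = 0"
      proof (rule poly_mapping_eqI)
        fix j
        show "Poly_Mapping.lookup a j = Poly_Mapping.lookup 0 j"
        proof (cases "j \<in> {1..m}")
          case True
          then have "(\<lambda>(u::'m, a). Poly_Mapping.lookup a j) \<in> C" by (auto simp: C_def)
          from bspec[OF x(2) this] show ?thesis by (simp add: ua)
        next
          case False
          then have "j \<notin> Poly_Mapping.keys a" using x(1) ua by (auto simp: X_def)
          then show ?thesis by (simp add: in_keys_iff)
        qed
      qed
      ultimately show ?thesis using ua by (simp add: zero_prod_def)
    qed
  qed
  moreover have "{x\<in>X. \<forall>l\<in>LL. 0 \<le> l x} = semigroup_C weight_cone m (\<lambda>i. \<Delta> i)"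
  proof (rule Set.set_eqI)
    fix x :: "'m \<times> (nat \<Rightarrow>\<^sub>0 int)"
    obtain u a where ua: "x = (u, a)" by fastforce
    have "(\<forall>l\<in>LL. 0 \<le> l x) \<longleftrightarrow> (\<forall>w\<in>L0. 0 \<le> fst w u) \<and> (\<forall>i\<in>I. \<forall>w\<in>L i. 0 \<le> fst w u + snd w * full_exponent m a i)"
    proof -
      have "(\<forall>l\<in>LL. 0 \<le> l x) \<longleftrightarrow> (\<forall>w\<in>L0. 0 \<le> fn0 w x) \<and> (\<forall>i\<in>I. \<forall>w\<in>L i. 0 \<le> fn i w x)"
        unfolding LL_def by blast
      then show ?thesis by (simp add: ua fn0_def fn_def)
    qed
    also have "\<dots> \<longleftrightarrow> u \<in> dual_cone_lattice weight_cone \<and> (\<forall>i\<in>I. \<forall>v\<in>\<Delta> i. 0 \<le> v u + of_int (full_exponent m a i))"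
      unfolding dual[symmetric] using bound by blast
    also have "\<dots> \<longleftrightarrow> u \<in> dual_cone_lattice weight_cone \<and> (\<forall>i\<le>m. \<forall>v\<in>\<Delta> i. 0 \<le> v u + of_int (full_exponent m a i))"
      unfolding I_def by blast
    finally show "x \<in> {x\<in>X. \<forall>l\<in>LL. 0 \<le> l x} \<longleftrightarrow> x \<in> semigroup_C weight_cone m (\<lambda>i. \<Delta> i)"
      unfolding ua semigroup_C_iff by (auto simp: X_def)
  qed
  ultimately show ?thesis by simp
qed

text \<open>
  The orders of \<open>\<Phi> u f\<close> at the marked points satisfy the bounds of the polyhedral divisor and add
  up to at most 0. Raising the one at a marked point \<open>i0 \<noteq> k\<close> until the sum is 0 keeps the bounds
  and the order at \<open>P k\<close>; this is where two marked points are needed.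
\<close>

lemma monomial_with_given_order:
  assumes f: "f \<in> A u" "f \<noteq> 0" and k: "k \<le> m"
  shows "\<exists>a. (u, a) \<in> semigroup_C weight_cone m (\<lambda>i. \<Delta> i) \<and>
    ord_at (P k) (line_monomial m P a) = ord_at (P k) (\<Phi> u f)"
proof -
  define z where "z = \<Phi> u f"
  have z: "z \<noteq> 0" using Phi_nz[OF f] by (simp add: z_def)
  have u: "u \<in> dual_cone_lattice weight_cone" by (rule degree_in_dual_cone[OF f])
  have bd: "divisor_bound coefficient u z" unfolding z_def by (rule homogeneous_bound[OF f])
  define n where "n i = ord_at (P i) z" for i
  have out: "0 \<le> ord_at x z" if "x \<notin> P ` {..m}" for x
    using bd zero_in_cone coefficient_other[OF that] by (force simp: divisor_bound_def)
  have "(\<Sum>i\<le>m. n i) = (\<Sum>x\<in>P ` {..m}. ord_at x z)" using P_inj by (simp add: sum.reindex n_def)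
  also have "\<dots> \<le> 0" by (rule sum_ord_le_0[OF z]) (use out in auto)
  finally have le: "(\<Sum>i\<le>m. n i) \<le> 0" .
  obtain i0 where i0: "i0 \<le> m" "i0 \<noteq> k" using m1 by (cases "k = 0") (auto intro: that[of 0] that[of 1])
  define e where "e i = (if i = i0 then n i0 - (\<Sum>i\<le>m. n i) else n i)" for i
  have e_ge: "n i \<le> e i" for i using le by (simp add: e_def)
  have "(\<Sum>i\<le>m. e i) = e i0 + (\<Sum>i\<in>{..m} - {i0}. e i)" using i0 by (intro sum.remove) auto
  also have "(\<Sum>i\<in>{..m} - {i0}. e i) = (\<Sum>i\<in>{..m} - {i0}. n i)" by (intro sum.cong) (auto simp: e_def)
  also have "(\<Sum>i\<in>{..m} - {i0}. n i) = (\<Sum>i\<le>m. n i) - n i0" using i0 by (simp add: sum_diff1)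
  finally have e_sum: "(\<Sum>i\<le>m. e i) = 0" by (simp add: e_def)
  define a where "a = (\<Sum>j=1..m. Poly_Mapping.single j (e j))"
  have a: "Poly_Mapping.lookup a j = (if j \<in> {1..m} then e j else 0)" for j
  proof -
    have "Poly_Mapping.lookup a j = (\<Sum>i=1..m. if i = j then e i else 0)"
      unfolding a_def lookup_sum by (intro sum.cong) (auto simp: lookup_single)
    then show ?thesis by simp
  qed
  have "{..m} = insert 0 {1..m}" by auto
  then have "e 0 + (\<Sum>j=1..m. e j) = 0" using e_sum by simp
  then have full: "full_exponent m a i = e i" if "i \<le> m" for i
    using that a by (auto simp: full_exponent_def)
  have "(u, a) \<in> semigroup_C weight_cone m (\<lambda>i. \<Delta> i)"
    unfolding semigroup_C_iff
  proof (intro conjI allI impI ballI)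
    show "Poly_Mapping.keys a \<subseteq> {1..m}" by (auto simp: in_keys_iff a split: if_splits)
    show "u \<in> dual_cone_lattice weight_cone" by (rule u)
    fix i v assume i: "i \<le> m" and v: "v \<in> \<Delta> i"
    have "- rat_of_int (n i) \<le> v u" using bd v by (auto simp: divisor_bound_def n_def)
    moreover have "rat_of_int (n i) \<le> of_int (e i)" using e_ge by (simp only: of_int_le_iff)
    ultimately show "0 \<le> v u + of_int (full_exponent m a i)" unfolding full[OF i] by linarith
  qed
  moreover have "ord_at (P k) (line_monomial m P a) = ord_at (P k) z"
    using ord_line_monomial_point[OF P_inj k] full[OF k] i0 by (simp add: e_def n_def)
  ultimately show ?thesis unfolding z_def by blast
qed

text \<open>
  The value of \<open>z\<^sup>a \<chi>\<^sup>u\<close> is additive in \<open>(u, a)\<close>, so the values of the generators generate the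
  values of all these monomials, and every value of \<open>v\<close> is the value of one of them: it is the
  value of a homogeneous part, and there is a monomial of the same weight and the same order at
  \<open>P k\<close>.
\<close>

theorem khovanskii_basis_of_monomials:
  fixes v :: "'a \<Rightarrow> 'g::linordered_ab_group_add"
  assumes v: "valuation \<iota> v" and hv: "homogeneous_valuation A v"
    and k: "k \<le> m"
    and point: "\<And>u f g. f \<in> A u \<Longrightarrow> g \<in> A u \<Longrightarrow> f \<noteq> 0 \<Longrightarrow> g \<noteq> 0 \<Longrightarrow>
      ord_at (P k) (\<Phi> u f) = ord_at (P k) (\<Phi> u g) \<Longrightarrow> v f = v g"
    and G: "semigroup_generated G = semigroup_C weight_cone m (\<lambda>i. \<Delta> i)"
  shows "khovanskii_basis v (embedding_generators m (\<lambda>i. form_vanishing_at (P i)) (realize \<Phi>) G)"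
proof -
  note vD = valuationD[OF v]
  let ?S = "semigroup_C weight_cone m (\<lambda>i. \<Delta> i)"
  define mon where "mon s = inv_into UNIV (realize \<Phi>) (restrict_to_line m (\<lambda>i. form_vanishing_at (P i)) (character s))" for s
  have mon: "mon (u, a) \<in> A u" "\<Phi> u (mon (u, a)) = line_monomial m P a" "mon (u, a) \<noteq> 0" if s: "(u, a) \<in> ?S" for u a
  proof -
    obtain f where f: "f \<in> A u" "\<Phi> u f = line_monomial m P a"
      using section_realized[OF _ line_monomial_nz] s unfolding semigroup_C_sections by blast
    then have "realize \<Phi> f = Poly_Mapping.single u (line_monomial m P a)" by (simp add: realize_homogeneous)
    then have "mon (u, a) = inv_into UNIV (realize \<Phi>) (realize \<Phi> f)" by (simp add: mon_def restrict_character)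
    also have "\<dots> = f" by (rule inv_f_f) (rule injI, rule realize_inj)
    finally have mf: "mon (u, a) = f" .
    show "mon (u, a) \<in> A u" "\<Phi> u (mon (u, a)) = line_monomial m P a" using f mf by simp_all
    show "mon (u, a) \<noteq> 0" using f(2) line_monomial_nz[of m P a] unfolding mf by (metis Phi_0)
  qed
  have S0: "0 \<in> ?S" and S_add: "s \<in> ?S \<Longrightarrow> t \<in> ?S \<Longrightarrow> s + t \<in> ?S" for s t
  proof -
    show "0 \<in> ?S" unfolding G[symmetric] by (rule semigroup_generated_zero)
    have sub: "x + y \<in> semigroup_generated G" if xy: "x \<in> semigroup_generated G" "y \<in> semigroup_generated G" for x y
    proof -
      obtain xs ys where "xs \<in> lists G" "x = sum_list xs" "ys \<in> lists G" "y = sum_list ys"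
        using xy unfolding semigroup_generated_def by blast
      then show ?thesis unfolding semigroup_generated_def by (intro image_eqI[of _ _ "xs @ ys"]) auto
    qed
    show "s \<in> ?S \<Longrightarrow> t \<in> ?S \<Longrightarrow> s + t \<in> ?S" using sub unfolding G[symmetric] by blast
  qed
  have G_sub: "g \<in> ?S" if "g \<in> G" for g
    using semigroup_generated_add[OF that semigroup_generated_zero] unfolding G[symmetric] by simp
  have vmon_add: "v (mon (s + t)) = v (mon s) + v (mon t)" if st: "s \<in> ?S" "t \<in> ?S" for s t
  proof -
    obtain u a w b where s: "s = (u, a)" and t: "t = (w, b)" by fastforce
    note 1 = mon[OF st(1)[unfolded s]] and 2 = mon[OF st(2)[unfolded t]]
    have st': "(u + w, a + b) \<in> ?S" using S_add[OF st] s t by simp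
    have "mon (u + w, a + b) = mon (u, a) * mon (w, b)"
      by (rule Phi_inj[OF mon(1)[OF st'] A_mult[OF 1(1) 2(1)]])
         (simp add: mon(2)[OF st'] Phi_mult[OF 1(1) 2(1)] 1(2) 2(2) line_monomial_add)
    then show ?thesis using vD(2)[OF 1(3) 2(3)] s t by simp
  qed
  have mon0: "v (mon 0) = 0"
    using vmon_add[OF S0 S0] by simp
  have vsum: "v (mon (sum_list xs)) = sum_list (map (\<lambda>s. v (mon s)) xs) \<and> sum_list xs \<in> ?S" if "set xs \<subseteq> G" for xs
    using that
  proof (induction xs)
    case Nil
    then show ?case using mon0 S0 by simp
  next
    case (Cons x xs)
    then show ?case using vmon_add[of x "sum_list xs"] G_sub S_add by simp
  qed
  have gens_nz: "embedding_generators m (\<lambda>i. form_vanishing_at (P i)) (realize \<Phi>) G - {0} = mon ` G"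
  proof -
    have nz: "mon g \<noteq> 0" if "g \<in> G" for g using mon(3)[of "fst g" "snd g"] G_sub[OF that] by simp
    have "embedding_generators m (\<lambda>i. form_vanishing_at (P i)) (realize \<Phi>) G = mon ` G"
      unfolding embedding_generators_def mon_def ..
    moreover have "0 \<notin> mon ` G"
    proof
      assume "0 \<in> mon ` G"
      then obtain g where "g \<in> G" "mon g = 0" by (metis imageE)
      then show False using nz by simp
    qed
    ultimately show ?thesis by simp
  qed
  have "semigroup_generated (v ` mon ` G) = (\<lambda>s. v (mon s)) ` ?S"
  proof
    show "semigroup_generated (v ` mon ` G) \<subseteq> (\<lambda>s. v (mon s)) ` ?S"
    proof (rule semigroup_generated_least)
      show "v ` mon ` G \<subseteq> (\<lambda>s. v (mon s)) ` ?S" using G_sub by blast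
      show "0 \<in> (\<lambda>s. v (mon s)) ` ?S" using mon0 S0 by (metis image_eqI)
      fix x y assume "x \<in> (\<lambda>s. v (mon s)) ` ?S" "y \<in> (\<lambda>s. v (mon s)) ` ?S"
      then obtain s t where "s \<in> ?S" "t \<in> ?S" "x = v (mon s)" "y = v (mon t)" by blast
      then show "x + y \<in> (\<lambda>s. v (mon s)) ` ?S" using vmon_add S_add by (metis image_eqI)
    qed
    show "(\<lambda>s. v (mon s)) ` ?S \<subseteq> semigroup_generated (v ` mon ` G)"
    proof
      fix x assume "x \<in> (\<lambda>s. v (mon s)) ` ?S"
      then obtain xs where xs: "set xs \<subseteq> G" "x = v (mon (sum_list xs))"
        unfolding G[symmetric] semigroup_generated_def by (auto simp: lists_eq_set)
      then have "x = sum_list (map (\<lambda>s. v (mon s)) xs)" using vsum by simp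
      moreover have "set (map (\<lambda>s. v (mon s)) xs) \<subseteq> v ` mon ` G"
        using xs(1) by (simp add: image_image image_mono)
      then have "map (\<lambda>s. v (mon s)) xs \<in> lists (v ` mon ` G)" unfolding lists_eq_set by simp
      ultimately show "x \<in> semigroup_generated (v ` mon ` G)"
        unfolding semigroup_generated_def by (rule image_eqI)
    qed
  qed
  also have "\<dots> = value_semigroup v"
  proof
    show "(\<lambda>s. v (mon s)) ` ?S \<subseteq> value_semigroup v"
      using mon(3) by (auto simp: value_semigroup_def)
    show "value_semigroup v \<subseteq> (\<lambda>s. v (mon s)) ` ?S"
    proof
      fix x assume "x \<in> value_semigroup v"
      then obtain f where f: "f \<noteq> 0" "x = v f" by (auto simp: value_semigroup_def)
      obtain u where u: "u \<in> support f" "v f = v (part f u)" using value_of_homogeneous_part[OF hv f(1)] by blast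
      have p: "part f u \<in> A u" "part f u \<noteq> 0" using part_in u(1) by (auto simp: support_iff)
      obtain a where a: "(u, a) \<in> ?S" "ord_at (P k) (line_monomial m P a) = ord_at (P k) (\<Phi> u (part f u))"
        using monomial_with_given_order[OF p k] by blast
      note ma = mon[OF a(1)]
      have "v (mon (u, a)) = v (part f u)"
        by (rule point[OF ma(1) p(1) ma(3) p(2)]) (simp add: ma(2) a(2))
      then show "x \<in> (\<lambda>s. v (mon s)) ` ?S" using a(1) f(2) u(2) by (metis image_eqI)
    qed
  qed
  finally show ?thesis unfolding khovanskii_basis_def gens_nz .
qed

end

theorem theorem1p3:
  fixes \<iota> :: "'k::alg_closed_field \<Rightarrow> 'a::idom"
    and A :: "'m::ab_group_add \<Rightarrow> 'a set"
    and v :: "'a \<Rightarrow> 'g::linordered_ab_group_add"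
  assumes "affine_T_variety \<iota> A"
    and "rational_variety \<iota>"
    and "complexity_one A"
    and "valuation \<iota> v"
    and "full_rank v"
    and "homogeneous_valuation A v"
  shows "\<exists>\<sigma> m P \<Delta> l \<psi> H.
           semi_canonical_embedding \<iota> A \<sigma> m P \<Delta> l \<psi> H \<and>
           khovanskii_basis v (embedding_generators m l \<psi> H)"
proof -
  have graded: "graded_algebra \<iota> A" using assms(1) by (simp add: affine_T_variety_def graded_algebra_def)
  interpret graded_algebra \<iota> A by (rule graded)
  obtain \<Phi> where \<Phi>: "homogeneous_embedding \<Phi>" using homogeneous_embedding_exists[OF assms] by blast
  have eff: "effective_grading A" and fg: "finitely_generated_algebra \<iota>" and ic: "integrally_closed TYPE('a)"
    using assms(1) by (simp_all add: affine_T_variety_def)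
  obtain H where H: "finite H" "0 \<notin> H" "\<forall>h\<in>H. \<exists>u. h \<in> A u" "subring_set hull (range \<iota> \<union> H) = UNIV"
    using homogeneous_generators[OF fg] by blast
  from bchoice[OF H(3)] obtain deg where deg: "\<And>h. h \<in> H \<Longrightarrow> h \<in> A (deg h)" by blast
  obtain r where "free_of_rank (UNIV :: 'm set) r" using assms(3) by (auto simp: complexity_one_def)
  then obtain B :: "'m set" where B: "lattice_basis B" by (auto simp: free_of_rank_def lattice_basis_def)
  have weights: "\<exists>u w a b. a \<in> A u \<and> b \<in> A w \<and> a \<noteq> 0 \<and> b \<noteq> 0 \<and> m = u - w" for m
    by (rule weights_from_effective[OF eff])
  interpret emb: embedded_algebra \<iota> A \<Phi> by standard (fact \<Phi> weights)+
  interpret gen: generated_algebra \<iota> A \<Phi> H deg B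
    by standard (fact H(1,2,4) deg B ic)+
  obtain x0 where x0: "\<forall>u f g. f \<in> A u \<longrightarrow> g \<in> A u \<longrightarrow> f \<noteq> 0 \<longrightarrow> g \<noteq> 0 \<longrightarrow>
    ord_at x0 (\<Phi> u f) = ord_at x0 (\<Phi> u g) \<longrightarrow> v f = v g"
    using emb.valuation_is_order_at_point[OF assms(4)] by blast
  \<comment> \<open>Besides \<open>x0\<close> and the zeros and poles of the generators, two arbitrary points are marked to
    make sure that there are at least two.\<close>
  define S where "S = insert x0 {None, Some 0} \<union> (\<Union>h\<in>H. {x. gen.gen_ord x h \<noteq> 0})"
  have S: "finite S" unfolding S_def gen.gen_ord_def
    using H(1) finite_ord_support[OF gen.Phi_gen_nz] by auto
  have "card {None, Some (0::'k)} \<le> card S" by (rule card_mono[OF S]) (auto simp: S_def)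
  then have card: "2 \<le> card S" by simp
  define m where "m = card S - 1"
  have m: "1 \<le> m" "{..m} = {0..<card S}" using card by (auto simp: m_def)
  obtain P where P: "bij_betw P {..m} S" using ex_bij_betw_nat_finite[OF S] m(2) by metis
  then have PS: "P ` {..m} = S" "inj_on P {..m}" by (auto simp: bij_betw_def)
  interpret mod: divisor_model \<iota> A \<Phi> H deg B m P
  proof
    show "gen.gen_ord x h = 0" if "x \<notin> P ` {..m}" "h \<in> H" for x h
      using that unfolding PS(1) by (auto simp: S_def)
  qed (fact m(1) PS(2))+
  have "x0 \<in> P ` {..m}" unfolding PS(1) by (simp add: S_def)
  then obtain k where k: "k \<le> m" "P k = x0" by auto
  obtain G where G: "finite G" "semigroup_generated G = semigroup_C gen.weight_cone m (\<lambda>i. gen.coefficient (P i))"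
    using mod.semigroup_C_finitely_generated by blast
  have "semi_canonical_embedding \<iota> A gen.weight_cone m P (\<lambda>i. gen.coefficient (P i))
    (\<lambda>i. form_vanishing_at (P i)) (realize \<Phi>) G"
    unfolding semi_canonical_embedding_def
    using mod.polyhedral_divisor_model linear_embedding_points[OF m(1) PS(2)] mod.equivariant_iso_model G by blast
  moreover have "khovanskii_basis v (embedding_generators m (\<lambda>i. form_vanishing_at (P i)) (realize \<Phi>) G)"
    by (rule mod.khovanskii_basis_of_monomials[OF assms(4,6) k(1) _ G(2)]) (use x0 k(2) in blast)
  ultimately show ?thesis by blast
qed

end
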